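(* Let $S_1,\dots,S_{n/k}$ be $\pi$-avoiding sequences, each of length $k$. Then there is an algorithm that sorts all $S_i$'s in time $O((\log c_\pi+1)\cdot n)+2^{2^{O(k\log k)}}$, even if $\pi$ is a priori unknown.
   Context: Sequences are over a totally ordered set, accessed by comparisons. A permutation of length $k$ is a sequence $\pi_1,\dots,\pi_k$ containing each element of $[k]$ once. A sequence $s_1,\dots,s_n$ contains $\pi$ if there are indices $i_1<\dots<i_k$ with $s_{i_j}<s_{i_\ell}\iff\pi_j<\pi_\ell$ for all $j,\ell$; otherwise it avoids $\pi$. A binary matrix $M$ contains a binary matrix $P$ if $P$ arises from $M$ by deleting rows/columns and turning some 1-entries into $0$; $M$ avoids $\pi$ if it does not contain the permutation matrix of $\pi$ (1s exactly at positions (column $i$, row $\pi_i$)). $\mathrm{ex}_\pi(n)$ is the maximum number of 1-entries of a $\pi$-avoiding $n\times n$ binary matrix and $c_\pi=\lim_{n\to\infty}\mathrm{ex}_\pi(n)/n$ (the Füredi–Hajnal limit). *)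

theory Defs
  imports
    Complex_Main
    "HOL-Library.Landau_Symbols"
    "Jordan_Normal_Form.DL_Submatrix"
begin

section \<open>Pattern avoidance\<close>

definition is_permutation :: "nat list \<Rightarrow> bool" where
  "is_permutation \<pi> \<longleftrightarrow> distinct \<pi> \<and> set \<pi> = {1..length \<pi>}"

text \<open>Sequences may have repeated entries; the embedding \<open>\<iota>\<close> has to reproduce the strict
  order of \<open>\<pi>\<close> exactly, so equal entries never realise two different entries of \<open>\<pi>\<close>.\<close>

definition seq_contains :: "'a::linorder list \<Rightarrow> nat list \<Rightarrow> bool" where
  "seq_contains s \<pi> \<longleftrightarrow>
     (\<exists>\<iota>::nat \<Rightarrow> nat. strict_mono_on {..<length \<pi>} \<iota> \<and>
        (\<forall>j<length \<pi>. \<iota> j < length s) \<and>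
        (\<forall>j<length \<pi>. \<forall>l<length \<pi>. s ! \<iota> j < s ! \<iota> l \<longleftrightarrow> \<pi> ! j < \<pi> ! l))"

abbreviation seq_avoids :: "'a::linorder list \<Rightarrow> nat list \<Rightarrow> bool" where
  "seq_avoids s \<pi> \<equiv> \<not> seq_contains s \<pi>"

text \<open>\<open>submatrix M I J\<close> deletes the rows outside \<open>I\<close> and the columns outside \<open>J\<close>.\<close>

definition mat_contains :: "bool mat \<Rightarrow> bool mat \<Rightarrow> bool" where
  "mat_contains M P \<longleftrightarrow>
     (\<exists>I J. dim_row (submatrix M I J) = dim_row P \<and> dim_col (submatrix M I J) = dim_col P \<and>
        (\<forall>r<dim_row P. \<forall>c<dim_col P. P $$ (r, c) \<longrightarrow> submatrix M I J $$ (r, c)))"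

text \<open>Rows and columns are numbered from 0 here, the values of \<open>\<pi>\<close> from 1.\<close>

definition perm_mat :: "nat list \<Rightarrow> bool mat" where
  "perm_mat \<pi> = mat (length \<pi>) (length \<pi>) (\<lambda>(r, c). \<pi> ! c = Suc r)"

abbreviation mat_avoids :: "bool mat \<Rightarrow> nat list \<Rightarrow> bool" where
  "mat_avoids M \<pi> \<equiv> \<not> mat_contains M (perm_mat \<pi>)"

definition num_ones :: "bool mat \<Rightarrow> nat" where
  "num_ones M = card {(r, c). r < dim_row M \<and> c < dim_col M \<and> M $$ (r, c)}"

definition ex_perm :: "nat list \<Rightarrow> nat \<Rightarrow> nat" where
  "ex_perm \<pi> n = Max (num_ones ` {M \<in> carrier_mat n n. mat_avoids M \<pi>})"

definition furedi_hajnal_limit :: "nat list \<Rightarrow> real" where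
  "furedi_hajnal_limit \<pi> = lim (\<lambda>n. real (ex_perm \<pi> n) / real n)"


section \<open>Comparison-based random access machine\<close>

text \<open>
  The machine has two infinite memories, one for natural numbers and one for elements of the
  ordered set, both with indirect addressing by numbers. Arithmetic is limited to addition and
  truncated subtraction. Elements can only be moved between element cells and compared with each
  other.

  Time is the unit-cost measure: each assignment and each evaluation of a test takes one step.
  Expressions are part of the program, so a step comprises at most a program-dependent constant
  number of elementary operations (in particular, of comparisons).
\<close>

datatype exp =
    Const nat
  | Mem exp
  | Plus exp exp
  | Minus exp exp

datatype test =
    Less exp exp
  | Elem_Less exp exp \<comment> \<open>compares the elements stored in the two addressed element cells\<close>
  | Not test
  | And test test

datatype com =
    Skip
  | Assign exp exp
  | Move exp exp \<comment> \<open>target address, source address, both in element memory\<close>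
  | Seq com com
  | If test com com
  | While test com

type_synonym 'a state = "(nat \<Rightarrow> nat) \<times> (nat \<Rightarrow> 'a)"

fun exp_val :: "exp \<Rightarrow> (nat \<Rightarrow> nat) \<Rightarrow> nat" where
  "exp_val (Const c) m = c"
| "exp_val (Mem a) m = m (exp_val a m)"
| "exp_val (Plus a b) m = exp_val a m + exp_val b m"
| "exp_val (Minus a b) m = exp_val a m - exp_val b m"

fun test_val :: "test \<Rightarrow> 'a::linorder state \<Rightarrow> bool" where
  "test_val (Less a b) (m, e) \<longleftrightarrow> exp_val a m < exp_val b m"
| "test_val (Elem_Less a b) (m, e) \<longleftrightarrow> e (exp_val a m) < e (exp_val b m)"
| "test_val (Not t) s \<longleftrightarrow> \<not> test_val t s"
| "test_val (And t u) s \<longleftrightarrow> test_val t s \<and> test_val u s"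

text \<open>\<open>exec P s T s'\<close>: started in \<open>s\<close>, the program \<open>P\<close> halts in \<open>s'\<close> after exactly \<open>T\<close> steps.\<close>

inductive exec :: "com \<Rightarrow> 'a::linorder state \<Rightarrow> nat \<Rightarrow> 'a state \<Rightarrow> bool" where
  Skip: "exec Skip s 1 s"
| Assign: "exec (Assign a b) (m, e) 1 (m(exp_val a m := exp_val b m), e)"
| Move: "exec (Move a b) (m, e) 1 (m, e(exp_val a m := e (exp_val b m)))"
| Seq: "exec P s T s' \<Longrightarrow> exec Q s' U s'' \<Longrightarrow> exec (Seq P Q) s (T + U) s''"
| If_True: "test_val t s \<Longrightarrow> exec P s T s' \<Longrightarrow> exec (If t P Q) s (Suc T) s'"
| If_False: "\<not> test_val t s \<Longrightarrow> exec Q s T s' \<Longrightarrow> exec (If t P Q) s (Suc T) s'"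
| While_False: "\<not> test_val t s \<Longrightarrow> exec (While t P) s 1 s"
| While_True: "test_val t s \<Longrightarrow> exec P s T s' \<Longrightarrow> exec (While t P) s' U s'' \<Longrightarrow>
    exec (While t P) s (Suc (T + U)) s''"

text \<open>
  Input: number cell 0 holds the number of sequences, number cell 1 their common length \<open>k\<close>, all
  other number cells are 0; entry \<open>j\<close> of the \<open>i\<close>-th sequence is in element cell \<open>i * k + j\<close>. The
  contents of the remaining element cells are arbitrary. Output: every sequence is sorted in place.
\<close>

definition sorts_all_in_time :: "com \<Rightarrow> nat \<Rightarrow> 'a::linorder list list \<Rightarrow> real \<Rightarrow> bool" where
  "sorts_all_in_time P k S B \<longleftrightarrow>
     (\<forall>e. (\<forall>i<length S. \<forall>j<k. e (i * k + j) = S ! i ! j) \<longrightarrow>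
        (\<exists>T m' e'. exec P ((\<lambda>_. 0)(0 := length S, 1 := k), e) T (m', e') \<and>
           real T \<le> B \<and>
           (\<forall>i<length S. map (\<lambda>j. e' (i * k + j)) [0..<k] = sort (S ! i))))"

end

theory Submission
  imports Defs "HOL-Library.Product_Lexorder"
begin

text \<open>
  The number memory holds one candidate decision tree of comparisons, whose leaves are sequences of
  transpositions. Every input sequence is run through the candidate, and gnome sort then checks and,
  if necessary, repairs the result. Whenever it had to repair something, the candidate is replaced
  by the next one in the enumeration of all trees by increasing depth. A tree that sorts all
  \<open>\<pi>\<close>-avoiding sequences is never replaced, so the number of failures is at most the number of trees
  up to the depth of the best such tree, and every other run costs time linear in that depth and
  \<open>k\<close>. The pattern is never consulted.

  By Fredman's argument some tree of depth \<open>O(log N + k)\<close> sorts all members of a set of \<open>N\<close> order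
  types. To bound \<open>N\<close>, contract the matrix of an order type repeatedly by blocks of size 2. Level \<open>i\<close>
  avoids \<open>\<pi>\<close> and has at most \<open>min k (c k / 2 ^ i)\<close> entries up to a constant factor, and each entry has
  at most 16 refinements, hence \<open>log N\<close> is \<open>O(k (log c + 1))\<close>. The limit \<open>c\<close> exists by the
  Marcus--Tardos theorem and superadditivity.
\<close>

section \<open>Bounded execution\<close>

text \<open>The cost per sequence may grow only with log c, while the cost of the search must depend
  on \<open>k\<close> alone. Both bounds come from one table of depth D = 2 (t + k), where t is the
  minimum of two bounds on log N. The refined count gives t = O(k (log c + 1)) and hence the linear
  term. The trivial count N <= k ^ k gives t = O(k log k); as a table of depth d has 2 ^ (d + k + 1)
  digits in base k, at most 2 ^ 2 ^ O(k log k) tables are tried. Since no candidate is deeper than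
  D, a failing run exceeds a successful one only by the repair and the step to the next candidate.
  The lack of multiplication shapes the encoding: heap numbering turns a move in the tree into a
  doubling, a leaf keeps its transpositions on the leftmost path below it, and the next tree is the
  increment of a base-k counter. Because entries may repeat, order types are lists of ranks instead
  of permutations. Their matrices may have several entries in a row, which does not disturb the
  count, as only the total number of entries is bounded.\<close>

definition halts :: "com \<Rightarrow> 'a::linorder state \<Rightarrow> nat \<Rightarrow> ('a state \<Rightarrow> bool) \<Rightarrow> bool" where
  "halts P s B Q \<longleftrightarrow> (\<exists>T s'. exec P s T s' \<and> T \<le> B \<and> Q s')"

lemma halts_mono:
  assumes "halts P s B Q" "B \<le> B'" "\<And>s'. Q s' \<Longrightarrow> Q' s'"
  shows "halts P s B' Q'"
  using assms unfolding halts_def by (meson le_trans)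

lemma halts_Skip: "Q s \<Longrightarrow> 1 \<le> B \<Longrightarrow> halts Skip s B Q"
  unfolding halts_def using exec.Skip by blast

lemma halts_Assign:
  "Q (m(exp_val a m := exp_val b m), e) \<Longrightarrow> 1 \<le> B \<Longrightarrow> halts (Assign a b) (m, e) B Q"
  unfolding halts_def using exec.Assign by blast

lemma halts_Move:
  "Q (m, e(exp_val a m := e (exp_val b m))) \<Longrightarrow> 1 \<le> B \<Longrightarrow> halts (Move a b) (m, e) B Q"
  unfolding halts_def using exec.Move by blast

text \<open>The claim about \<open>P'\<close> sits in the postcondition of \<open>P\<close>, so a
  program can be executed symbolically from left to right while the time bounds add up.\<close>

lemma halts_Seq:
  assumes "halts P s B (\<lambda>s'. halts P' s' B' Q)" "B + B' \<le> B''"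
  shows "halts (Seq P P') s B'' Q"
proof -
  obtain T s' U s'' where "exec P s T s'" "T \<le> B" "exec P' s' U s''" "U \<le> B'" "Q s''"
    using assms(1) unfolding halts_def by blast
  then show ?thesis
    unfolding halts_def using exec.Seq assms(2) by (meson add_mono le_trans)
qed

lemma halts_If:
  assumes "test_val t s \<Longrightarrow> halts P s B Q" "\<not> test_val t s \<Longrightarrow> halts P' s B Q" "Suc B \<le> B'"
  shows "halts (If t P P') s B' Q"
proof (cases "test_val t s")
  case True
  then obtain T s' where "exec P s T s'" "T \<le> B" "Q s'"
    using assms(1) unfolding halts_def by blast
  then show ?thesis
    unfolding halts_def using exec.If_True[OF True] assms(3) by (meson Suc_le_mono le_trans)
next
  case False
  then obtain T s' where "exec P' s T s'" "T \<le> B" "Q s'"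
    using assms(2) unfolding halts_def by blast
  then show ?thesis
    unfolding halts_def using exec.If_False[OF False] assms(3) by (meson Suc_le_mono le_trans)
qed

text \<open>Amortized analysis: \<open>\<Phi>\<close> bounds the remaining time, so the cost
  \<open>b\<close> of a round may vary as long as the drop of the potential pays for it and for the
  test. The last, failing test is paid by \<open>1 \<le> \<Phi> s\<close>.\<close>

lemma halts_While:
  fixes \<Phi> :: "'a::linorder state \<Rightarrow> nat"
  assumes step: "\<And>s. I s \<Longrightarrow> test_val t s \<Longrightarrow>
      \<exists>b. halts P s b (\<lambda>s'. I s' \<and> Suc b + \<Phi> s' \<le> \<Phi> s)"
    and final: "\<And>s. I s \<Longrightarrow> \<not> test_val t s \<Longrightarrow> 1 \<le> \<Phi> s \<and> Q s"
    and "I s" "\<Phi> s \<le> B"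
  shows "halts (While t P) s B Q"
proof -
  have "I s \<Longrightarrow> halts (While t P) s (\<Phi> s) Q" for s
  proof (induction "\<Phi> s" arbitrary: s rule: less_induct)
    case less
    show ?case
    proof (cases "test_val t s")
      case True
      then obtain b where "halts P s b (\<lambda>s'. I s' \<and> Suc b + \<Phi> s' \<le> \<Phi> s)"
        using step less.prems by blast
      then obtain T s' where T: "exec P s T s'" "T \<le> b" "I s'" "Suc b + \<Phi> s' \<le> \<Phi> s"
        unfolding halts_def by blast
      then have "halts (While t P) s' (\<Phi> s') Q"
        using less.hyps[of s'] by simp
      then obtain U s'' where U: "exec (While t P) s' U s''" "U \<le> \<Phi> s'" "Q s''"
        unfolding halts_def by blast
      have "exec (While t P) s (Suc (T + U)) s''"
        using exec.While_True[OF True T(1) U(1)] .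
      moreover have "Suc (T + U) \<le> \<Phi> s"
        using T U by linarith
      ultimately show ?thesis
        unfolding halts_def using U(3) by blast
    next
      case False
      then show ?thesis
        unfolding halts_def using exec.While_False[OF False] final[OF less.prems] by blast
    qed
  qed
  then show ?thesis
    using assms(3,4) halts_mono by blast
qed


section \<open>The program\<close>

abbreviation reg :: "nat \<Rightarrow> exp" where
  "reg i \<equiv> Mem (Const i)"

abbreviation inc :: "nat \<Rightarrow> exp \<Rightarrow> com" where
  "inc i a \<equiv> Assign (Const i) (Plus (reg i) a)"

text \<open>
  Number cells: 0 remaining sequences, 1 \<open>k\<close>, 2 address of the current sequence, 3 a free element
  address, 4 depth of the current decision tree, 5 current node, 6 loop counter, 7 set iff the tree
  failed, 8 number of digits of the tree. The digits are in the cells from 9 on. Nodes are numbered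
  as in a binary heap, from 1, and node \<open>v\<close> owns the digits \<open>2 v\<close> and \<open>2 v + 1\<close>.
\<close>

definition digit :: "exp \<Rightarrow> exp" where
  "digit a = Mem (Plus (Const 9) a)"

definition entry :: "exp \<Rightarrow> exp" where
  "entry a = Plus (reg 2) a"

definition swap_com :: "exp \<Rightarrow> exp \<Rightarrow> com" where
  "swap_com a b = Seq (Move (reg 3) a) (Seq (Move a b) (Move b (reg 3)))"

definition walk_com :: com where
  "walk_com =
     Seq (Assign (Const 5) (Const 1))
    (Seq (Assign (Const 6) (Const 0))
         (While (Less (reg 6) (reg 4))
           (Seq (If (Elem_Less (entry (digit (Plus (reg 5) (reg 5))))
                               (entry (digit (Plus (Plus (reg 5) (reg 5)) (Const 1)))))
                    (Assign (Const 5) (Plus (Plus (reg 5) (reg 5)) (Const 1)))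
                    (Assign (Const 5) (Plus (reg 5) (reg 5))))
                (inc 6 (Const 1)))))"

text \<open>The transpositions of a leaf v are the first digits of the nodes v, 2 v, 4 v, ..., so
  each address arises from the previous one by doubling.\<close>

definition permute_com :: com where
  "permute_com =
     Seq (Assign (Const 6) (Const 0))
         (While (Less (reg 6) (reg 1))
           (Seq (swap_com (entry (reg 6)) (entry (digit (Plus (reg 5) (reg 5)))))
           (Seq (Assign (Const 5) (Plus (reg 5) (reg 5)))
                (inc 6 (Const 1)))))"

definition gnome_com :: com where
  "gnome_com =
     Seq (Assign (Const 6) (Const 0))
    (Seq (Assign (Const 7) (Const 0))
         (While (Less (Plus (reg 6) (Const 1)) (reg 1))
           (If (Elem_Less (entry (Plus (reg 6) (Const 1))) (entry (reg 6)))
               (Seq (swap_com (entry (reg 6)) (entry (Plus (reg 6) (Const 1))))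
               (Seq (Assign (Const 7) (Const 1))
                    (Assign (Const 6) (Minus (reg 6) (Const 1)))))
               (inc 6 (Const 1)))))"

text \<open>A base-\<open>k\<close> counter with the least significant digit first. On overflow all
  digits have already been reset to 0, so only the depth grows, and the number of digits doubles
  with it.\<close>

definition next_com :: com where
  "next_com =
     Seq (Assign (Const 6) (Const 0))
    (Seq (While (And (Less (reg 6) (reg 8)) (Not (Less (Plus (digit (reg 6)) (Const 1)) (reg 1))))
           (Seq (Assign (Plus (Const 9) (reg 6)) (Const 0)) (inc 6 (Const 1))))
         (If (Less (reg 6) (reg 8))
             (Assign (Plus (Const 9) (reg 6)) (Plus (digit (reg 6)) (Const 1)))
             (Seq (inc 4 (Const 1)) (inc 8 (reg 8)))))"

definition sort_one_com :: com where
  "sort_one_com =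
     Seq walk_com (Seq permute_com (Seq gnome_com
    (Seq (If (Less (Const 0) (reg 7)) next_com Skip)
    (Seq (inc 2 (reg 1))
         (Assign (Const 0) (Minus (reg 0) (Const 1)))))))"

text \<open>Repeated addition puts the total input length into cell 3, the first address after the
  input, and repeated doubling puts 2 ^ (k + 1), the number of digits at depth 0, into cell
  8.\<close>

definition init_com :: com where
  "init_com =
     Seq (Assign (Const 6) (reg 0))
    (Seq (While (Less (Const 0) (reg 6))
           (Seq (inc 3 (reg 1)) (Assign (Const 6) (Minus (reg 6) (Const 1)))))
    (Seq (Assign (Const 8) (Const 2))
         (While (Less (reg 6) (reg 1))
           (Seq (inc 8 (reg 8)) (inc 6 (Const 1))))))"

definition sort_all_com :: com where
  "sort_all_com = Seq init_com (While (Less (Const 0) (reg 0)) sort_one_com)"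


section \<open>Effect of the subprograms\<close>

definition block :: "(nat \<Rightarrow> 'a) \<Rightarrow> nat \<Rightarrow> nat \<Rightarrow> 'a list" where
  "block e b k = map (\<lambda>j. e (b + j)) [0..<k]"

lemma length_block [simp]: "length (block e b k) = k"
  by (simp add: block_def)

lemma nth_block [simp]: "j < k \<Longrightarrow> block e b k ! j = e (b + j)"
  by (simp add: block_def)

definition swap_at :: "nat \<Rightarrow> nat \<Rightarrow> 'a list \<Rightarrow> 'a list" where
  "swap_at i j xs = xs[i := xs ! j, j := xs ! i]"

lemma length_swap_at [simp]: "length (swap_at i j xs) = length xs"
  by (simp add: swap_at_def)

lemma mset_swap_at [simp]:
  "i < length xs \<Longrightarrow> j < length xs \<Longrightarrow> mset (swap_at i j xs) = mset xs"
  by (simp add: swap_at_def mset_swap)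

lemma nth_swap_at:
  "i < length xs \<Longrightarrow> j < length xs \<Longrightarrow> l < length xs \<Longrightarrow>
     swap_at i j xs ! l = xs ! (if l = i then j else if l = j then i else l)"
  by (auto simp: swap_at_def nth_list_update)

lemma block_swap:
  assumes "i < k" "j < k" "n \<ge> b + k"
  shows "block (e(n := x, b + i := e (b + j), b + j := e (b + i))) b k = swap_at i j (block e b k)"
  using assms by (intro nth_equalityI) (auto simp: nth_swap_at)

fun node :: "(nat \<Rightarrow> nat) \<Rightarrow> 'a::linorder list \<Rightarrow> nat \<Rightarrow> nat" where
  "node g x 0 = 1"
| "node g x (Suc r) = (let v = node g x r in
     if x ! g (2 * v) < x ! g (2 * v + 1) then 2 * v + 1 else 2 * v)"

fun swaps :: "(nat \<Rightarrow> nat) \<Rightarrow> nat \<Rightarrow> nat \<Rightarrow> 'a list \<Rightarrow> 'a list" where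
  "swaps g v 0 x = x"
| "swaps g v (Suc r) x = swap_at r (g (2 * (v * 2 ^ r))) (swaps g v r x)"

text \<open>The functional counterpart of \<open>walk_com\<close> followed by
  \<open>permute_com\<close>.\<close>

definition run_tree :: "(nat \<Rightarrow> nat) \<Rightarrow> nat \<Rightarrow> 'a::linorder list \<Rightarrow> 'a list" where
  "run_tree g d x = swaps g (node g x d) (length x) x"

lemma length_swaps [simp]: "length (swaps g v r x) = length x"
  by (induction r) auto

lemma mset_swaps:
  "r \<le> length x \<Longrightarrow> (\<And>u. g u < length x) \<Longrightarrow> mset (swaps g v r x) = mset x"
  by (induction r) auto

definition table :: "(nat \<Rightarrow> nat) \<Rightarrow> nat \<Rightarrow> nat" where
  "table m u = m (9 + u)"

lemma halts_swap_com:
  assumes "exp_val a m \<noteq> m 3" "exp_val b m \<noteq> m 3"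
    and "Q (m, e(m 3 := e (exp_val a m), exp_val a m := e (exp_val b m),
                 exp_val b m := e (exp_val a m)))"
  shows "halts (swap_com a b) (m, e) 3 Q"
  unfolding swap_com_def
  apply (rule halts_Seq[of _ _ 1 _ 2], rule halts_Move)
    apply (rule halts_Seq[of _ _ 1 _ 1], rule halts_Move, rule halts_Move)
  using assms by (auto simp: fun_upd_def)

lemma halts_walk_com:
  assumes "m 1 = k" "m 2 = b" "m 4 = d" "table m = g" "\<And>u. g u < k"
  shows "halts walk_com (m, e) (4 * d + 3) (\<lambda>(m', e').
    e' = e \<and> (\<forall>a. a \<notin> {5, 6} \<longrightarrow> m' a = m a) \<and> m' 5 = node g (block e b k) d)"
proof -
  define I where "I = (\<lambda>(m', e'). e' = e \<and> (\<forall>a. a \<notin> {5, 6} \<longrightarrow> m' a = m a) \<and>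
    m' 6 \<le> d \<and> m' 5 = node g (block e b k) (m' 6))"
  define \<Phi> where "\<Phi> = (\<lambda>(m'::nat \<Rightarrow> nat, e'::nat \<Rightarrow> 'a). 4 * (d - m' 6) + 1)"
  have step: "\<exists>c. halts (Seq (If (Elem_Less (entry (digit (Plus (reg 5) (reg 5))))
                               (entry (digit (Plus (Plus (reg 5) (reg 5)) (Const 1)))))
                    (Assign (Const 5) (Plus (Plus (reg 5) (reg 5)) (Const 1)))
                    (Assign (Const 5) (Plus (reg 5) (reg 5))))
                (inc 6 (Const 1))) (m', e') c (\<lambda>s'. I s' \<and> Suc c + \<Phi> s' \<le> \<Phi> (m', e'))"
    if s: "I (m', e')" "test_val (Less (reg 6) (reg 4)) (m', e')" for m' e'
  proof -
    have dig: "m' (9 + u) = g u" for u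
      using s assms(4) by (auto simp: I_def table_def)
    have *: "e' = e" "m' 2 = b" "m' 6 < d" "m' 5 = node g (block e b k) (m' 6)"
      using s assms by (auto simp: I_def)
    have t: "test_val (Elem_Less (entry (digit (Plus (reg 5) (reg 5))))
        (entry (digit (Plus (Plus (reg 5) (reg 5)) (Const 1))))) (m', e') \<longleftrightarrow>
      block e b k ! g (2 * m' 5) < block e b k ! g (2 * m' 5 + 1)"
      using * assms(5) dig dig[of "2 * m' 5 + 1"] by (simp add: entry_def digit_def mult_2[symmetric])
    have I: "I (m'(5 := w, 6 := m' 6 + 1), e')"
      if "w = node g (block e b k) (Suc (m' 6))" for w
      using that s *(3) by (auto simp: I_def)
    show ?thesis
      apply (rule exI[of _ 3], rule halts_Seq[of _ _ 2 _ 1], rule halts_If[of _ _ _ 1])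
         apply (rule halts_Assign, rule halts_Assign)
      subgoal using I[of "2 * m' 5 + 1"] *(3,4) t by (simp add: \<Phi>_def Let_def mult_2[symmetric])
          apply (simp, simp)
        apply (rule halts_Assign, rule halts_Assign)
      subgoal using I[of "2 * m' 5"] *(3,4) t by (simp add: \<Phi>_def Let_def mult_2[symmetric])
      by auto
  qed
  show ?thesis
    unfolding walk_com_def
    apply (rule halts_Seq[of _ _ 1 _ "4 * d + 2"], rule halts_Assign,
         rule halts_Seq[of _ _ 1 _ "4 * d + 1"], rule halts_Assign,
         rule halts_While[where I = I and \<Phi> = \<Phi>])
    subgoal for s using step by (cases s) blast
    subgoal for s using assms(3) by (cases s) (auto simp: I_def \<Phi>_def)
    by (auto simp: I_def \<Phi>_def)
qed
lemma halts_permute_com: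
  assumes "m 1 = k" "m 2 = b" "m 3 \<ge> b + k" "m 5 = v" "table m = g" "\<And>u. g u < k"
  shows "halts permute_com (m, e) (6 * k + 2) (\<lambda>(m', e').
    (\<forall>a. a \<notin> {5, 6} \<longrightarrow> m' a = m a) \<and> (\<forall>a. a \<notin> {b..<b + k} \<longrightarrow> a \<noteq> m 3 \<longrightarrow> e' a = e a) \<and>
    block e' b k = swaps g v k (block e b k))"
proof -
  define I where "I = (\<lambda>(m', e').
    (\<forall>a. a \<notin> {5, 6} \<longrightarrow> m' a = m a) \<and> (\<forall>a. a \<notin> {b..<b + k} \<longrightarrow> a \<noteq> m 3 \<longrightarrow> e' a = e a) \<and>
    m' 6 \<le> k \<and> m' 5 = v * 2 ^ m' 6 \<and> block e' b k = swaps g v (m' 6) (block e b k))"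
  define \<Phi> where "\<Phi> = (\<lambda>(m'::nat \<Rightarrow> nat, e'::nat \<Rightarrow> 'a). 6 * (k - m' 6) + 1)"
  have step: "\<exists>c. halts (Seq (swap_com (entry (reg 6)) (entry (digit (Plus (reg 5) (reg 5)))))
           (Seq (Assign (Const 5) (Plus (reg 5) (reg 5)))
                (inc 6 (Const 1)))) (m', e') c (\<lambda>s'. I s' \<and> Suc c + \<Phi> s' \<le> \<Phi> (m', e'))"
    if s: "I (m', e')" "test_val (Less (reg 6) (reg 1)) (m', e')" for m' e'
  proof -
    define j where "j = g (2 * m' 5)"
    have j: "j < k" using assms j_def by simp
    have dig: "m' (9 + u) = g u" for u
      using s assms(5) by (auto simp: I_def table_def)
    have *: "m' 1 = k" "m' 2 = b" "m' 3 = m 3" "m' 6 < k" "m' 5 = v * 2 ^ m' 6"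
      "block e' b k = swaps g v (m' 6) (block e b k)"
      using s assms by (auto simp: I_def)
    have ex: "exp_val (entry (reg 6)) m' = b + m' 6"
        "exp_val (entry (digit (Plus (reg 5) (reg 5)))) m' = b + j"
      using *(2) dig[of "2 * m' 5"] by (simp_all add: entry_def digit_def j_def mult_2[symmetric])
    let ?e = "e'(m 3 := e' (b + m' 6), b + m' 6 := e' (b + j), b + j := e' (b + m' 6))"
    have "block ?e b k = swap_at (m' 6) j (block e' b k)"
      using *(4) j assms(3) by (rule block_swap)
    then have bl: "block ?e b k = swaps g v (Suc (m' 6)) (block e b k)"
      using *(5,6) by (simp add: j_def)
    have oth: "\<forall>a. a \<notin> {b..<b + k} \<longrightarrow> a \<noteq> m 3 \<longrightarrow> ?e a = e a"
      using s(1) *(4) j by (auto simp: I_def)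
    have "I (m'(5 := 2 * m' 5, 6 := m' 6 + 1), ?e)"
      unfolding I_def using s(1) * bl oth by (auto simp: I_def)
    then show ?thesis
      apply (intro exI[of _ 5], intro halts_Seq[of _ _ 3 _ 2])
       apply (rule halts_swap_com)
      subgoal using * assms(3) ex by simp
      subgoal using * assms(3) j ex by simp
       apply (unfold ex *(3))
       apply (rule halts_Seq[of _ _ 1 _ 1], rule halts_Assign, rule halts_Assign)
      using *(4) by (auto simp: \<Phi>_def mult_2[symmetric])
  qed
  show ?thesis
    unfolding permute_com_def
    apply (rule halts_Seq[of _ _ 1 _ "6 * k + 1"], rule halts_Assign,
         rule halts_While[where I = I and \<Phi> = \<Phi>])
    subgoal for s using step by (cases s) blast
    subgoal for s using assms(1) by (cases s) (auto simp: I_def \<Phi>_def)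
    using assms by (auto simp: I_def \<Phi>_def)
qed

section \<open>Gnome sort and inversions\<close>

definition inversions :: "'a::linorder list \<Rightarrow> (nat \<times> nat) set" where
  "inversions xs = {(i, j). i < j \<and> j < length xs \<and> xs ! j < xs ! i}"

lemma inversions_subset: "inversions xs \<subseteq> {..<length xs} \<times> {..<length xs}"
  by (auto simp: inversions_def)

lemma finite_inversions [simp]: "finite (inversions xs)"
  using inversions_subset finite_subset by blast

lemma card_inversions_le: "card (inversions xs) \<le> length xs * length xs"
  using card_mono[OF _ inversions_subset[of xs]] by simp

lemma inversions_eq_empty: "sorted xs \<Longrightarrow> inversions xs = {}"
  by (auto simp: inversions_def sorted_iff_nth_mono leD)

text \<open>The transposition \<open>\<tau>\<close> of adjacent positions preserves the order of
  every pair of positions except \<open>(r, Suc r)\<close>. So the inversions after the swap inject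
  into the earlier ones other than this pair.\<close>

lemma card_inversions_swap:
  assumes "Suc r < length xs" "xs ! Suc r < xs ! r"
  shows "card (inversions (swap_at r (Suc r) xs)) < card (inversions xs)"
proof -
  define \<tau> where "\<tau> = (\<lambda>i. if i = r then Suc r else if i = Suc r then r else i)"
  have inj: "inj \<tau>"
    by (rule injI) (auto simp: \<tau>_def split: if_splits)
  have nth: "swap_at r (Suc r) xs ! i = xs ! \<tau> i" if "i < length xs" for i
    using assms that by (simp add: nth_swap_at \<tau>_def)
  have "map_prod \<tau> \<tau> ` inversions (swap_at r (Suc r) xs) \<subseteq> inversions xs - {(r, Suc r)}"
  proof
    fix p assume "p \<in> map_prod \<tau> \<tau> ` inversions (swap_at r (Suc r) xs)"
    then obtain i j where p: "p = (\<tau> i, \<tau> j)" and ij: "i < j" "j < length xs"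
      "swap_at r (Suc r) xs ! j < swap_at r (Suc r) xs ! i"
      by (auto simp: inversions_def)
    then have lt: "xs ! \<tau> j < xs ! \<tau> i"
      using nth[of i] nth[of j] by simp
    have "\<not> (i = r \<and> j = Suc r)"
      using lt assms(2) by (auto simp: \<tau>_def)
    then have "\<tau> i < \<tau> j" "\<tau> j < length xs" "(\<tau> i, \<tau> j) \<noteq> (r, Suc r)"
      using ij assms(1) by (auto simp: \<tau>_def split: if_splits)
    then show "p \<in> inversions xs - {(r, Suc r)}"
      using lt p by (simp add: inversions_def)
  qed
  moreover have "card (map_prod \<tau> \<tau> ` inversions (swap_at r (Suc r) xs)) =
      card (inversions (swap_at r (Suc r) xs))"
    by (intro card_image inj_on_subset[OF prod.inj_map[OF inj inj]]) simp
  ultimately have "card (inversions (swap_at r (Suc r) xs)) \<le> card (inversions xs - {(r, Suc r)})"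
    by (metis card_mono finite_Diff finite_inversions)
  also have "\<dots> < card (inversions xs)"
    using assms by (intro card_Diff1_less finite_inversions) (auto simp: inversions_def)
  finally show ?thesis .
qed

text \<open>On a sorted block the time is linear in \<open>k\<close>, which makes the check of a
  successful candidate cheap. The flag in cell 7 records whether anything had to be
  repaired.\<close>

lemma halts_gnome_com:
  assumes "m 1 = k" "m 2 = b" "m 3 \<ge> b + k" "k \<ge> 1"
  shows "halts gnome_com (m, e) (14 * card (inversions (block e b k)) + 7 * k + 3) (\<lambda>(m', e').
    (\<forall>a. a \<notin> {6, 7} \<longrightarrow> m' a = m a) \<and> (\<forall>a. a \<notin> {b..<b + k} \<longrightarrow> a \<noteq> m 3 \<longrightarrow> e' a = e a) \<and>
    sorted (block e' b k) \<and> mset (block e' b k) = mset (block e b k) \<and>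
    m' 7 = (if sorted (block e b k) then 0 else 1))"
proof -
  define x where "x = block e b k"
  define I where "I = (\<lambda>(m', e').
    (\<forall>a. a \<notin> {6, 7} \<longrightarrow> m' a = m a) \<and> (\<forall>a. a \<notin> {b..<b + k} \<longrightarrow> a \<noteq> m 3 \<longrightarrow> e' a = e a) \<and>
    m' 6 < k \<and> sorted (take (m' 6 + 1) (block e' b k)) \<and> mset (block e' b k) = mset x \<and>
    (m' 7 = 0 \<and> block e' b k = x \<or> m' 7 = 1 \<and> \<not> sorted x))"
  \<comment> \<open>A swap removes an inversion and moves back by at most one position, so counting
    inversions twice pays for both. A round costs at most 7 steps.\<close>
  define \<Phi> where "\<Phi> = (\<lambda>(m'::nat \<Rightarrow> nat, e'::nat \<Rightarrow> 'a).
    7 * (2 * card (inversions (block e' b k)) + (k - 1 - m' 6)) + 1)"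
  have step: "\<exists>c. halts (If (Elem_Less (entry (Plus (reg 6) (Const 1))) (entry (reg 6)))
               (Seq (swap_com (entry (reg 6)) (entry (Plus (reg 6) (Const 1))))
               (Seq (Assign (Const 7) (Const 1))
                    (Assign (Const 6) (Minus (reg 6) (Const 1)))))
               (inc 6 (Const 1))) (m', e') c (\<lambda>s'. I s' \<and> Suc c + \<Phi> s' \<le> \<Phi> (m', e'))"
    if s: "I (m', e')" "test_val (Less (Plus (reg 6) (Const 1)) (reg 1)) (m', e')" for m' e'
  proof -
    define r where "r = m' 6"
    let ?y = "block e' b k"
    have *: "m' 2 = b" "m' 3 = m 3" "Suc r < k" "sorted (take (Suc r) ?y)" "mset ?y = mset x"
      "m' 7 = 0 \<and> ?y = x \<or> m' 7 = 1 \<and> \<not> sorted x"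
      using s assms by (auto simp: I_def r_def)
    have ex: "exp_val (entry (reg 6)) m' = b + r"
        "exp_val (entry (Plus (reg 6) (Const 1))) m' = b + Suc r"
      using *(1) by (simp_all add: entry_def r_def)
    have t: "test_val (Elem_Less (entry (Plus (reg 6) (Const 1))) (entry (reg 6))) (m', e')
        \<longleftrightarrow> ?y ! Suc r < ?y ! r"
      using ex *(3) by simp
    let ?e = "e'(m 3 := e' (b + r), b + r := e' (b + Suc r), b + Suc r := e' (b + r))"
    have bl: "block ?e b k = swap_at r (Suc r) ?y"
      using *(3) assms(3) by (intro block_swap) auto
    have I1: "I (m'(7 := 1, 6 := r - 1), ?e) \<and> 6 + \<Phi> (m'(7 := 1, 6 := r - 1), ?e) < \<Phi> (m', e')"
      if "?y ! Suc r < ?y ! r"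
    proof -
      \<comment> \<open>For \<open>r = 0\<close> truncated subtraction keeps the position at 0 and
        the prefix has one entry. Otherwise the swap does not touch the first \<open>r\<close>
        entries.\<close>
      have "sorted (take (r - 1 + 1) (swap_at r (Suc r) ?y))"
      proof (cases r)
        case (Suc r')
        have "take r (swap_at r (Suc r) ?y) = take r ?y"
          by (simp add: swap_at_def)
        moreover have "sorted (take r ?y)"
          using *(3,4) by (auto simp: sorted_iff_nth_mono)
        ultimately show ?thesis using Suc by simp
      qed (simp add: take_Suc_conv_app_nth sorted_iff_nth_Suc)
      moreover have "mset (swap_at r (Suc r) ?y) = mset x"
        using *(3,5) by simp
      moreover have "\<not> sorted x"
      proof -
        have "\<not> sorted ?y"
          using that *(3) by (metis leD length_block sorted_iff_nth_Suc)
        then show ?thesis using *(6) by auto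
      qed
      moreover have "\<forall>a. a \<notin> {b..<b + k} \<longrightarrow> a \<noteq> m 3 \<longrightarrow> ?e a = e a"
        using s(1) *(3) by (auto simp: I_def)
      ultimately have "I (m'(7 := 1, 6 := r - 1), ?e)"
        using s(1) * bl by (auto simp: I_def)
      moreover have "card (inversions (block ?e b k)) < card (inversions ?y)"
        unfolding bl using that *(3) by (intro card_inversions_swap) auto
      then have "6 + \<Phi> (m'(7 := 1, 6 := r - 1), ?e) < \<Phi> (m', e')"
        using *(3) unfolding \<Phi>_def prod.case r_def[symmetric] by simp
      ultimately show ?thesis by blast
    qed
    have I2: "I (m'(6 := Suc r), e')" if "\<not> ?y ! Suc r < ?y ! r"
    proof -
      have "sorted (take (Suc r + 1) ?y)"
        unfolding sorted_iff_nth_Suc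
      proof (intro allI impI)
        fix i assume i: "Suc i < length (take (Suc r + 1) ?y)"
        show "take (Suc r + 1) ?y ! i \<le> take (Suc r + 1) ?y ! Suc i"
        proof (cases "i = r")
          case False
          then have "take (Suc r) ?y ! i \<le> take (Suc r) ?y ! Suc i"
            using *(3,4) i unfolding sorted_iff_nth_Suc by simp
          then show ?thesis using i False by simp
        qed (use i that in auto)
      qed
      then show ?thesis using s(1) * by (auto simp: I_def)
    qed
    show ?thesis
      apply (rule exI[of _ 6], rule halts_If[of _ _ _ 5])
      subgoal premises p
        apply (intro halts_Seq[of _ _ 3 _ 2], rule halts_swap_com)
        subgoal using * assms(3) ex by simp
        subgoal using * assms(3) ex by simp
         apply (unfold ex *(2))
         apply (rule halts_Seq[of _ _ 1 _ 1], rule halts_Assign, rule halts_Assign)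
        using I1 p t by (simp_all add: r_def[symmetric])
      subgoal premises p
        apply (rule halts_Assign)
        using I2 p t *(3) by (auto simp: \<Phi>_def r_def[symmetric])
      by simp
  qed
  show ?thesis
    unfolding gnome_com_def x_def[symmetric]
    apply (rule halts_Seq[of _ _ 1 _ "14 * card (inversions x) + 7 * k + 2"], rule halts_Assign,
         rule halts_Seq[of _ _ 1 _ "14 * card (inversions x) + 7 * k + 1"], rule halts_Assign,
         rule halts_While[where I = I and \<Phi> = \<Phi>])
    subgoal for s using step by (cases s) blast
    subgoal premises p for s
    proof -
      obtain m' e' where s: "s = (m', e')" by (cases s)
      have "m' 6 < k" "\<not> m' 6 + 1 < k" using p assms(1) by (auto simp: I_def s)
      then have "take (m' 6 + 1) (block e' b k) = block e' b k" by simp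
      then show ?thesis using p by (auto simp: I_def \<Phi>_def s)
    qed
    using assms by (auto simp: I_def \<Phi>_def x_def take_Suc_conv_app_nth sorted_iff_nth_Suc)
qed

section \<open>Tables as counters in base k\<close>

definition digits_val :: "nat \<Rightarrow> nat \<Rightarrow> (nat \<Rightarrow> nat) \<Rightarrow> nat" where
  "digits_val k L g = (\<Sum>u<L. g u * k ^ u)"

lemma digits_val_max:
  "(\<And>u. u < r \<Longrightarrow> g u + 1 = k) \<Longrightarrow> digits_val k r g + 1 = k ^ r"
proof (induction r)
  case (Suc r)
  then have "digits_val k r g + 1 = k ^ r" "g r + 1 = k" by auto
  then have "digits_val k (Suc r) g + 1 = k ^ r + g r * k ^ r"
    by (simp add: digits_val_def)
  also have "\<dots> = (g r + 1) * k ^ r" by simp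
  finally show ?case by (simp only: \<open>g r + 1 = k\<close> power_Suc)
qed (simp add: digits_val_def)

lemma digits_val_less:
  "(\<And>u. u < L \<Longrightarrow> g u < k) \<Longrightarrow> digits_val k L g < k ^ L"
proof (induction L)
  case (Suc L)
  then have *: "digits_val k L g < k ^ L" "g L + 1 \<le> k" by (auto simp: Suc_le_eq)
  have "digits_val k (Suc L) g = digits_val k L g + g L * k ^ L"
    by (simp add: digits_val_def)
  also have "\<dots> < (g L + 1) * k ^ L" using *(1) by simp
  also have "\<dots> \<le> k * k ^ L" using *(2) by (rule mult_right_mono) simp
  finally show ?case by simp
qed (simp add: digits_val_def)

lemma digits_val_inj:
  assumes "\<And>u. u < L \<Longrightarrow> g u < k" "\<And>u. u < L \<Longrightarrow> h u < k" "digits_val k L g = digits_val k L h"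
    "u < L"
  shows "g u = h u"
  using assms
proof (induction L)
  case (Suc L)
  have less: "digits_val k L g < k ^ L" "digits_val k L h < k ^ L"
    using Suc.prems(1,2) by (auto intro!: digits_val_less)
  then have M: "k ^ L \<noteq> 0" by linarith
  have eq: "digits_val k L g + g L * k ^ L = digits_val k L h + h L * k ^ L"
    using Suc.prems(3) by (simp add: digits_val_def)
  have "(digits_val k L g + g L * k ^ L) div k ^ L = g L"
    "(digits_val k L h + h L * k ^ L) div k ^ L = h L"
    using less by (simp_all add: div_mult_self1[OF M] del: power_eq_0_iff)
  then have "g L = h L" using eq by simp
  moreover from this have "digits_val k L g = digits_val k L h" using eq by simp
  ultimately show ?case
    using Suc.IH Suc.prems(1,2,4) by (metis less_SucE less_SucI)
qed simp

text \<open>Carry: the digits below \<open>r\<close> are all k - 1 and sum up to k ^ r - 1, which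
  the increment of digit \<open>r\<close> replaces by k ^ r.\<close>

lemma digits_val_increment:
  assumes "\<And>u. u < r \<Longrightarrow> g u + 1 = k" "\<And>u. u < r \<Longrightarrow> h u = 0" "h r = g r + 1"
    "\<And>u. r < u \<Longrightarrow> h u = g u" "r < L"
  shows "digits_val k L h = digits_val k L g + 1"
  using \<open>r < L\<close>
proof (induction L)
  case (Suc L)
  show ?case
  proof (cases "L = r")
    case True
    have "digits_val k r g + 1 = k ^ r"
      using assms(1) by (rule digits_val_max)
    moreover have "digits_val k r h = 0"
      using assms(2) by (simp add: digits_val_def)
    ultimately show ?thesis
      using assms(3) by (simp add: True digits_val_def)
  next
    case False
    then show ?thesis
      using Suc assms(4)[of L] by (simp add: digits_val_def)
  qed
qed simp

lemma halts_next_com: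
  assumes "m 1 = k" "k \<ge> 1" "m 8 = L" "table m = g" "\<And>u. g u < k" "\<And>u. u \<ge> L \<Longrightarrow> g u = 0"
  shows "halts next_com (m, e) (3 * L + 5) (\<lambda>(m', e').
    e' = e \<and> (\<forall>a\<in>{0, 1, 2, 3, 7}. m' a = m a) \<and> (\<forall>u. table m' u < k) \<and>
    (m' 4 = m 4 \<and> m' 8 = L \<and> (\<forall>u\<ge>L. table m' u = 0) \<and>
       digits_val k L (table m') = digits_val k L g + 1 \<or>
     m' 4 = m 4 + 1 \<and> m' 8 = 2 * L \<and> (\<forall>u. table m' u = 0) \<and> digits_val k L g + 1 = k ^ L))"
proof -
  define I where "I = (\<lambda>(m'::nat \<Rightarrow> nat, e'::nat \<Rightarrow> 'a).
    e' = e \<and> (\<forall>a<9. a \<noteq> 6 \<longrightarrow> m' a = m a) \<and> m' 6 \<le> L \<and>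
    (\<forall>u<m' 6. m' (9 + u) = 0 \<and> g u + 1 = k) \<and> (\<forall>u\<ge>m' 6. m' (9 + u) = g u))"
  define \<Phi> where "\<Phi> = (\<lambda>(m'::nat \<Rightarrow> nat, e'::nat \<Rightarrow> 'a). 3 * (L - m' 6) + 1)"
  define t where "t = And (Less (reg 6) (reg 8)) (Not (Less (Plus (digit (reg 6)) (Const 1)) (reg 1)))"
  have step: "\<exists>c. halts (Seq (Assign (Plus (Const 9) (reg 6)) (Const 0)) (inc 6 (Const 1)))
      (m', e') c (\<lambda>s'. I s' \<and> Suc c + \<Phi> s' \<le> \<Phi> (m', e'))"
    if s: "I (m', e')" "test_val t (m', e')" for m' e'
  proof -
    define r where "r = m' 6"
    have *: "r < L" "m' 1 = k" "m' (9 + r) = g r" "g r + 1 = k"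
      using s assms(1-3) assms(5)[of r] by (auto simp: I_def r_def t_def digit_def)
    have "I (m'(9 + r := 0, 6 := r + 1), e')"
      using s(1) *(1,3,4) by (auto simp: I_def r_def less_Suc_eq)
    then show ?thesis
      apply (intro exI[of _ 2] halts_Seq[of _ _ 1 _ 1])
       apply (rule halts_Assign, rule halts_Assign)
      using * by (auto simp: \<Phi>_def r_def[symmetric])
  qed
  show ?thesis
    unfolding next_com_def t_def[symmetric]
    apply (rule halts_Seq[of _ _ 1 _ "3 * L + 4"], rule halts_Assign,
        rule halts_Seq[of _ _ "3 * L + 1" _ 3], rule halts_While[where I = I and \<Phi> = \<Phi>])
    subgoal for s using step by (cases s) blast
    subgoal premises p for s
    proof -
      obtain m' e' where s: "s = (m', e')" by (cases s)
      define r where "r = m' 6"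
      have *: "e' = e" "\<And>a. a < 9 \<Longrightarrow> a \<noteq> 6 \<Longrightarrow> m' a = m a" "r \<le> L"
        "\<And>u. u < r \<Longrightarrow> m' (9 + u) = 0 \<and> g u + 1 = k" "\<And>u. u \<ge> r \<Longrightarrow> m' (9 + u) = g u"
        using p(1) by (auto simp: I_def s r_def)
      have t: "r = L \<or> r < L \<and> g r + 1 < k"
        using p(2) * assms by (auto simp: t_def digit_def s r_def)
      have "halts (If (Less (reg 6) (reg 8))
             (Assign (Plus (Const 9) (reg 6)) (Plus (digit (reg 6)) (Const 1)))
             (Seq (inc 4 (Const 1)) (inc 8 (reg 8)))) (m', e') 3 (\<lambda>(m', e').
    e' = e \<and> (\<forall>a\<in>{0, 1, 2, 3, 7}. m' a = m a) \<and> (\<forall>u. table m' u < k) \<and>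
    (m' 4 = m 4 \<and> m' 8 = L \<and> (\<forall>u\<ge>L. table m' u = 0) \<and>
       digits_val k L (table m') = digits_val k L g + 1 \<or>
     m' 4 = m 4 + 1 \<and> m' 8 = 2 * L \<and> (\<forall>u. table m' u = 0) \<and> digits_val k L g + 1 = k ^ L))"
      proof (rule halts_If[of _ _ _ 2])
        assume "test_val (Less (reg 6) (reg 8)) (m', e')"
        then have r: "r < L" "g r + 1 < k"
          using t * assms by (auto simp: r_def)
        let ?m = "m'(9 + r := g r + 1)"
        have tab: "table ?m u = (if u < r then 0 else if u = r then g r + 1 else g u)" for u
          using *(4,5)[of u] by (simp add: table_def)
        have "digits_val k L (table ?m) = digits_val k L g + 1"
          by (rule digits_val_increment[of r]) (use *(4) r tab in auto)
        moreover have "\<forall>u. table ?m u < k"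
          using tab assms(2,5) r by auto
        moreover have "\<forall>u\<ge>L. table ?m u = 0"
          using tab assms(6) r by auto
        ultimately show "halts (Assign (Plus (Const 9) (reg 6)) (Plus (digit (reg 6)) (Const 1)))
          (m', e') 2 (\<lambda>(m', e').
    e' = e \<and> (\<forall>a\<in>{0, 1, 2, 3, 7}. m' a = m a) \<and> (\<forall>u. table m' u < k) \<and>
    (m' 4 = m 4 \<and> m' 8 = L \<and> (\<forall>u\<ge>L. table m' u = 0) \<and>
       digits_val k L (table m') = digits_val k L g + 1 \<or>
     m' 4 = m 4 + 1 \<and> m' 8 = 2 * L \<and> (\<forall>u. table m' u = 0) \<and> digits_val k L g + 1 = k ^ L))"
          apply (intro halts_Assign)
          using *(1,2) *(5)[of r] assms(3) by (auto simp: digit_def r_def[symmetric])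
      next
        assume "\<not> test_val (Less (reg 6) (reg 8)) (m', e')"
        then have r: "r = L"
          using t * assms by (auto simp: r_def)
        let ?m = "m'(4 := m 4 + 1, 8 := 2 * L)"
        have "table ?m u = 0" for u
          using *(4,5)[of u] assms(6)[of u] r by (cases "u < r") (auto simp: table_def)
        moreover have "digits_val k L g + 1 = k ^ L"
          using digits_val_max[of r] *(4) r by blast
        ultimately show "halts (Seq (inc 4 (Const 1)) (inc 8 (reg 8)))
          (m', e') 2 (\<lambda>(m', e').
    e' = e \<and> (\<forall>a\<in>{0, 1, 2, 3, 7}. m' a = m a) \<and> (\<forall>u. table m' u < k) \<and>
    (m' 4 = m 4 \<and> m' 8 = L \<and> (\<forall>u\<ge>L. table m' u = 0) \<and>
       digits_val k L (table m') = digits_val k L g + 1 \<or>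
     m' 4 = m 4 + 1 \<and> m' 8 = 2 * L \<and> (\<forall>u. table m' u = 0) \<and> digits_val k L g + 1 = k ^ L))"
          apply (intro halts_Seq[of _ _ 1 _ 1])
           apply (rule halts_Assign, rule halts_Assign)
          using *(1,2) assms(2,3) by (auto simp: mult_2[symmetric])
      qed simp
      then show ?thesis by (simp add: \<Phi>_def s)
    qed
    using assms by (auto simp: I_def \<Phi>_def table_def)
qed


text \<open>The nodes of a tree of depth d are below 2 ^ (d + 1), the path of transpositions below a
  leaf stays below 2 ^ (d + k), and a node owns two digits; hence the size 2 ^ (d + k + 1). Zeros
  beyond the last digit ensure that an overflow produces the zero table of the next depth.\<close>

definition valid :: "nat \<Rightarrow> nat \<Rightarrow> (nat \<Rightarrow> nat) \<Rightarrow> bool" where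
  "valid k n m \<longleftrightarrow> m 1 = k \<and> m 3 = n \<and> m 8 = 2 ^ (m 4 + k + 1) \<and>
     (\<forall>u. table m u < k) \<and> (\<forall>u\<ge>m 8. table m u = 0)"

text \<open>The position of a table in the order in which the program tries all tables.\<close>

definition position :: "nat \<Rightarrow> nat \<Rightarrow> (nat \<Rightarrow> nat) \<Rightarrow> nat" where
  "position k d g = (\<Sum>d'<d. k ^ 2 ^ (d' + k + 1)) + digits_val k (2 ^ (d + k + 1)) g"

text \<open>After a success no inversions are left for gnome sort. A failure additionally pays for
  at most \<open>k\<^sup>2\<close> inversions and one increment of the counter, and it advances the
  candidate by exactly one position.\<close>

lemma halts_sort_one_com:
  fixes e :: "nat \<Rightarrow> 'a::linorder"
  assumes "valid k n m" "k \<ge> 1" "m 2 = b" "b + k \<le> n"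
  defines "x \<equiv> block e b k"
  defines "ok \<equiv> sorted (run_tree (table m) (m 4) x)"
  shows "halts sort_one_com (m, e)
    (4 * m 4 + 13 * k + 13 + (if ok then 0 else 14 * k\<^sup>2 + 3 * 2 ^ (m 4 + k + 1) + 5))
    (\<lambda>(m', e'). valid k n m' \<and> m' 0 = m 0 - 1 \<and> m' 2 = b + k \<and>
      (\<forall>a. a \<notin> {b..<b + k} \<longrightarrow> a \<noteq> n \<longrightarrow> e' a = e a) \<and>
      sorted (block e' b k) \<and> mset (block e' b k) = mset x \<and>
      (if ok then table m' = table m \<and> m' 4 = m 4
       else position k (m' 4) (table m') = position k (m 4) (table m) + 1))"
    (is "halts _ _ _ ?Q")
proof -
  define L where "L = (2::nat) ^ (m 4 + k + 1)"
  define g where "g = table m"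
  define v where "v = node g x (m 4)"
  define y where "y = swaps g v k x"
  define B where "B = (if ok then 0 else 3 * L + 5)"
  define Bi where "Bi = 14 * card (inversions y)"
  have m: "m 1 = k" "m 3 = n" "m 8 = L" "\<And>u. g u < k" "\<And>u. u \<ge> L \<Longrightarrow> g u = 0"
    using assms(1) by (auto simp: valid_def L_def g_def)
  have ok: "ok \<longleftrightarrow> sorted y"
    by (simp add: ok_def run_tree_def y_def v_def g_def x_def)
  have y: "mset y = mset x"
    unfolding y_def by (rule mset_swaps) (auto simp: m x_def)
  have Bi: "Bi \<le> (if ok then 0 else 14 * k\<^sup>2)"
    using inversions_eq_empty[of y] card_inversions_le[of y] ok
    by (auto simp: Bi_def y_def x_def power2_eq_square)
  have "halts sort_one_com (m, e) (4 * m 4 + 3 + (6 * k + 2 + (Bi + 7 * k + 3 + (B + 2 + (1 + 1))))) ?Q"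
    unfolding sort_one_com_def
  proof (rule halts_Seq[OF halts_mono[OF halts_walk_com[of m k b "m 4" g]]])
    fix s' :: "'a state"
    assume s': "case s' of (m', e') \<Rightarrow> e' = e \<and> (\<forall>a. a \<notin> {5, 6} \<longrightarrow> m' a = m a) \<and>
      m' 5 = node g (block e b k) (m 4)"
    obtain m1 e1 where [simp]: "s' = (m1, e1)" by (cases s')
    have m1: "e1 = e" "m1 5 = v" "\<And>a. a \<notin> {5, 6} \<Longrightarrow> m1 a = m a" "table m1 = g"
      using s' by (auto simp: v_def x_def g_def table_def)
    have "halts (Seq permute_com (Seq gnome_com (Seq (If (Less (Const 0) (reg 7)) next_com Skip)
      (Seq (inc 2 (reg 1)) (Assign (Const 0) (Minus (reg 0) (Const 1))))))) (m1, e1)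
      (6 * k + 2 + (Bi + 7 * k + 3 + (B + 2 + (1 + 1)))) ?Q"
    proof (rule halts_Seq[OF halts_mono[OF halts_permute_com[of m1 k b v g]]])
      fix s'' :: "'a state"
      assume s'': "case s'' of (m', e') \<Rightarrow> (\<forall>a. a \<notin> {5, 6} \<longrightarrow> m' a = m1 a) \<and>
        (\<forall>a. a \<notin> {b..<b + k} \<longrightarrow> a \<noteq> m1 3 \<longrightarrow> e' a = e1 a) \<and>
        block e' b k = swaps g v k (block e1 b k)"
      obtain m2 e2 where [simp]: "s'' = (m2, e2)" by (cases s'')
      have m2: "\<And>a. a \<notin> {5, 6} \<Longrightarrow> m2 a = m a" "table m2 = g" "block e2 b k = y"
        "\<And>a. a \<notin> {b..<b + k} \<Longrightarrow> a \<noteq> n \<Longrightarrow> e2 a = e a"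
        using s'' m1 m(2) by (auto simp: table_def y_def x_def)
      have "halts (Seq gnome_com (Seq (If (Less (Const 0) (reg 7)) next_com Skip)
        (Seq (inc 2 (reg 1)) (Assign (Const 0) (Minus (reg 0) (Const 1)))))) (m2, e2)
        (Bi + 7 * k + 3 + (B + 2 + (1 + 1))) ?Q"
      proof (rule halts_Seq[OF halts_mono[OF halts_gnome_com[of m2 k b e2]]])
        fix s3 :: "'a state"
        assume s3: "case s3 of (m', e') \<Rightarrow> (\<forall>a. a \<notin> {6, 7} \<longrightarrow> m' a = m2 a) \<and>
          (\<forall>a. a \<notin> {b..<b + k} \<longrightarrow> a \<noteq> m2 3 \<longrightarrow> e' a = e2 a) \<and>
          sorted (block e' b k) \<and> mset (block e' b k) = mset (block e2 b k) \<and>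
          m' 7 = (if sorted (block e2 b k) then 0 else 1)"
        obtain m3 e3 where [simp]: "s3 = (m3, e3)" by (cases s3)
        have m3: "\<And>a. a \<notin> {5, 6, 7} \<Longrightarrow> m3 a = m a" "table m3 = g" "sorted (block e3 b k)"
          "mset (block e3 b k) = mset x" "m3 7 = (if ok then 0 else 1)"
          "\<And>a. a \<notin> {b..<b + k} \<Longrightarrow> a \<noteq> n \<Longrightarrow> e3 a = e a"
          using s3 m2 m(2) y ok by (auto simp: table_def)
        have "halts (If (Less (Const 0) (reg 7)) next_com Skip) (m3, e3) (B + 2) (\<lambda>(m', e').
          e' = e3 \<and> (\<forall>a\<in>{0, 2}. m' a = m a) \<and> valid k n m' \<and>
          (if ok then table m' = table m \<and> m' 4 = m 4
           else position k (m' 4) (table m') = position k (m 4) (table m) + 1))"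
        proof (rule halts_If[of _ _ _ "B + 1"])
          assume "test_val (Less (Const 0) (reg 7)) (m3, e3)"
          then have nok: "\<not> ok" using m3(5) by (auto split: if_splits)
          show "halts next_com (m3, e3) (B + 1) (\<lambda>(m', e').
            e' = e3 \<and> (\<forall>a\<in>{0, 2}. m' a = m a) \<and> valid k n m' \<and>
            (if ok then table m' = table m \<and> m' 4 = m 4
             else position k (m' 4) (table m') = position k (m 4) (table m) + 1))"
          proof (rule halts_mono[OF halts_next_com[of m3 k L g]])
            fix s4 :: "'a state"
            assume s4: "case s4 of (m', e') \<Rightarrow>
              e' = e3 \<and> (\<forall>a\<in>{0, 1, 2, 3, 7}. m' a = m3 a) \<and> (\<forall>u. table m' u < k) \<and>
              (m' 4 = m3 4 \<and> m' 8 = L \<and> (\<forall>u\<ge>L. table m' u = 0) \<and>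
                 digits_val k L (table m') = digits_val k L g + 1 \<or>
               m' 4 = m3 4 + 1 \<and> m' 8 = 2 * L \<and> (\<forall>u. table m' u = 0) \<and> digits_val k L g + 1 = k ^ L)"
            obtain m4 e4 where [simp]: "s4 = (m4, e4)" by (cases s4)
            have "m3 4 = m 4" using m3(1) by auto
            then consider "m4 4 = m 4" "m4 8 = L" "\<forall>u\<ge>L. table m4 u = 0"
                "digits_val k L (table m4) = digits_val k L g + 1"
              | "m4 4 = m 4 + 1" "m4 8 = 2 * L" "\<forall>u. table m4 u = 0" "digits_val k L g + 1 = k ^ L"
              using s4 by auto
            \<comment> \<open>On overflow \<open>digits_val k L g + 1\<close> equals
              \<open>k ^ L\<close>, the number of all tables of the old depth. So the position grows
              by 1 although the digits restart at 0.\<close>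
            then have "position k (m4 4) (table m4) = position k (m 4) (table m) + 1 \<and>
                m4 8 = 2 ^ (m4 4 + k + 1) \<and> (\<forall>u\<ge>m4 8. table m4 u = 0)"
              by cases (auto simp: position_def L_def g_def[symmetric] digits_val_def)
            then show "case s4 of (m', e') \<Rightarrow>
              e' = e3 \<and> (\<forall>a\<in>{0, 2}. m' a = m a) \<and> valid k n m' \<and>
              (if ok then table m' = table m \<and> m' 4 = m 4
               else position k (m' 4) (table m') = position k (m 4) (table m) + 1)"
              using s4 nok m3(1) m(1,2) by (auto simp: valid_def)
          qed (use m m3 nok assms(2) in \<open>auto simp: B_def\<close>)
        next
          assume "\<not> test_val (Less (Const 0) (reg 7)) (m3, e3)"
          then have ok: "ok" using m3(5) by (auto split: if_splits)
          show "halts Skip (m3, e3) (B + 1) (\<lambda>(m', e').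
            e' = e3 \<and> (\<forall>a\<in>{0, 2}. m' a = m a) \<and> valid k n m' \<and>
            (if ok then table m' = table m \<and> m' 4 = m 4
             else position k (m' 4) (table m') = position k (m 4) (table m) + 1))"
            by (rule halts_Skip) (use ok m3(1,2) m in \<open>auto simp: valid_def g_def[symmetric] L_def\<close>)
        qed simp
        then have "halts (Seq (If (Less (Const 0) (reg 7)) next_com Skip)
          (Seq (inc 2 (reg 1)) (Assign (Const 0) (Minus (reg 0) (Const 1))))) (m3, e3)
          (B + 2 + (1 + 1)) ?Q"
        proof (rule halts_Seq[OF halts_mono[OF _ order_refl]])
          fix s4 :: "'a state"
          assume s4: "case s4 of (m', e') \<Rightarrow>
            e' = e3 \<and> (\<forall>a\<in>{0, 2}. m' a = m a) \<and> valid k n m' \<and>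
            (if ok then table m' = table m \<and> m' 4 = m 4
             else position k (m' 4) (table m') = position k (m 4) (table m) + 1)"
          obtain m4 e4 where [simp]: "s4 = (m4, e4)" by (cases s4)
          have "table (m4(2 := b + k, 0 := m 0 - 1)) = table m4"
            by (auto simp: table_def)
          then show "halts (Seq (inc 2 (reg 1)) (Assign (Const 0) (Minus (reg 0) (Const 1)))) s4
              (1 + 1) ?Q"
            apply (simp only: \<open>s4 = _\<close>)
            apply (rule halts_Seq[of _ _ 1 _ 1], rule halts_Assign, rule halts_Assign)
            using s4 m3 assms(3) by (auto simp: valid_def)
        qed simp_all
        then show "halts (Seq (If (Less (Const 0) (reg 7)) next_com Skip)
          (Seq (inc 2 (reg 1)) (Assign (Const 0) (Minus (reg 0) (Const 1))))) s3
          (B + 2 + (1 + 1)) ?Q" by simp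
      qed (use m m2 assms in \<open>auto simp: Bi_def\<close>)
      then show "halts (Seq gnome_com (Seq (If (Less (Const 0) (reg 7)) next_com Skip)
        (Seq (inc 2 (reg 1)) (Assign (Const 0) (Minus (reg 0) (Const 1)))))) s''
        (Bi + 7 * k + 3 + (B + 2 + (1 + 1))) ?Q" by simp
    qed (use m m1 assms in auto)
    then show "halts (Seq permute_com (Seq gnome_com (Seq (If (Less (Const 0) (reg 7)) next_com Skip)
      (Seq (inc 2 (reg 1)) (Assign (Const 0) (Minus (reg 0) (Const 1))))))) s'
      (6 * k + 2 + (Bi + 7 * k + 3 + (B + 2 + (1 + 1)))) ?Q" by simp
  qed (use m assms g_def in auto)
  then show ?thesis
    by (rule halts_mono) (use Bi in \<open>auto simp: B_def L_def split: if_splits\<close>)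
qed

lemma halts_init_com:
  assumes "m 1 = k" "m 0 = c" "\<And>a. a > 1 \<Longrightarrow> m a = 0" "k \<ge> 1"
  shows "halts init_com (m, e) (3 * c + 3 * k + 5)
    (\<lambda>(m', e'). e' = e \<and> m' 0 = c \<and> m' 2 = 0 \<and> m' 4 = 0 \<and> (\<forall>u. table m' u = 0) \<and> valid k (c * k) m')"
proof -
  define I where "I = (\<lambda>(m'::nat \<Rightarrow> nat, e'::nat \<Rightarrow> 'a). e' = e \<and>
    (\<forall>a. a \<notin> {3, 6} \<longrightarrow> m' a = m a) \<and> m' 6 \<le> c \<and> m' 3 + m' 6 * k = c * k)"
  define \<Phi> where "\<Phi> = (\<lambda>(m'::nat \<Rightarrow> nat, e'::nat \<Rightarrow> 'a). 3 * m' 6 + 1)"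
  define J where "J = (\<lambda>(m'::nat \<Rightarrow> nat, e'::nat \<Rightarrow> 'a). e' = e \<and>
    (\<forall>a. a \<notin> {3, 6, 8} \<longrightarrow> m' a = m a) \<and> m' 6 \<le> k \<and> m' 3 = c * k \<and> m' 8 = 2 ^ (m' 6 + 1))"
  define \<Psi> where "\<Psi> = (\<lambda>(m'::nat \<Rightarrow> nat, e'::nat \<Rightarrow> 'a). 3 * (k - m' 6) + 1)"
  have 1: "halts (Seq (inc 3 (reg 1)) (Assign (Const 6) (Minus (reg 6) (Const 1)))) s 2
      (\<lambda>s'. I s' \<and> Suc 2 + \<Phi> s' \<le> \<Phi> s)" if I: "I s" "test_val (Less (Const 0) (reg 6)) s" for s
  proof -
    obtain m' e' where s: "s = (m', e')" by (cases s)
    obtain r where r: "m' 6 = Suc r" using I(2) by (auto simp: s gr0_conv_Suc)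
    show ?thesis
      unfolding s
      apply (rule halts_Seq[of _ _ 1 _ 1], rule halts_Assign, rule halts_Assign)
      using I(1) assms(1) by (auto simp: I_def \<Phi>_def s r)
  qed
  have 2: "halts (Seq (inc 8 (reg 8)) (inc 6 (Const 1))) s 2
      (\<lambda>s'. J s' \<and> Suc 2 + \<Psi> s' \<le> \<Psi> s)" if "J s" "test_val (Less (reg 6) (reg 1)) s" for s
  proof -
    obtain m' e' where s: "s = (m', e')" by (cases s)
    show ?thesis
      unfolding s
      apply (rule halts_Seq[of _ _ 1 _ 1], rule halts_Assign, rule halts_Assign)
      using that assms(1) by (auto simp: J_def \<Psi>_def s)
  qed
  show ?thesis
    unfolding init_com_def
    apply (rule halts_Seq[of _ _ 1 _ "3 * c + 3 * k + 4"], rule halts_Assign,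
        rule halts_Seq[of _ _ "3 * c + 1" _ "3 * k + 3"], rule halts_While[where I = I and \<Phi> = \<Phi>])
         apply (use 1 in blast)
    subgoal premises p for s
    proof -
      obtain m' e' where s: "s = (m', e')" by (cases s)
      have *: "m' 6 = 0" "m' 3 = c * k" "\<And>a. a \<notin> {3, 6} \<Longrightarrow> m' a = m a" "e' = e"
        using p by (auto simp: I_def s)
      have "halts (Seq (Assign (Const 8) (Const 2)) (While (Less (reg 6) (reg 1))
           (Seq (inc 8 (reg 8)) (inc 6 (Const 1))))) (m', e') (3 * k + 3) (\<lambda>(m', e'). e' = e \<and>
           m' 0 = c \<and> m' 2 = 0 \<and> m' 4 = 0 \<and> (\<forall>u. table m' u = 0) \<and> valid k (c * k) m')"
        apply (rule halts_Seq[of _ _ 1 _ "3 * k + 1"], rule halts_Assign,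
          rule halts_While[where I = J and \<Phi> = \<Psi>])
             apply (use 2 in blast)
        subgoal for s'
          using assms by (cases s') (auto simp: J_def \<Psi>_def valid_def table_def)
        using * by (auto simp: J_def \<Psi>_def)
      then show ?thesis by (simp add: s \<Phi>_def)
    qed
    using assms by (auto simp: I_def \<Phi>_def)
qed

section \<open>The search for a good table\<close>

lemma position_less:
  assumes "\<And>u. g u < k"
  shows "position k d g < (\<Sum>d'<Suc d. k ^ 2 ^ (d' + k + 1))"
  using digits_val_less[of "2 ^ (d + k + 1)" g k] assms by (simp add: position_def)

text \<open>The tables of depth at most \<open>D\<close> occupy an initial segment of the
  positions.\<close>

lemma depth_le_if_position_le:
  assumes "position k d g \<le> position k D h" "\<And>u. h u < k"
  shows "d \<le> D"
proof (rule ccontr)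
  assume "\<not> d \<le> D"
  then have "(\<Sum>d'<Suc D. k ^ 2 ^ (d' + k + 1)) \<le> (\<Sum>d'<d. k ^ 2 ^ (d' + k + 1))"
    by (intro sum_mono2) auto
  also have "\<dots> \<le> position k d g"
    by (simp add: position_def)
  finally show False
    using position_less[of h k D, OF assms(2)] assms(1) by linarith
qed

lemma position_inj:
  assumes "position k d g = position k D h" "\<And>u. g u < k" "\<And>u. h u < k"
  shows "d = D" "u < 2 ^ (D + k + 1) \<Longrightarrow> g u = h u"
proof -
  show "d = D"
    using depth_le_if_position_le[of k d g D h] depth_le_if_position_le[of k D h d g] assms by simp
  then show "g u = h u" if "u < 2 ^ (D + k + 1)"
    using assms that by (intro digits_val_inj[of "2 ^ (D + k + 1)" g k h]) (auto simp: position_def)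
qed

lemma node_less: "node g x r < 2 ^ (r + 1)"
proof (induction r)
  case (Suc r)
  then have "2 * node g x r + 1 < 2 ^ (Suc r + 1)" by simp
  then show ?case by (simp add: Let_def)
qed simp

lemma node_cong:
  "(\<And>u. u < 2 ^ (d + 1) \<Longrightarrow> g u = h u) \<Longrightarrow> r \<le> d \<Longrightarrow> node g x r = node h x r"
proof (induction r)
  case (Suc r)
  have "(2::nat) ^ (r + 2) \<le> 2 ^ (d + 1)"
    using Suc.prems(2) by (intro power_increasing) auto
  then have "2 * node h x r + 1 < 2 ^ (d + 1)"
    using node_less[of h x r] by simp
  then have "g (2 * node h x r) = h (2 * node h x r)"
    "g (2 * node h x r + 1) = h (2 * node h x r + 1)"
    using Suc.prems(1) by auto
  then show ?case
    using Suc by (simp add: Let_def)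
qed simp

lemma swaps_cong:
  "(\<And>i. i < r \<Longrightarrow> g (2 * (v * 2 ^ i)) = h (2 * (v * 2 ^ i))) \<Longrightarrow> swaps g v r x = swaps h v r x"
  by (induction r) auto

text \<open>A run reads no digit beyond this bound. Hence a candidate whose digits match those of a
  table \<open>h\<close> behaves like \<open>h\<close>, even if \<open>h\<close> differs from it
  further on.\<close>

lemma run_tree_cong:
  assumes "\<And>u. u < 2 ^ (d + length x + 1) \<Longrightarrow> g u = h u"
  shows "run_tree g d x = run_tree h d x"
proof -
  have "(2::nat) ^ (d + 1) \<le> 2 ^ (d + length x + 1)" by (intro power_increasing) auto
  with assms have "node g x d = node h x d"
    using assms by (intro node_cong[of d]) (meson le_refl order_less_le_trans)+
  moreover have "swaps g (node h x d) (length x) x = swaps h (node h x d) (length x) x"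
  proof (intro swaps_cong assms)
    fix i assume i: "i < length x"
    have "2 * (node h x d * 2 ^ i) < 2 * (2 ^ (d + 1) * 2 ^ i)"
      using node_less[of h x d] by simp
    also have "\<dots> = 2 ^ (d + i + 2)" by (simp add: power_add)
    also have "\<dots> \<le> 2 ^ (d + length x + 1)" using i by (intro power_increasing) auto
    finally show "2 * (node h x d * 2 ^ i) < 2 ^ (d + length x + 1)" .
  qed
  ultimately show ?thesis by (simp add: run_tree_def)
qed

text \<open>The exceptional address \<open>c * k\<close> is the buffer of the swaps, directly after
  the last block.\<close>

lemma block_disjoint:
  assumes "\<And>a. a \<notin> {i * k..<i * k + k} \<Longrightarrow> a \<noteq> c * k \<Longrightarrow> e' a = e a" "l < c" "l \<noteq> i"
  shows "block e' (l * k) k = block e (l * k) k"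
proof (intro nth_equalityI)
  fix j assume "j < length (block e' (l * k) k)"
  then have j: "j < k" by simp
  have "l * k + j < c * k"
    using j assms(2) mult_le_mono1[of "Suc l" c k] by simp
  moreover have "l * k + j < i * k \<or> i * k + k \<le> l * k + j"
    using j assms(3) mult_le_mono1[of "Suc l" i k] mult_le_mono1[of "Suc i" l k] by force
  ultimately have "e' (l * k + j) = e (l * k + j)"
    using assms(1)[of "l * k + j"] by force
  then show "block e' (l * k) k ! j = block e (l * k) k ! j"
    using j by simp
qed simp

text \<open>The table \<open>h\<close> is only known to exist. The search cannot pass its position,
  because the candidate found there agrees with \<open>h\<close> on all digits that a run reads and
  so does not fail. Thus \<open>position k D h\<close> bounds the number of failures, and no
  candidate is deeper than \<open>D\<close>.\<close>

lemma halts_sort_all_com: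
  fixes S :: "'a::linorder list list"
  assumes k: "k \<ge> 1" and len: "\<And>s. s \<in> set S \<Longrightarrow> length s = k"
    and h: "\<And>u. h u < k" "\<And>s. s \<in> set S \<Longrightarrow> sorted (run_tree h D s)"
    and e: "\<And>i j. i < length S \<Longrightarrow> j < k \<Longrightarrow> e (i * k + j) = S ! i ! j"
    and m: "m 1 = k" "m 0 = length S" "\<And>a. a > 1 \<Longrightarrow> m a = 0"
  shows "halts sort_all_com (m, e) (3 * length S + 3 * k + 5 +
      (length S * (4 * D + 13 * k + 14) +
       position k D h * (14 * k\<^sup>2 + 3 * 2 ^ (D + k + 1) + 5) + 1))
    (\<lambda>(m', e'). \<forall>i<length S. block e' (i * k) k = sort (S ! i))"
proof -
  define c where "c = length S"
  define P where "P = position k D h"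
  define K where "K = 14 * k\<^sup>2 + 3 * 2 ^ (D + k + 1) + 5"
  define pos where "pos = (\<lambda>m. position k (m 4) (table m))"
  define I where "I = (\<lambda>(m::nat \<Rightarrow> nat, e). valid k (c * k) m \<and> m 0 \<le> c \<and> m 2 = (c - m 0) * k \<and>
    (\<forall>i<c. block e (i * k) k = (if i < c - m 0 then sort (S ! i) else S ! i)) \<and> pos m \<le> P)"
  \<comment> \<open>Every remaining sequence is charged a successful run, and every failure still
    possible its extra cost \<open>K\<close>. The 14 is the 13 of a run plus the loop test.\<close>
  define \<Phi> where "\<Phi> = (\<lambda>(m::nat \<Rightarrow> nat, e::nat \<Rightarrow> 'a). m 0 * (4 * D + 13 * k + 14) + (P - pos m) * K + 1)"
  have step: "\<exists>b. halts sort_one_com (m, e) b (\<lambda>s'. I s' \<and> Suc b + \<Phi> s' \<le> \<Phi> (m, e))"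
    if "I (m, e)" "test_val (Less (Const 0) (reg 0)) (m, e)" for m e
  proof -
    define i where "i = c - m 0"
    define x where "x = block e (i * k) k"
    define ok where "ok = sorted (run_tree (table m) (m 4) x)"
    have v: "valid k (c * k) m" and b: "m 2 = i * k" and le: "pos m \<le> P"
      and m0: "m 0 = c - i" "i < c"
      and bl: "\<And>l. l < c \<Longrightarrow> block e (l * k) k = (if l < i then sort (S ! l) else S ! l)"
      using that by (auto simp: I_def i_def)
    have x: "x = S ! i" using bl[OF m0(2)] by (simp add: x_def)
    have bk: "i * k + k \<le> c * k"
      using m0(2) mult_le_mono1[of "Suc i" c k] by simp
    have d: "m 4 \<le> D"
      using le h(1) unfolding pos_def P_def by (rule depth_le_if_position_le)
    have fail: "pos m < P" if "\<not> ok"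
    proof (rule ccontr)
      assume "\<not> pos m < P"
      then have eq: "position k (m 4) (table m) = position k D h"
        using le by (simp add: pos_def P_def)
      have tk: "table m u < k" for u using v by (simp add: valid_def)
      have "run_tree (table m) D x = run_tree h D x"
        using position_inj(2)[OF eq tk h(1)] by (intro run_tree_cong) (simp add: x_def)
      moreover have "sorted (run_tree h D x)"
        using h(2) x m0(2) by (simp add: c_def)
      ultimately show False
        using that position_inj(1)[OF eq tk h(1)] by (simp add: ok_def)
    qed
    define b where "b = 4 * m 4 + 13 * k + 13 +
      (if ok then 0 else 14 * k\<^sup>2 + 3 * 2 ^ (m 4 + k + 1) + 5)"
    have "(2::nat) ^ (m 4 + k + 1) \<le> 2 ^ (D + k + 1)"
      using d by (intro power_increasing) auto
    then have bK: "b \<le> 4 * D + 13 * k + 13 + (if ok then 0 else K)"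
      using d unfolding b_def K_def by (cases ok; simp only: if_True if_False; linarith)
    have "halts sort_one_com (m, e) b (\<lambda>s'. I s' \<and> Suc b + \<Phi> s' \<le> \<Phi> (m, e))"
    proof (rule halts_mono[OF halts_sort_one_com[OF v k \<open>m 2 = i * k\<close> bk, of e, folded x_def, folded ok_def]])
      fix s' :: "'a state"
      assume s': "case s' of (m', e') \<Rightarrow> valid k (c * k) m' \<and> m' 0 = m 0 - 1 \<and> m' 2 = i * k + k \<and>
        (\<forall>a. a \<notin> {i * k..<i * k + k} \<longrightarrow> a \<noteq> c * k \<longrightarrow> e' a = e a) \<and>
        sorted (block e' (i * k) k) \<and> mset (block e' (i * k) k) = mset x \<and>
        (if ok then table m' = table m \<and> m' 4 = m 4
         else position k (m' 4) (table m') = position k (m 4) (table m) + 1)"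
      obtain m' e' where s: "s' = (m', e')" by (cases s')
      have pos: "pos m' = (if ok then pos m else pos m + 1)"
        using s' by (simp add: s pos_def)
      have m0': "m' 0 = m 0 - 1" "c - m' 0 = Suc i" using s' m0 by (auto simp: s)
      have "block e' (l * k) k = (if l < Suc i then sort (S ! l) else S ! l)" if "l < c" for l
      proof (cases "l = i")
        case True
        have "block e' (i * k) k = sort (S ! i)"
          using s' x by (intro properties_for_sort[symmetric]) (auto simp: s)
        then show ?thesis using True by simp
      next
        case False
        have "block e' (l * k) k = block e (l * k) k"
          using s' that False by (intro block_disjoint[of i k c]) (auto simp: s)
        then show ?thesis using bl[OF that] False by auto
      qed
      then have "I s'"
        using s' pos le fail m0 m0' by (auto simp: I_def s)
      moreover have "Suc b + \<Phi> s' \<le> \<Phi> (m, e)"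
      proof -
        have "m 0 = Suc (m' 0)" using m0 m0' by simp
        moreover have "(P - pos m') * K + (if ok then 0 else K) \<le> (P - pos m) * K"
        proof (cases ok)
          case False
          then have "P - pos m = Suc (P - pos m')" using pos fail by simp
          then show ?thesis using False by simp
        qed (simp add: pos)
        ultimately show ?thesis using bK by (simp add: \<Phi>_def s)
      qed
      ultimately show "I s' \<and> Suc b + \<Phi> s' \<le> \<Phi> (m, e)" by blast
    qed (simp add: b_def)
    then show ?thesis by blast
  qed
  show ?thesis
    unfolding sort_all_com_def
  proof (rule halts_Seq[OF halts_mono[OF halts_init_com[OF m(1,2,3) k] order_refl] order_refl])
    fix s' :: "'a state"
    assume s': "case s' of (m', e') \<Rightarrow> e' = e \<and> m' 0 = length S \<and> m' 2 = 0 \<and> m' 4 = 0 \<and>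
      (\<forall>u. table m' u = 0) \<and> valid k (length S * k) m'"
    obtain m' e' where s: "s' = (m', e')" by (cases s')
    have "block e (i * k) k = S ! i" if "i < length S" for i
      using that e len by (intro nth_equalityI) auto
    moreover have "pos m' = 0"
      using s' by (simp add: s pos_def position_def digits_val_def)
    ultimately have "I s'" "\<Phi> s' \<le> length S * (4 * D + 13 * k + 14) +
       position k D h * (14 * k\<^sup>2 + 3 * 2 ^ (D + k + 1) + 5) + 1"
      using s' by (auto simp: I_def \<Phi>_def s c_def K_def P_def)
    then show "halts (While (Less (Const 0) (reg 0)) sort_one_com) s'
      (length S * (4 * D + 13 * k + 14) +
       position k D h * (14 * k\<^sup>2 + 3 * 2 ^ (D + k + 1) + 5) + 1)
      (\<lambda>(m', e'). \<forall>i<length S. block e' (i * k) k = sort (S ! i))"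
      apply (rule halts_While[where I = I and \<Phi> = \<Phi>, rotated 2])
      subgoal for s using step by (cases s) blast
      subgoal for s by (cases s) (auto simp: I_def \<Phi>_def c_def)
      done
  qed
qed

section \<open>Decision trees\<close>

fun swap_seq :: "(nat \<Rightarrow> nat) \<Rightarrow> nat \<Rightarrow> 'a list \<Rightarrow> 'a list" where
  "swap_seq p 0 x = x"
| "swap_seq p (Suc r) x = swap_at r (p r) (swap_seq p r x)"

lemma length_swap_seq [simp]: "length (swap_seq p r x) = length x"
  by (induction r) auto

lemma swaps_eq_swap_seq: "swaps g v r x = swap_seq (\<lambda>i. g (2 * (v * 2 ^ i))) r x"
  by (induction r) auto

lemma mset_swap_seq:
  "r \<le> length x \<Longrightarrow> (\<And>i. i < r \<Longrightarrow> p i < length x) \<Longrightarrow> mset (swap_seq p r x) = mset x"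
  by (induction r) auto

lemma swap_seq_map:
  "r \<le> length x \<Longrightarrow> (\<And>i. i < r \<Longrightarrow> p i < length x) \<Longrightarrow>
     swap_seq p r (map f x) = map f (swap_seq p r x)"
  by (induction r) (auto simp: swap_at_def map_update)

lemma swap_seq_cong: "(\<And>i. i < r \<Longrightarrow> p i = q i) \<Longrightarrow> swap_seq p r x = swap_seq q r x"
  by (induction r) auto

lemma swap_seq_eq_map_nth:
  assumes "\<And>i. i < length x \<Longrightarrow> p i < length x"
  shows "swap_seq p (length x) x = map ((!) x) (swap_seq p (length x) [0..<length x])"
  using swap_seq_map[of "length x" "[0..<length x]" p "(!) x"] assms by (simp add: map_nth)

text \<open>As in selection sort, step \<open>r\<close> fetches the entry that \<open>z\<close> has
  at position \<open>r\<close> from the positions not yet settled. So k digits per leaf can express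
  every rearrangement.\<close>

lemma swap_seq_realizes:
  assumes "mset x = mset z"
  obtains p where "\<And>i. i < length x \<Longrightarrow> p i < length x" "swap_seq p (length x) x = z"
proof -
  define k where "k = length x"
  have lz: "length z = k" using assms k_def by (metis size_mset)
  have "\<exists>p. (\<forall>i<r. p i < k) \<and> take r (swap_seq p r x) = take r z" if "r \<le> k" for r
    using that
  proof (induction r)
    case (Suc r)
    then obtain p where p: "\<forall>i<r. p i < k" "take r (swap_seq p r x) = take r z" by auto
    define y where "y = swap_seq p r x"
    have ly: "length y = k" by (simp add: y_def k_def)
    have "mset y = mset z"
      using mset_swap_seq[of r x p] p(1) Suc.prems assms by (simp add: y_def k_def)
    then have "mset (take r y) + mset (drop r y) = mset (take r z) + mset (drop r z)"
      by (metis append_take_drop_id mset_append)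
    then have "set (drop r y) = set (drop r z)"
      using p(2) by (metis add_left_cancel mset_eq_setD y_def)
    moreover have "z ! r \<in> set (drop r z)"
      using Suc.prems lz by (metis Cons_nth_drop_Suc Suc_le_lessD list.set_intros(1))
    ultimately obtain l where l: "l < length (drop r y)" "drop r y ! l = z ! r"
      by (metis in_set_conv_nth)
    define j where "j = r + l"
    have j: "r \<le> j" "j < k" "y ! j = z ! r" using l ly by (auto simp: j_def)
    have "take (Suc r) (swap_at r j y) = take r y @ [y ! j]"
      using Suc.prems j ly by (simp add: take_Suc_conv_app_nth nth_swap_at) (simp add: swap_at_def)
    also have "\<dots> = take (Suc r) z"
      using Suc.prems j lz p(2) by (simp add: y_def take_Suc_conv_app_nth)
    finally have "take (Suc r) (swap_at r j y) = take (Suc r) z" .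
    moreover have "swap_seq (p(r := j)) (Suc r) x = swap_at r j y"
      using swap_seq_cong[of r "p(r := j)" p x] by (simp add: y_def)
    moreover have "\<forall>i<Suc r. (p(r := j)) i < k"
      using p(1) j(2) by (auto simp: less_Suc_eq)
    ultimately show ?case by metis
  qed auto
  from this[of k] obtain p where "\<forall>i<k. p i < k" "take k (swap_seq p k x) = take k z" by auto
  then show ?thesis using that[of p] lz by (simp add: k_def)
qed

fun solvable :: "nat \<Rightarrow> nat \<Rightarrow> 'a::linorder list set \<Rightarrow> bool" where
  "solvable k 0 X \<longleftrightarrow> (\<exists>p. (\<forall>i<k. p i < k) \<and> (\<forall>x\<in>X. sorted (swap_seq p k x)))"
| "solvable k (Suc d) X \<longleftrightarrow> (\<exists>i<k. \<exists>j<k.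
     solvable k d {x \<in> X. x ! i < x ! j} \<and> solvable k d {x \<in> X. \<not> x ! i < x ! j})"

lemma solvable_mono: "solvable k d X \<Longrightarrow> Y \<subseteq> X \<Longrightarrow> solvable k d Y"
proof (induction d arbitrary: X Y)
  case (Suc d)
  then obtain i j where ij: "i < k" "j < k" "solvable k d {x \<in> X. x ! i < x ! j}"
    "solvable k d {x \<in> X. \<not> x ! i < x ! j}" by auto
  have "solvable k d {x \<in> Y. x ! i < x ! j}"
    by (rule Suc.IH[OF ij(3)]) (use Suc.prems(2) in auto)
  moreover have "solvable k d {x \<in> Y. \<not> x ! i < x ! j}"
    by (rule Suc.IH[OF ij(4)]) (use Suc.prems(2) in auto)
  ultimately show ?case using ij(1,2) by auto
qed auto

lemma solvable_Suc: "k \<ge> 1 \<Longrightarrow> solvable k d X \<Longrightarrow> solvable k (Suc d) X"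
  using solvable_mono[of k d X] by (auto intro!: exI[of _ 0])

lemma solvable_add: "k \<ge> 1 \<Longrightarrow> solvable k d X \<Longrightarrow> solvable k (n + d) X"
  by (induction n) (auto simp: solvable_Suc simp del: solvable.simps)

text \<open>The members of \<open>X\<close> agree on the order of the first \<open>i\<close> positions, where ties are broken by
  the position.\<close>

definition agree :: "nat \<Rightarrow> 'a::linorder list set \<Rightarrow> bool" where
  "agree i X \<longleftrightarrow> (\<forall>x\<in>X. \<forall>y\<in>X. \<forall>u v. v < u \<longrightarrow> u < i \<longrightarrow> (x ! u < x ! v \<longleftrightarrow> y ! u < y ! v))"

lemma agree_subset: "agree i X \<Longrightarrow> Y \<subseteq> X \<Longrightarrow> agree i Y"
  unfolding agree_def by blast

text \<open>Sorting the pairs \<open>(x ! i, i)\<close> gives the stable sorting permutation of one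
  member. It depends only on the comparisons that \<open>agree\<close> fixes, so it sorts all the
  others too.\<close>

lemma solvable_if_agree:
  fixes X :: "'a::linorder list set"
  assumes "agree k X" "\<And>x. x \<in> X \<Longrightarrow> length x = k"
  shows "solvable k 0 X"
proof (cases "X = {}")
  case True
  then show ?thesis by (auto intro!: exI[of _ id])
next
  case False
  then obtain x where x: "x \<in> X" by blast
  define ps where "ps = sort (map (\<lambda>i. (x ! i, i)) [0..<k])"
  define z where "z = map snd ps"
  have "mset z = image_mset snd (mset (map (\<lambda>i. (x ! i, i)) [0..<k]))"
    unfolding z_def ps_def by (simp only: mset_map mset_sort)
  also have "\<dots> = mset [0..<k]" by (simp add: multiset.map_comp comp_def)
  finally obtain p where p: "\<And>i. i < k \<Longrightarrow> p i < k" "swap_seq p k [0..<k] = z"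
    using swap_seq_realizes[of "[0..<k]" z] by auto
  have lp: "length ps = k" and sp: "sorted ps" and dp: "distinct ps"
    by (auto simp: ps_def distinct_map inj_on_def)
  have ps: "\<exists>a<k. ps ! i = (x ! a, a)" if "i < k" for i
    using nth_mem[of i ps] that lp by (auto simp: ps_def)
  have "sorted (swap_seq p k y)" if y: "y \<in> X" for y
    unfolding sorted_iff_nth_mono_less
  proof (intro allI impI)
    fix i j assume ij: "i < j" "j < length (swap_seq p k y)"
    have ly: "length y = k" using assms(2) y .
    obtain a b where ab: "a < k" "b < k" "ps ! i = (x ! a, a)" "ps ! j = (x ! b, b)"
      using ps[of i] ps[of j] ij ly by auto
    have "ps ! i < ps ! j"
      using sp dp ij ly lp by (simp add: sorted_iff_nth_mono_less nth_eq_iff_index_eq order_le_less)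
    then have "x ! a < x ! b \<or> \<not> x ! b < x ! a \<and> a < b"
      using ab by auto
    then have "y ! a \<le> y ! b"
    proof
      assume lt: "x ! a < x ! b"
      show ?thesis
      proof (cases "b < a")
        case True
        then have "y ! a < y ! b" using lt assms(1) x y ab(1) unfolding agree_def by blast
        then show ?thesis by simp
      next
        case False
        then have "a < b" using lt by (metis linorder_neqE_nat order_less_irrefl)
        then show ?thesis using lt assms(1) x y ab(2) unfolding agree_def by (meson leI order_less_asym)
      qed
    next
      assume "\<not> x ! b < x ! a \<and> a < b"
      then have "\<not> y ! b < y ! a" using assms(1) x y ab(2) unfolding agree_def by blast
      then show ?thesis by simp
    qed
    moreover have "swap_seq p k y = map ((!) y) z"
      using swap_seq_eq_map_nth[of y p] p ly by simp
    ultimately show "swap_seq p k y ! i \<le> swap_seq p k y ! j"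
      using ab ij ly lp by (simp add: z_def)
  qed
  then show ?thesis using p(1) unfolding solvable.simps by blast
qed

text \<open>
  Insertion sort in the manner of Fredman: position \<open>i\<close> is inserted into the known order of the
  earlier ones. The subsets of \<open>X\<close> on which entry \<open>i\<close> is less than entry \<open>u\<close> form a chain for
  \<open>u < i\<close>, so comparing entry \<open>i\<close> with the two entries whose subsets have size closest to half of
  \<open>X\<close> from below and above either halves \<open>X\<close> or determines the place of entry \<open>i\<close>.
\<close>

lemma solvable_insertion:
  fixes X :: "'a::linorder list set"
  assumes "t + (k - i) = n" "i \<le> k" "k \<ge> 1" "agree i X" "finite X" "card X \<le> 2 ^ t"
    "\<And>x. x \<in> X \<Longrightarrow> length x = k"
  shows "solvable k (2 * n) X"
  using assms
proof (induction n arbitrary: t i X)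
  case 0
  then have "i = k" by simp
  then have "solvable k 0 X" using "0.prems"(4,7) by (simp add: solvable_if_agree del: solvable.simps)
  then show ?case by (simp del: solvable.simps)
next
  \<comment> \<open>Two comparisons lower \<open>t + (k - i)\<close> by one: they either halve the
    bound on \<open>card X\<close> or place one more entry.\<close>
  case (Suc n)
  show ?case
  proof (cases "i = k \<or> t = 0")
    case True
    have "agree k X"
    proof (cases "i = k")
      case False
      then have "card X \<le> 1" using True Suc.prems(6) by simp
      then have "x = y" if "x \<in> X" "y \<in> X" for x y
        using that Suc.prems(5) card_le_Suc0_iff_eq[of X] by auto
      then show ?thesis unfolding agree_def by metis
    qed (use Suc.prems(4) in simp)
    then have "solvable k 0 X"
      using Suc.prems(7) by (simp add: solvable_if_agree del: solvable.simps)
    then show ?thesis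
      using solvable_add[of k 0 X "2 * Suc n"] Suc.prems(3) by (simp del: solvable.simps)
  next
    case False
    then have i: "i < k" and "t > 0" using Suc.prems(2) by auto
    then obtain t' where t': "t = Suc t'" by (cases t) auto
    define Less where "Less u = {x \<in> X. x ! i < x ! u}" for u
    have fin: "finite (Less u)" for u using Suc.prems(5) by (simp add: Less_def)
    \<comment> \<open>Otherwise two members would have entry \<open>i\<close> between entries
      \<open>u\<close> and \<open>v\<close> in opposite orders, although they agree on the order of
      these two.\<close>
    have chain: "Less u \<subseteq> Less v \<or> Less v \<subseteq> Less u" if "u \<le> i" "v \<le> i" for u v
    proof (rule ccontr)
      assume "\<not> (Less u \<subseteq> Less v \<or> Less v \<subseteq> Less u)"
      then obtain x y where "x \<in> Less u" "x \<notin> Less v" "y \<in> Less v" "y \<notin> Less u" by blast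
      then have xy: "x \<in> X" "y \<in> X" "x ! i < x ! u" "x ! v \<le> x ! i" "y ! i < y ! v" "y ! u \<le> y ! i"
        by (auto simp: Less_def)
      then have "u < i" "v < i" using that by (auto simp: order_le_less)
      moreover have "x ! v < x ! u" "y ! u < y ! v" using xy by auto
      ultimately show False
        using Suc.prems(4) xy(1,2) unfolding agree_def by (metis linorder_neqE_nat order_less_asym)
    qed
    have halved: "solvable k (2 * n) Y" if "Y \<subseteq> X" "2 * card Y \<le> card X" for Y
    proof (rule Suc.IH[of t' i])
      show "agree i Y" using Suc.prems(4) that(1) by (rule agree_subset)
    qed (use Suc.prems that t' i finite_subset[of Y X] in auto)
    have inserted: "solvable k (2 * n) Y" if "Y \<subseteq> X" "\<And>x y u. x \<in> Y \<Longrightarrow> y \<in> Y \<Longrightarrow> u < i \<Longrightarrow>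
        (x \<in> Less u \<longleftrightarrow> y \<in> Less u)" for Y
    proof (rule Suc.IH[of t "Suc i"])
      have "agree i Y" using Suc.prems(4) that(1) by (rule agree_subset)
      show "agree (Suc i) Y"
        unfolding agree_def
      proof (intro ballI allI impI)
        fix x y u v assume xy: "x \<in> Y" "y \<in> Y" and uv: "v < u" "u < Suc i"
        show "x ! u < x ! v \<longleftrightarrow> y ! u < y ! v"
        proof (cases "u = i")
          case True
          have "x \<in> X" "y \<in> X" using xy that(1) by auto
          then show ?thesis using that(2)[OF xy, of v] uv True by (simp add: Less_def)
        next
          case False
          then have "u < i" using uv by simp
          with \<open>agree i Y\<close> xy uv(1) show ?thesis unfolding agree_def by blast
        qed
      qed
      have "card Y \<le> card X" using that(1) Suc.prems(5) by (rule card_mono[rotated])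
      then show "card Y \<le> 2 ^ t" using Suc.prems(6) by simp
    qed (use Suc.prems that i finite_subset[of Y X] in auto)
    define low where "low = {u. u \<le> i \<and> 2 * card (Less u) \<le> card X}"
    have "i \<in> low" by (simp add: low_def Less_def)
    moreover have fl: "finite low" by (simp add: low_def)
    ultimately have "Max ((\<lambda>u. card (Less u)) ` low) \<in> (\<lambda>u. card (Less u)) ` low"
      by (intro Max_in) auto
    then obtain lo where lo: "lo \<in> low" "Max ((\<lambda>u. card (Less u)) ` low) = card (Less lo)"
      by blast
    have max: "card (Less u) \<le> card (Less lo)" if "u \<in> low" for u
      unfolding lo(2)[symmetric] using fl that by (intro Max_ge) auto
    have low: "Less u \<subseteq> Less lo" if "u \<in> low" for u
    proof -
      have "u \<le> i" "lo \<le> i" using that lo(1) by (auto simp: low_def)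
      then consider "Less u \<subseteq> Less lo" | "Less lo \<subseteq> Less u" using chain by blast
      then show ?thesis
      proof cases
        case 2
        then show ?thesis using card_seteq[OF fin 2] max[OF that] by simp
      qed
    qed
    have "\<exists>hi\<le>i. solvable k (2 * n) {x \<in> X - Less lo. x ! i < x ! hi} \<and>
        solvable k (2 * n) {x \<in> X - Less lo. \<not> x ! i < x ! hi}"
    proof (cases "\<exists>u\<le>i. u \<notin> low")
      \<comment> \<open>No set exceeds half of \<open>X\<close>. Outside \<open>Less lo\<close>
        entry \<open>i\<close> is then less than no earlier entry, so its place is known, and the
        second comparison is the trivial one of entry \<open>i\<close> with itself.\<close>
      case False
      then have "x \<notin> Less u" if "x \<in> X - Less lo" "u < i" for x u
        using low[of u] that by auto
      then have sub: "solvable k (2 * n) Y" if "Y \<subseteq> X - Less lo" for Y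
        using that by (intro inserted) blast+
      show ?thesis by (intro exI[of _ i] conjI order_refl sub) auto
    next
      case True
      then obtain hi where hi: "hi \<le> i" "hi \<notin> low"
        "\<And>u. u \<le> i \<Longrightarrow> u \<notin> low \<Longrightarrow> card (Less hi) \<le> card (Less u)"
        using ex_is_arg_min_if_finite[of "{..i} - low" "\<lambda>u. card (Less u)"]
        by (auto simp: is_arg_min_linorder)
      have high: "Less hi \<subseteq> Less u" if u: "u \<le> i" "u \<notin> low" for u
      proof -
        consider "Less hi \<subseteq> Less u" | "Less u \<subseteq> Less hi" using chain[OF hi(1) u(1)] by blast
        then show ?thesis
        proof cases
          case 2
          then show ?thesis using card_seteq[OF fin 2] hi(3)[OF u] by simp
        qed
      qed
      have yes: "solvable k (2 * n) {x \<in> X - Less lo. x ! i < x ! hi}"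
      proof (rule inserted)
        fix x y u
        assume xy: "x \<in> {x \<in> X - Less lo. x ! i < x ! hi}" "y \<in> {x \<in> X - Less lo. x ! i < x ! hi}"
          and u: "u < i"
        \<comment> \<open>Every \<open>Less u\<close> either lies inside \<open>Less lo\<close> or
          contains \<open>Less hi\<close>, so it cannot separate two members of the
          difference.\<close>
        then have "x \<in> Less hi - Less lo" "y \<in> Less hi - Less lo" by (auto simp: Less_def)
        then show "x \<in> Less u \<longleftrightarrow> y \<in> Less u"
          using low[of u] high[of u] u by (cases "u \<in> low") auto
      qed auto
      have no: "solvable k (2 * n) {x \<in> X - Less lo. \<not> x ! i < x ! hi}"
      proof (rule solvable_mono[OF halved])
        have "card (X - Less hi) = card X - card (Less hi)"
          by (intro card_Diff_subset) (auto simp: fin, auto simp: Less_def)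
        then show "2 * card (X - Less hi) \<le> card X"
          using hi(1,2) by (auto simp: low_def)
      qed (auto simp: Less_def)
      show ?thesis by (intro exI[of _ hi] conjI hi(1) yes no)
    qed
    then obtain hi where "hi \<le> i \<and> solvable k (2 * n) {x \<in> X - Less lo. x ! i < x ! hi} \<and>
        solvable k (2 * n) {x \<in> X - Less lo. \<not> x ! i < x ! hi}" ..
    moreover from this i have "hi < k" by simp
    ultimately have "solvable k (Suc (2 * n)) (X - Less lo)"
      unfolding solvable.simps(2) by (intro exI[of _ i] conjI i exI[of _ hi]) auto
    moreover have "X - Less lo = {x \<in> X. \<not> x ! i < x ! lo}" by (auto simp: Less_def)
    ultimately have no: "solvable k (Suc (2 * n)) {x \<in> X. \<not> x ! i < x ! lo}" by simp
    have "solvable k (Suc (2 * n)) (Less lo)"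
      using lo(1) Suc.prems(3) by (intro solvable_Suc halved) (auto simp: low_def Less_def)
    then have yes: "solvable k (Suc (2 * n)) {x \<in> X. x ! i < x ! lo}"
      by (simp only: Less_def)
    have "lo < k" using lo(1) i by (simp add: low_def)
    then have "solvable k (Suc (Suc (2 * n))) X"
      unfolding solvable.simps(2)[of k "Suc (2 * n)"]
      by (intro exI[of _ i] conjI i exI[of _ lo] yes no)
    then show ?thesis by (simp del: solvable.simps)
  qed
qed

section \<open>From trees to tables\<close>

fun tree_path :: "nat \<Rightarrow> (bool list \<Rightarrow> nat \<times> nat) \<Rightarrow> 'a::linorder list \<Rightarrow> bool list" where
  "tree_path 0 G x = []"
| "tree_path (Suc d) G x = (let b = x ! fst (G []) < x ! snd (G []) in
     b # tree_path d (\<lambda>q. G (b # q)) x)"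

text \<open>\<open>tree_path\<close> recurses at the root, like \<open>solvable\<close>, whereas the
  machine extends its path at the lower end.\<close>

lemma tree_path_Suc_end:
  "tree_path (Suc d) G x = tree_path d G x @
     [x ! fst (G (tree_path d G x)) < x ! snd (G (tree_path d G x))]"
proof (induction d arbitrary: G)
  case (Suc d)
  show ?case
    by (subst tree_path.simps(2), subst Suc) (simp add: Let_def)
qed (simp add: Let_def)

text \<open>One labelling \<open>G\<close> of bit strings holds both kinds of data: the comparisons
  at the strings shorter than \<open>d\<close>, and the transposition of position \<open>r\<close>
  of a leaf at the string \<open>r\<close> steps to the left below it.\<close>

lemma solvable_imp_tree:
  assumes "solvable k d X" "k \<ge> 1"
  shows "\<exists>G. (\<forall>q. fst (G q) < k \<and> snd (G q) < k) \<and>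
    (\<forall>x\<in>X. sorted (swap_seq (\<lambda>r. fst (G (tree_path d G x @ replicate r False))) k x))"
  using assms(1)
proof (induction d arbitrary: X)
  case 0
  then obtain p where p: "\<forall>i<k. p i < k" "\<forall>x\<in>X. sorted (swap_seq p k x)" by auto
  define G where "G q = (if length q < k then p (length q) else 0, 0::nat)" for q :: "bool list"
  have "swap_seq (\<lambda>r. fst (G (replicate r False))) k x = swap_seq p k x" for x :: "'a list"
    by (rule swap_seq_cong) (simp add: G_def)
  then show ?case
    using p assms(2) by (intro exI[of _ G]) (auto simp: G_def)
next
  case (Suc d)
  then obtain i j where ij: "i < k" "j < k" and
    s: "solvable k d {x \<in> X. x ! i < x ! j}" "solvable k d {x \<in> X. \<not> x ! i < x ! j}"
    by auto
  obtain T where T: "\<forall>q. fst (T q) < k \<and> snd (T q) < k"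
    "\<forall>x\<in>{x \<in> X. x ! i < x ! j}. sorted (swap_seq (\<lambda>r. fst (T (tree_path d T x @ replicate r False))) k x)"
    using Suc.IH[OF s(1)] by blast
  obtain F where F: "\<forall>q. fst (F q) < k \<and> snd (F q) < k"
    "\<forall>x\<in>{x \<in> X. \<not> x ! i < x ! j}. sorted (swap_seq (\<lambda>r. fst (F (tree_path d F x @ replicate r False))) k x)"
    using Suc.IH[OF s(2)] by blast
  define G where "G q = (case q of [] \<Rightarrow> (i, j) | b # q' \<Rightarrow> if b then T q' else F q')" for q
  have [simp]: "G [] = (i, j)" "G (b # q) = (if b then T q else F q)" for b q
    by (auto simp: G_def)
  have "\<forall>q. fst (G q) < k \<and> snd (G q) < k"
    using T(1) F(1) ij by (auto simp: G_def split: list.split)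
  moreover have "sorted (swap_seq (\<lambda>r. fst (G (tree_path (Suc d) G x @ replicate r False))) k x)"
    if "x \<in> X" for x
    using T(2) F(2) that by (cases "x ! i < x ! j") (auto simp: Let_def)
  ultimately show ?case by blast
qed

text \<open>The bits are read as a binary number behind a leading 1, which keeps strings with
  leading zeros apart.\<close>

definition heap_index :: "bool list \<Rightarrow> nat" where
  "heap_index q = foldl (\<lambda>v b. 2 * v + of_bool b) 1 q"

lemma heap_index_simps [simp]:
  "heap_index [] = 1" "heap_index (q @ [b]) = 2 * heap_index q + of_bool b"
  by (auto simp: heap_index_def)

lemma heap_index_pos: "heap_index q \<ge> 1"
  by (induction q rule: rev_induct) auto

lemma inj_heap_index: "inj heap_index"
proof (rule injI)
  fix p q show "heap_index p = heap_index q \<Longrightarrow> p = q"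
  proof (induction p arbitrary: q rule: rev_induct)
    case Nil
    show ?case
    proof (cases q rule: rev_cases)
      case (snoc q' b)
      then show ?thesis using Nil heap_index_pos[of q'] by simp
    qed simp
  next
    case (snoc b p)
    show ?case
    proof (cases q rule: rev_cases)
      case Nil
      then show ?thesis
        using snoc.prems heap_index_pos[of p] by simp
    next
      case (snoc q' c)
      then have *: "2 * heap_index p + of_bool b = 2 * heap_index q' + (of_bool c :: nat)"
        using snoc.prems by simp
      then have "heap_index p = heap_index q'" "b = c"
        by (cases b; cases c; simp; presburger)+
      then show ?thesis using snoc.IH snoc by simp
    qed
  qed
qed

lemma heap_index_replicate: "heap_index (q @ replicate r False) = heap_index q * 2 ^ r"
proof (induction r)
  case (Suc r)
  have "q @ replicate (Suc r) False = (q @ replicate r False) @ [False]"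
    by (simp add: replicate_append_same)
  then show ?case using Suc by (simp only: heap_index_simps) simp
qed simp

lemma solvable_imp_table:
  assumes "solvable k d X" "k \<ge> 1" "\<And>x. x \<in> X \<Longrightarrow> length x = k"
  shows "\<exists>g. (\<forall>u. g u < k) \<and> (\<forall>x\<in>X. sorted (run_tree g d x))"
proof -
  obtain G where G: "\<forall>q. fst (G q) < k \<and> snd (G q) < k"
    "\<forall>x\<in>X. sorted (swap_seq (\<lambda>r. fst (G (tree_path d G x @ replicate r False))) k x)"
    using solvable_imp_tree[OF assms(1,2)] by blast
  \<comment> \<open>A number that is no heap index receives the label of some unspecified string. It
    stays below \<open>k\<close>, because the bound on \<open>G\<close> holds for all
    strings.\<close>
  define g where "g u = (if even u then fst else snd) (G (inv_into UNIV heap_index (u div 2)))" for u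
  have g: "g (2 * heap_index q) = fst (G q)" "g (2 * heap_index q + 1) = snd (G q)" for q
    using inv_into_f_f[OF inj_heap_index] by (auto simp: g_def)
  have node: "node g x r = heap_index (tree_path r G x)" for x :: "'a list" and r
  proof (induction r)
    case (Suc r)
    then show ?case
      by (simp only: node.simps Let_def g tree_path_Suc_end heap_index_simps) simp
  qed simp
  have "run_tree g d x = swap_seq (\<lambda>r. fst (G (tree_path d G x @ replicate r False))) k x"
    if "x \<in> X" for x
    unfolding run_tree_def swaps_eq_swap_seq node heap_index_replicate[symmetric] g
    using assms(3) that by simp
  moreover have "\<forall>u. g u < k" using G(1) by (simp add: g_def)
  ultimately show ?thesis using G(2) by (intro exI[of _ g]) auto
qed

text \<open>Only comparisons influence a run, so both sequences follow the same path and undergo the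
  same rearrangement \<open>z\<close> of positions. This transfers a table found for lists of ranks
  to sequences over any linear order.\<close>

lemma sorted_run_tree_iff:
  assumes "\<And>u. g u < k" "length x = k" "length y = k"
    "\<And>i j. i < k \<Longrightarrow> j < k \<Longrightarrow> x ! i < x ! j \<longleftrightarrow> y ! i < y ! j"
  shows "sorted (run_tree g d x) \<longleftrightarrow> sorted (run_tree g d y)"
proof -
  have node: "node g x r = node g y r" for r
    by (induction r) (simp_all add: Let_def assms(1,4))
  define z where "z = swap_seq (\<lambda>i. g (2 * (node g y d * 2 ^ i))) k [0..<k]"
  have "mset z = mset [0..<k]" unfolding z_def by (rule mset_swap_seq) (auto simp: assms(1))
  then have z: "z ! i < k" if "i < k" for i
    using that mset_eq_setD[of z "[0..<k]"] nth_mem[of i z] by (auto simp: z_def)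
  have "run_tree g d x = map ((!) x) z" "run_tree g d y = map ((!) y) z"
    using swap_seq_eq_map_nth[of x "\<lambda>i. g (2 * (node g y d * 2 ^ i))"]
      swap_seq_eq_map_nth[of y "\<lambda>i. g (2 * (node g y d * 2 ^ i))"]
    by (simp_all add: run_tree_def node swaps_eq_swap_seq z_def assms)
  then show ?thesis
    using z assms(4) by (auto simp: sorted_iff_nth_mono_less z_def linorder_not_less[symmetric])
qed

lemma exists_table:
  fixes X :: "'a::linorder list set"
  assumes "finite X" "card X \<le> 2 ^ t" "k \<ge> 1" "\<And>x. x \<in> X \<Longrightarrow> length x = k"
  shows "\<exists>g. (\<forall>u. g u < k) \<and> (\<forall>x\<in>X. sorted (run_tree g (2 * (t + k)) x))"
proof (rule solvable_imp_table)
  show "solvable k (2 * (t + k)) X"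
    by (rule solvable_insertion[of t k 0]) (use assms in \<open>auto simp: agree_def\<close>)
qed (use assms in auto)

section \<open>Order types as lists of ranks\<close>

definition rank_list :: "'a::linorder list \<Rightarrow> nat list" where
  "rank_list s = map (\<lambda>a. card {b \<in> set s. b < a}) s"

lemma length_rank_list [simp]: "length (rank_list s) = length s"
  by (simp add: rank_list_def)

lemma rank_list_less_iff:
  assumes "i < length s" "j < length s"
  shows "rank_list s ! i < rank_list s ! j \<longleftrightarrow> s ! i < s ! j"
proof
  assume lt: "s ! i < s ! j"
  have "{b \<in> set s. b < s ! i} \<subseteq> {b \<in> set s. b < s ! j}"
    using lt by auto
  moreover have "s ! i \<in> {b \<in> set s. b < s ! j}" "s ! i \<notin> {b \<in> set s. b < s ! i}"
    using lt assms(1) by auto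
  ultimately have "{b \<in> set s. b < s ! i} \<subset> {b \<in> set s. b < s ! j}" by blast
  then show "rank_list s ! i < rank_list s ! j"
    using assms by (simp add: rank_list_def psubset_card_mono)
next
  assume *: "rank_list s ! i < rank_list s ! j"
  show "s ! i < s ! j"
  proof (rule ccontr)
    assume "\<not> s ! i < s ! j"
    then have "card {b \<in> set s. b < s ! j} \<le> card {b \<in> set s. b < s ! i}"
      by (intro card_mono) auto
    then show False using * assms by (simp add: rank_list_def)
  qed
qed

text \<open>Ranks bounded by the length leave only finitely many order types of each length.\<close>

lemma rank_list_less_length: "r \<in> set (rank_list s) \<Longrightarrow> r < length s"
proof -
  assume "r \<in> set (rank_list s)"
  then obtain a where a: "a \<in> set s" "r = card {b \<in> set s. b < a}"
    by (auto simp: rank_list_def)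
  then have "{b \<in> set s. b < a} \<subset> set s" by blast
  then have "r < card (set s)"
    using a by (simp add: psubset_card_mono)
  then show ?thesis using card_length[of s] by simp
qed

lemma seq_contains_rank_list: "seq_contains (rank_list s) \<pi> \<longleftrightarrow> seq_contains s \<pi>"
  unfolding seq_contains_def by (auto simp: rank_list_less_iff)

section \<open>Patterns in sets of cells\<close>

text \<open>
  Point \<open>j\<close> of a pattern of size \<open>l\<close> lies in row \<open>p j\<close> and column \<open>q j\<close>. Keeping both coordinates
  makes the notion symmetric under transposition.
\<close>

definition occurs :: "nat \<Rightarrow> (nat \<Rightarrow> nat) \<Rightarrow> (nat \<Rightarrow> nat) \<Rightarrow> (nat \<times> nat) set \<Rightarrow> bool" where
  "occurs l p q E \<longleftrightarrow> (\<exists>R C. (\<forall>j<l. (R j, C j) \<in> E) \<and>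
     (\<forall>i<l. \<forall>j<l. p i < p j \<longrightarrow> R i < (R j :: nat)) \<and> (\<forall>i<l. \<forall>j<l. q i < q j \<longrightarrow> C i < (C j :: nat)))"

definition extremal :: "nat \<Rightarrow> (nat \<Rightarrow> nat) \<Rightarrow> (nat \<Rightarrow> nat) \<Rightarrow> nat \<Rightarrow> nat" where
  "extremal l p q n = Max (card ` {E. E \<subseteq> {..<n} \<times> {..<n} \<and> \<not> occurs l p q E})"

definition contract :: "nat \<Rightarrow> (nat \<times> nat) set \<Rightarrow> (nat \<times> nat) set" where
  "contract b E = (\<lambda>(r, c). (r div b, c div b)) ` E"

lemma occurs_mono: "occurs l p q E \<Longrightarrow> E \<subseteq> F \<Longrightarrow> occurs l p q F"
  unfolding occurs_def by blast

lemma not_occurs_empty: "l \<ge> 1 \<Longrightarrow> \<not> occurs l p q {}"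
  by (auto simp: occurs_def intro!: exI[of _ 0])

lemma occurs_transpose: "occurs l q p (prod.swap ` E) \<longleftrightarrow> occurs l p q E"
proof -
  have "(a, b) \<in> prod.swap ` E \<longleftrightarrow> (b, a) \<in> E" for a b by force
  then have "occurs l q p (prod.swap ` E) \<longleftrightarrow> (\<exists>R C. (\<forall>j<l. (C j, R j) \<in> E) \<and>
     (\<forall>i<l. \<forall>j<l. q i < q j \<longrightarrow> R i < R j) \<and> (\<forall>i<l. \<forall>j<l. p i < p j \<longrightarrow> C i < C j))"
    by (simp add: occurs_def)
  also have "\<dots> \<longleftrightarrow> occurs l p q E"
    unfolding occurs_def by (subst ex_comm) (simp only: conj_commute conj_left_commute)
  finally show ?thesis .
qed

lemma div_less_imp_less: "a div b < c div b \<Longrightarrow> a < (c::nat)"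
  by (meson div_le_mono leD leI)

text \<open>Pick one entry from each block used. Strict inequalities between block indices carry
  over to any choice of entries in the blocks.\<close>

lemma occurs_contract:
  assumes "occurs l p q (contract b E)"
  shows "occurs l p q E"
proof -
  obtain R C where RC: "\<forall>j<l. (R j, C j) \<in> contract b E"
    "\<forall>i<l. \<forall>j<l. p i < p j \<longrightarrow> R i < R j" "\<forall>i<l. \<forall>j<l. q i < q j \<longrightarrow> C i < C j"
    using assms unfolding occurs_def by blast
  have "\<forall>j. \<exists>r c. j < l \<longrightarrow> (r, c) \<in> E \<and> r div b = R j \<and> c div b = C j"
    using RC(1) by (fastforce simp: contract_def)
  then obtain R' C' where *: "\<And>j. j < l \<Longrightarrow> (R' j, C' j) \<in> E \<and> R' j div b = R j \<and> C' j div b = C j"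
    by metis
  show ?thesis
    unfolding occurs_def
  proof (intro exI conjI allI impI)
    fix i j assume "i < l" "j < l" "p i < p j"
    then show "R' i < R' j" using RC(2) * by (metis div_less_imp_less)
  next
    fix i j assume "i < l" "j < l" "q i < q j"
    then show "C' i < C' j" using RC(3) * by (metis div_less_imp_less)
  qed (use * in blast)
qed

lemma card_le_extremal:
  assumes "E \<subseteq> {..<n} \<times> {..<n}" "\<not> occurs l p q E"
  shows "card E \<le> extremal l p q n"
proof -
  have "finite {E. E \<subseteq> {..<n} \<times> {..<n} \<and> \<not> occurs l p q E}"
    by (rule finite_subset[of _ "Pow ({..<n} \<times> {..<n})"]) auto
  then show ?thesis
    unfolding extremal_def using assms by (intro Max_ge) auto
qed

lemma extremal_attained:
  assumes "l \<ge> 1"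
  obtains E where "E \<subseteq> {..<n} \<times> {..<n}" "\<not> occurs l p q E" "card E = extremal l p q n"
proof -
  let ?A = "{E. E \<subseteq> {..<n} \<times> {..<n} \<and> \<not> occurs l p q E}"
  have "finite ?A"
    by (rule finite_subset[of _ "Pow ({..<n} \<times> {..<n})"]) auto
  moreover have "{} \<in> ?A" using not_occurs_empty assms by auto
  ultimately have "extremal l p q n \<in> card ` ?A"
    unfolding extremal_def by (intro Max_in) auto
  then show ?thesis using that by auto
qed


section \<open>The Marcus--Tardos theorem\<close>

lemma ex_strict_mono_into:
  assumes "finite A" "l \<le> card A"
  obtains f :: "nat \<Rightarrow> nat" where "\<And>i. i < l \<Longrightarrow> f i \<in> A" "\<And>i j. i < j \<Longrightarrow> j < l \<Longrightarrow> f i < f j"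
proof
  let ?xs = "sorted_list_of_set A"
  show "?xs ! i \<in> A" if "i < l" for i
    using that assms nth_mem[of i ?xs] by simp
  show "?xs ! i < ?xs ! j" if "i < j" "j < l" for i j
    using sorted_wrt_nth_less[OF strict_sorted_list_of_set, of i j A] that assms by simp
qed

definition cell :: "nat \<Rightarrow> (nat \<times> nat) set \<Rightarrow> nat \<Rightarrow> nat \<Rightarrow> (nat \<times> nat) set" where
  "cell b E i j = {(r, c) \<in> E. r div b = i \<and> c div b = j}"

text \<open>The wide blocks of the Marcus--Tardos argument: those with entries in at least
  \<open>l\<close> different columns. Tall blocks are obtained by transposition.\<close>

definition wide :: "nat \<Rightarrow> nat \<Rightarrow> (nat \<times> nat) set \<Rightarrow> nat \<Rightarrow> nat \<Rightarrow> bool" where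
  "wide l b E i j \<longleftrightarrow> l \<le> card ((\<lambda>(r, c). c mod b) ` cell b E i j)"

text \<open>Pigeonhole within one column of blocks: every wide block selects \<open>l\<close> of its
  \<open>b\<close> columns, and there are at most 2 ^ b selections. If \<open>l\<close> blocks share
  a selection, point u of the pattern can be found in block number \<open>p u\<close>, in selected
  column number \<open>q u\<close>.\<close>

lemma card_wide_le:
  assumes "\<not> occurs l p q E" "\<And>j. j < l \<Longrightarrow> p j < l" "\<And>j. j < l \<Longrightarrow> q j < l" "b \<ge> 1"
  shows "card {i. i < n \<and> wide l b E i j} \<le> l * 2 ^ b"
proof (rule ccontr)
  assume large: "\<not> card {i. i < n \<and> wide l b E i j} \<le> l * 2 ^ b"
  define W where "W = {i. i < n \<and> wide l b E i j}"
  define cols where "cols i = (\<lambda>(r, c). c mod b) ` cell b E i j" for i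
  have cols: "cols i \<subseteq> {..<b}" for i using assms(4) by (auto simp: cols_def)
  then have "finite (cols i)" for i using finite_subset by blast
  then have "\<forall>i. \<exists>A. i \<in> W \<longrightarrow> A \<subseteq> cols i \<and> card A = l"
    unfolding W_def wide_def cols_def[symmetric] by (metis (mono_tags, lifting) mem_Collect_eq obtain_subset_with_card_n)
  then obtain A where A: "\<And>i. i \<in> W \<Longrightarrow> A i \<subseteq> cols i \<and> card (A i) = l" by metis
  have "\<exists>B\<in>Pow {..<b}. l \<le> card {i \<in> W. A i = B}"
  proof (rule ccontr)
    assume "\<not> ?thesis"
    then have "card {i \<in> W. A i = B} \<le> l" if "B \<in> Pow {..<b}" for B
      using that by (meson le_cases)
    then have "(\<Sum>B\<in>Pow {..<b}. card {i \<in> W. A i = B}) \<le> (\<Sum>B\<in>Pow {..<b}. l)"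
      by (rule sum_mono)
    moreover have "A i \<in> Pow {..<b}" if "i \<in> W" for i
      using A[OF that] cols[of i] by auto
    then have "W = (\<Union>B\<in>Pow {..<b}. {i \<in> W. A i = B})"
      by auto
    then have "card W \<le> (\<Sum>B\<in>Pow {..<b}. card {i \<in> W. A i = B})"
      by (metis card_UN_le finite_Pow_iff finite_lessThan)
    ultimately show False
      using large by (simp add: W_def card_Pow mult.commute)
  qed
  then obtain B where B: "B \<subseteq> {..<b}" "l \<le> card {i \<in> W. A i = B}" by blast
  have "finite W" by (simp add: W_def)
  then obtain f where f: "\<And>i. i < l \<Longrightarrow> f i \<in> {i \<in> W. A i = B}" "\<And>i j. i < j \<Longrightarrow> j < l \<Longrightarrow> f i < f j"
    using ex_strict_mono_into[of "{i \<in> W. A i = B}" l] B(2) by (auto intro: that)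
  show False
  proof (cases "l = 0")
    case True
    then show False using assms(1) by (auto simp: occurs_def)
  next
    case False
    then have "card B = l" using f(1)[of 0] A by auto
    then obtain a where a: "\<And>i. i < l \<Longrightarrow> a i \<in> B" "\<And>i j. i < j \<Longrightarrow> j < l \<Longrightarrow> a i < a j"
      using ex_strict_mono_into[of B l] finite_subset[OF B(1)] by auto
    have "\<exists>r. u < l \<longrightarrow> (r, j * b + a (q u)) \<in> E \<and> r div b = f (p u)" for u
    proof (cases "u < l")
      case True
      then have fp: "f (p u) \<in> W" "A (f (p u)) = B" using f(1)[of "p u"] assms(2) by auto
      have "a (q u) \<in> cols (f (p u))"
        using a(1)[OF assms(3)[OF True]] A[OF fp(1)] fp(2) by auto
      then obtain r c where "(r, c) \<in> E" "r div b = f (p u)" "c div b = j" "c mod b = a (q u)"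
        by (auto simp: cols_def cell_def)
      then show ?thesis using div_mult_mod_eq[of c b] by metis
    qed auto
    then obtain R where R: "\<And>u. u < l \<Longrightarrow> (R u, j * b + a (q u)) \<in> E \<and> R u div b = f (p u)"
      by metis
    have "occurs l p q E"
      unfolding occurs_def
    proof (intro exI conjI allI impI)
      fix u v assume "u < l" "v < l" "p u < p v"
      then show "R u < R v" using f(2) assms(2) R by (metis div_less_imp_less)
    next
      fix u v assume "u < l" "v < l" "q u < q v"
      then show "j * b + a (q u) < j * b + a (q v)" using a(2) assms(3) by simp
    qed (use R in blast)
    then show False using assms(1) by blast
  qed
qed

text \<open>A block lies in the product of its row set and its column set. So a block neither wide
  nor tall has at most \<open>(l - 1)\<^sup>2\<close> entries, and the number of nonempty blocks is
  bounded by \<open>extremal\<close> at size \<open>n\<close>. Wide and tall blocks are few and have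
  at most \<open>b\<^sup>2\<close> entries each.\<close>

lemma card_contract_step:
  assumes "E \<subseteq> {..<b * n} \<times> {..<b * n}" "\<not> occurs l p q E"
    "\<And>j. j < l \<Longrightarrow> p j < l" "\<And>j. j < l \<Longrightarrow> q j < l" "b \<ge> 1"
  shows "card E \<le> (l - 1)\<^sup>2 * extremal l p q n + 2 * (n * (l * 2 ^ b) * b\<^sup>2)"
proof -
  define F where "F = contract b E"
  define tall where "tall i j = wide l b (prod.swap ` E) j i" for i j
  define W where "W = (SIGMA j:{..<n}. {i. i < n \<and> wide l b E i j})"
  define T where "T = (SIGMA i:{..<n}. {j. j < n \<and> tall i j})"
  have finE: "finite E" using assms(1) finite_subset by blast
  then have finF: "finite F" by (simp add: F_def contract_def)
  have F: "F \<subseteq> {..<n} \<times> {..<n}"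
    using assms(1,5) by (auto simp: F_def contract_def less_mult_imp_div_less mult.commute)
  have "\<not> occurs l p q F" using occurs_contract assms(2) by (auto simp: F_def)
  then have cardF: "card F \<le> extremal l p q n" using F card_le_extremal by blast
  have finW: "finite W" "finite T" by (auto simp: W_def T_def)
  have "card W = (\<Sum>j<n. card {i. i < n \<and> wide l b E i j})"
    by (auto simp: W_def)
  also have "\<dots> \<le> (\<Sum>j<n. l * 2 ^ b)"
    using card_wide_le[OF assms(2-5)] by (intro sum_mono) auto
  finally have cardW: "card W \<le> n * (l * 2 ^ b)" by simp
  have "\<not> occurs l q p (prod.swap ` E)" using assms(2) occurs_transpose by blast
  then have tall: "card {j. j < n \<and> tall i j} \<le> l * 2 ^ b" for i
    unfolding tall_def using card_wide_le assms(3-5) by blast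
  have "card T = (\<Sum>i<n. card {j. j < n \<and> tall i j})"
    by (auto simp: T_def)
  also have "\<dots> \<le> (\<Sum>i<n. l * 2 ^ b)"
    using tall by (intro sum_mono) auto
  finally have cardT: "card T \<le> n * (l * 2 ^ b)" by simp
  have fin: "finite (cell b E i j)" for i j
    using finE by (rule finite_subset[rotated]) (auto simp: cell_def)
  have modinj: "cell b E i j \<subseteq> (\<lambda>(r, c). (i * b + r, j * b + c)) `
      (((\<lambda>(r, c). r mod b) ` cell b E i j) \<times> ((\<lambda>(r, c). c mod b) ` cell b E i j))" for i j
  proof
    fix x assume x: "x \<in> cell b E i j"
    obtain r c where rc: "x = (r, c)" by (cases x)
    then have "r = i * b + r mod b" "c = j * b + c mod b"
      using x div_mult_mod_eq[of r b] div_mult_mod_eq[of c b] by (auto simp: cell_def)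
    then have "x = (\<lambda>(r, c). (i * b + r, j * b + c)) (r mod b, c mod b)" by (simp add: rc)
    moreover have "(r mod b, c mod b) \<in>
        ((\<lambda>(r, c). r mod b) ` cell b E i j) \<times> ((\<lambda>(r, c). c mod b) ` cell b E i j)"
      using x rc by force
    ultimately show "x \<in> (\<lambda>(r, c). (i * b + r, j * b + c)) `
      (((\<lambda>(r, c). r mod b) ` cell b E i j) \<times> ((\<lambda>(r, c). c mod b) ` cell b E i j))" by blast
  qed
  have cell: "card (cell b E i j) \<le> card ((\<lambda>(r, c). r mod b) ` cell b E i j) *
      card ((\<lambda>(r, c). c mod b) ` cell b E i j)" for i j
    unfolding card_cartesian_product[symmetric]
    using modinj[of i j] fin by (meson card_image_le card_mono finite_SigmaI finite_imageI le_trans)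
  have mod_le: "card ((\<lambda>(r, c). r mod b) ` cell b E i j) \<le> b"
    "card ((\<lambda>(r, c). c mod b) ` cell b E i j) \<le> b" for i j
    using assms(5) card_mono[of "{..<b}"] by (force intro!: card_mono[of "{..<b}", simplified])+
  have cell_le: "card (cell b E i j) \<le> b\<^sup>2" for i j
    using cell[of i j] mult_le_mono[OF mod_le] by (metis le_trans power2_eq_square)
  have small: "card (cell b E i j) \<le> (l - 1)\<^sup>2" if "\<not> wide l b E i j" "\<not> tall i j" for i j
  proof -
    have "cell b (prod.swap ` E) j i = prod.swap ` cell b E i j" by (force simp: cell_def)
    then have "(\<lambda>(r, c). c mod b) ` cell b (prod.swap ` E) j i = (\<lambda>(r, c). r mod b) ` cell b E i j"
      by (force simp: image_image)
    then have s: "card ((\<lambda>(r, c). r mod b) ` cell b E i j) \<le> l - 1"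
      "card ((\<lambda>(r, c). c mod b) ` cell b E i j) \<le> l - 1"
      using that by (auto simp: tall_def wide_def)
    then show ?thesis
      using cell[of i j] mult_le_mono[OF s] by (simp add: power2_eq_square)
  qed
  have "E \<subseteq> (\<Union>(i, j)\<in>F. cell b E i j)"
    by (force simp: F_def contract_def cell_def)
  then have "card E \<le> card (\<Union>(i, j)\<in>F. cell b E i j)"
    using fin finF by (intro card_mono) auto
  also have "\<dots> \<le> (\<Sum>x\<in>F. card (case x of (i, j) \<Rightarrow> cell b E i j))"
    using finF by (rule card_UN_le)
  also have "\<dots> \<le> (\<Sum>x\<in>F. (l - 1)\<^sup>2 + ((if prod.swap x \<in> W then b\<^sup>2 else 0) + (if x \<in> T then b\<^sup>2 else 0)))"
  proof (rule sum_mono)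
    fix x assume x: "x \<in> F"
    obtain i j where ij: "x = (i, j)" by (cases x)
    then have "i < n" "j < n" using F x by auto
    then show "card (case x of (i, j) \<Rightarrow> cell b E i j)
      \<le> (l - 1)\<^sup>2 + ((if prod.swap x \<in> W then b\<^sup>2 else 0) + (if x \<in> T then b\<^sup>2 else 0))"
      using small[of i j] cell_le[of i j] by (auto simp: ij W_def T_def)
  qed
  also have "\<dots> = card F * (l - 1)\<^sup>2 + ((\<Sum>x\<in>F. if prod.swap x \<in> W then b\<^sup>2 else 0) +
      (\<Sum>x\<in>F. if x \<in> T then b\<^sup>2 else 0))"
    by (simp add: sum.distrib)
  also have "(\<Sum>x\<in>F. if prod.swap x \<in> W then b\<^sup>2 else 0) \<le> card W * b\<^sup>2"
  proof -
    have "card {x \<in> F. prod.swap x \<in> W} \<le> card W"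
      using finW by (intro card_inj_on_le[of prod.swap]) auto
    then show ?thesis
      using finF by (simp add: sum.If_cases Int_def)
  qed
  also have "(\<Sum>x\<in>F. if x \<in> T then b\<^sup>2 else 0) \<le> card T * b\<^sup>2"
  proof -
    have "card {x \<in> F. x \<in> T} \<le> card T"
      using finW by (intro card_mono) auto
    then show ?thesis
      using finF by (simp add: sum.If_cases Int_def)
  qed
  finally have "card E \<le> card F * (l - 1)\<^sup>2 + (card W * b\<^sup>2 + card T * b\<^sup>2)" by simp
  also have "\<dots> \<le> extremal l p q n * (l - 1)\<^sup>2 + (n * (l * 2 ^ b) * b\<^sup>2 + n * (l * 2 ^ b) * b\<^sup>2)"
    using cardF cardW cardT by (intro add_mono mult_le_mono) auto
  finally show ?thesis by (simp add: mult.commute mult_2)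
qed

lemma extremal_linear:
  assumes "l \<ge> 2" "\<And>j. j < l \<Longrightarrow> p j < l" "\<And>j. j < l \<Longrightarrow> q j < l"
  shows "\<exists>K. \<forall>n. extremal l p q n \<le> K * n"
proof -
  \<comment> \<open>The size is chosen so that \<open>(l - 1)\<^sup>2 + 1 \<le> b\<close>, which
    makes the recursion from \<open>n\<close> to \<open>n div b\<close> linear.\<close>
  define b where "b = l\<^sup>2"
  define A where "A = 2 * (l * 2 ^ b * b\<^sup>2)"
  \<comment> \<open>\<open>A\<close> pays for the wide and tall blocks, and
    \<open>2 * b\<^sup>2\<close> for the at most 2 b n entries in the fewer than b rows and columns
    beyond the last full block.\<close>
  define K where "K = A + 2 * b\<^sup>2"
  have "b \<ge> 2\<^sup>2" unfolding b_def using assms(1) by (rule power_mono) simp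
  then have b: "b \<ge> 2" by simp
  have "extremal l p q n \<le> K * n" for n
  proof (induction n rule: less_induct)
    case (less n)
    obtain E where E: "E \<subseteq> {..<n} \<times> {..<n}" "\<not> occurs l p q E" "card E = extremal l p q n"
      using extremal_attained assms(1) by (metis le_trans one_le_numeral)
    have finE: "finite E" using E(1) finite_subset by blast
    define h where "h = n div b"
    define r where "r = n mod b"
    have n: "n = b * h + r" "r < b" using b by (simp_all add: h_def r_def)
    show ?case
    proof (cases "n = 0")
      case True
      then show ?thesis using E by simp
    next
      case False
      then have "h < n" using b by (simp add: h_def)
      define E0 where "E0 = E \<inter> {..<b * h} \<times> {..<b * h}"
      have "\<not> occurs l p q E0" using E(2) occurs_mono E0_def by blast
      then have "card E0 \<le> (l - 1)\<^sup>2 * extremal l p q h + 2 * (h * (l * 2 ^ b) * b\<^sup>2)"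
        using assms b by (intro card_contract_step) (auto simp: E0_def)
      also have "\<dots> \<le> (l - 1)\<^sup>2 * (K * h) + A * h"
        using less.IH[OF \<open>h < n\<close>] by (simp add: A_def mult_ac)
      finally have E0: "card E0 \<le> (l - 1)\<^sup>2 * (K * h) + A * h" .
      have "E - E0 \<subseteq> {b * h..<n} \<times> {..<n} \<union> {..<n} \<times> {b * h..<n}"
        using E(1) by (auto simp: E0_def)
      then have "card (E - E0) \<le> card ({b * h..<n} \<times> {..<n} \<union> {..<n} \<times> {b * h..<n})"
        by (rule card_mono[rotated]) simp
      also have "\<dots> \<le> r * n + n * r"
        using n by (intro order_trans[OF card_Un_le]) simp
      also have "\<dots> \<le> 2 * (b * n)"
      proof -
        have "r * n \<le> b * n" using n(2) by (intro mult_le_mono1) simp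
        then show ?thesis using mult.commute[of n r] by linarith
      qed
      finally have E1: "card (E - E0) \<le> 2 * (b * n)" .
      have "card E = card E0 + card (E - E0)"
        using finE by (metis E0_def Int_lower1 card_Diff_subset card_mono finite_Int le_add_diff_inverse)
      then have "card E \<le> (l - 1)\<^sup>2 * (K * h) + A * h + 2 * (b * n)" using E0 E1 by linarith
      also have "2 * (b * n) \<le> 2 * b\<^sup>2 * h + 2 * b\<^sup>2 * r"
        using b by (simp add: n(1) power2_eq_square algebra_simps)
      also have "(l - 1)\<^sup>2 * (K * h) + A * h + (2 * b\<^sup>2 * h + 2 * b\<^sup>2 * r) \<le>
          (l - 1)\<^sup>2 * (K * h) + K * h + K * r"
        by (simp add: K_def algebra_simps)
      also have "\<dots> \<le> b * (K * h) + K * r"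
      proof -
        have "(l - 1)\<^sup>2 + 1 \<le> b"
          using assms(1) by (cases l) (auto simp: b_def power2_eq_square)
        then have "((l - 1)\<^sup>2 + 1) * (K * h) \<le> b * (K * h)" by (rule mult_le_mono1)
        then show ?thesis by (simp add: algebra_simps)
      qed
      also have "\<dots> = K * n" by (simp add: n(1) algebra_simps)
      finally show ?thesis using E(3) by simp
    qed
  qed
  then show ?thesis by blast
qed


section \<open>The limit\<close>

text \<open>Fekete's lemma, with the supremum as limit. The bound for every single \<open>n\<close>
  matters as much as the convergence, since the counting applies it at all sizes 2 ^ i.\<close>

lemma superadditive_limit:
  fixes a :: "nat \<Rightarrow> nat"
  assumes super: "\<And>m n. a m + a n \<le> a (m + n)" and lin: "\<And>n. a n \<le> K * n"
  obtains L where "(\<lambda>n. real (a n) / real n) \<longlonglongrightarrow> L" "\<And>n. real (a n) \<le> L * real n"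
proof -
  define L where "L = (SUP n\<in>{1..}. real (a n) / real n)"
  have bound: "real (a n) / real n \<le> real K" for n
  proof (cases "n = 0")
    case False
    have "real (a n) \<le> real K * real n" using lin[of n] by (metis of_nat_le_iff of_nat_mult)
    then show ?thesis using False by (simp add: divide_le_eq)
  qed simp
  then have bdd: "bdd_above ((\<lambda>n. real (a n) / real n) ` {1..})"
    by (auto simp: bdd_above_def)
  have upper: "real (a n) / real n \<le> L" if "n \<ge> 1" for n
    unfolding L_def using bdd that by (intro cSUP_upper) auto
  have mult: "q * a m \<le> a (q * m)" for q m
  proof (induction q)
    case (Suc q)
    then show ?case using super[of m "q * m"] by simp
  qed simp
  have lower: "real (a m) / real m - real (a m) / real n \<le> real (a n) / real n"
    if "m \<ge> 1" "n \<ge> 1" for m n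
  proof -
    have "(n div m) * a m \<le> a (n div m * m)" by (rule mult)
    also have "\<dots> \<le> a n" using super[of "n div m * m" "n mod m"] by simp
    finally have "real (n div m) * real (a m) \<le> real (a n)"
      by (metis of_nat_le_iff of_nat_mult)
    moreover have "real n / real m - 1 \<le> real (n div m)"
    proof -
      have "n \<le> n div m * m + m"
        using that div_mult_mod_eq[of n m] mod_less_divisor[of m n] by linarith
      then have "real n \<le> (real (n div m) + 1) * real m"
        by (metis (no_types, opaque_lifting) add.commute mult_Suc of_nat_1 of_nat_Suc of_nat_le_iff of_nat_mult)
      then show ?thesis using that by (simp add: field_simps)
    qed
    then have "(real n / real m - 1) * real (a m) \<le> real (n div m) * real (a m)"
      by (rule mult_right_mono) simp
    ultimately have "(real n / real m - 1) * real (a m) \<le> real (a n)" by linarith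
    then have "(real n / real m - 1) * real (a m) / real n \<le> real (a n) / real n"
      by (rule divide_right_mono) simp
    then show ?thesis using that by (simp add: field_simps)
  qed
  have "(\<lambda>n. real (a n) / real n) \<longlonglongrightarrow> L"
  proof (rule order_tendstoI)
    fix y assume "y < L"
    then obtain m where m: "m \<ge> 1" "y < real (a m) / real m"
      unfolding L_def using less_cSUP_iff[OF _ bdd] by auto
    have "(\<lambda>n. real (a m) / real m - real (a m) / real n) \<longlonglongrightarrow> real (a m) / real m - 0"
      by (intro tendsto_diff tendsto_const lim_const_over_n)
    then have "eventually (\<lambda>n. y < real (a m) / real m - real (a m) / real n) sequentially"
      using m(2) order_tendstoD(1) by fastforce
    then show "eventually (\<lambda>n. y < real (a n) / real n) sequentially"
      using eventually_ge_at_top[of 1]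
    proof eventually_elim
      case (elim n)
      then show ?case using lower[OF m(1), of n] by linarith
    qed
  next
    fix y assume "L < y"
    show "eventually (\<lambda>n. real (a n) / real n < y) sequentially"
      using eventually_ge_at_top[of 1]
    proof eventually_elim
      case (elim n)
      then show ?case using upper[of n] \<open>L < y\<close> by linarith
    qed
  qed
  moreover have "real (a n) \<le> L * real n" for n
  proof (cases "n = 0")
    case True
    then show ?thesis using lin[of 0] by simp
  next
    case False
    then show ?thesis using upper[of n] by (simp add: divide_le_eq)
  qed
  ultimately show ?thesis using that by blast
qed

text \<open>
  If the first point of a pattern is below the last one, then the pattern does not occur in a skew
  sum of two sets avoiding it, and otherwise not in a direct sum.
\<close>

lemma extremal_superadditive:
  assumes "l \<ge> 2" "inj_on p {..<l}"
  shows "extremal l p id m + extremal l p id n \<le> extremal l p id (m + n)"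
proof -
  obtain E where E: "E \<subseteq> {..<m} \<times> {..<m}" "\<not> occurs l p id E" "card E = extremal l p id m"
    using extremal_attained assms(1) by (metis le_trans one_le_numeral)
  obtain F where F: "F \<subseteq> {..<n} \<times> {..<n}" "\<not> occurs l p id F" "card F = extremal l p id n"
    using extremal_attained assms(1) by (metis le_trans one_le_numeral)
  define a where "a = (if p 0 < p (l - 1) then n else 0)"
  define b where "b = (if p 0 < p (l - 1) then 0 else m)"
  define E' where "E' = (\<lambda>(r, c). (r + a, c)) ` E"
  define F' where "F' = (\<lambda>(r, c). (r + b, c + m)) ` F"
  have E': "r \<ge> a" "r < a + m" "c < m" "(r - a, c) \<in> E" if "(r, c) \<in> E'" for r c
    using that E(1) by (auto simp: E'_def)
  have F': "r \<ge> b" "r < b + n" "c \<ge> m" "c < m + n" "(r - b, c - m) \<in> F" if "(r, c) \<in> F'" for r c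
    using that F(1) by (auto simp: F'_def)
  have fin: "finite E" "finite F" using E(1) F(1) finite_subset by blast+
  have "\<not> occurs l p id (E' \<union> F')"
  proof
    assume "occurs l p id (E' \<union> F')"
    then obtain R C where "\<forall>j<l. (R j, C j) \<in> E' \<union> F'" "\<forall>i<l. \<forall>j<l. p i < p j \<longrightarrow> R i < R j"
      "\<forall>i<l. \<forall>j<l. id i < id j \<longrightarrow> C i < C j"
      unfolding occurs_def by blast
    then have RC: "\<And>j. j < l \<Longrightarrow> (R j, C j) \<in> E' \<union> F'"
      "\<And>i j. i < l \<Longrightarrow> j < l \<Longrightarrow> p i < p j \<Longrightarrow> R i < R j" "\<And>i j. i < j \<Longrightarrow> j < l \<Longrightarrow> C i < C j"
      by auto
    have ends: "0 < l" "l - 1 < l" "C 0 < C (l - 1)" using assms(1) RC(3) by auto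
    have "p 0 \<noteq> p (l - 1)"
      using assms inj_onD[OF assms(2), of 0 "l - 1"] by auto
    then consider "p 0 < p (l - 1)" | "p (l - 1) < p 0" by linarith
    \<comment> \<open>The columns rule out a first point in \<open>F'\<close> with a last point in
      \<open>E'\<close>, and the rows rule out the converse. The columns of all other points lie
      between those of these two, so the whole occurrence lies in one summand.\<close>
    then have side: "(R 0, C 0) \<in> E' \<longleftrightarrow> (R (l - 1), C (l - 1)) \<in> E'"
    proof cases
      case 1
      then have "R 0 < R (l - 1)" using RC(2) ends by blast
      then show ?thesis
        using RC(1)[OF ends(1)] RC(1)[OF ends(2)] ends(3) 1 E'[of "R 0" "C 0"] F'[of "R 0" "C 0"]
          E'[of "R (l - 1)" "C (l - 1)"] F'[of "R (l - 1)" "C (l - 1)"]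
        by (auto simp: a_def b_def)
    next
      case 2
      then have "R (l - 1) < R 0" using RC(2) ends by blast
      then show ?thesis
        using RC(1)[OF ends(1)] RC(1)[OF ends(2)] ends(3) 2 E'[of "R 0" "C 0"] F'[of "R 0" "C 0"]
          E'[of "R (l - 1)" "C (l - 1)"] F'[of "R (l - 1)" "C (l - 1)"]
        by (auto simp: a_def b_def)
    qed
    have first: "C 0 \<le> C j" if "j < l" for j
      using RC(3)[of 0 j] that by (cases "j = 0") (simp_all add: less_imp_le)
    have last: "C j \<le> C (l - 1)" if "j < l" for j
    proof (cases "j = l - 1")
      case False
      then have "j < l - 1" using that by linarith
      then show ?thesis using RC(3)[of j "l - 1"] ends(2) by (simp add: less_imp_le)
    qed simp
    show False
    proof (cases "(R 0, C 0) \<in> E'")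
      case True
      then have "C (l - 1) < m" using side E'(3) by blast
      then have in': "(R j, C j) \<in> E'" if "j < l" for j
        using RC(1)[OF that] last[OF that] F'(3)[of "R j" "C j"] by auto
      have "occurs l p id E"
        unfolding occurs_def
      proof (rule exI[of _ "\<lambda>j. R j - a"], rule exI[of _ C], intro conjI allI impI)
        fix i j assume "i < l" "j < l" "p i < p j"
        then show "R i - a < R j - a" using RC(2)[of i j] E'(1)[OF in'] by (simp add: diff_less_mono)
      qed (use E'(4)[OF in'] RC(3) in auto)
      then show False using E(2) by blast
    next
      case False
      then have "m \<le> C 0" using F'(3) RC(1)[OF ends(1)] by blast
      then have in': "(R j, C j) \<in> F'" if "j < l" for j
        using RC(1)[OF that] first[OF that] E'(3)[of "R j" "C j"] by auto
      have "occurs l p id F"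
        unfolding occurs_def
      proof (rule exI[of _ "\<lambda>j. R j - b"], rule exI[of _ "\<lambda>j. C j - m"], intro conjI allI impI)
        fix i j assume "i < l" "j < l" "p i < p j"
        then show "R i - b < R j - b" using RC(2)[of i j] F'(1)[OF in'] by (simp add: diff_less_mono)
      next
        fix i j assume "i < l" "j < l" "id i < id j"
        then show "C i - m < C j - m" using RC(3)[of i j] F'(3)[OF in'] by (simp add: diff_less_mono)
      qed (use F'(5)[OF in'] in auto)
      then show False using F(2) by blast
    qed
  qed
  moreover have "E' \<union> F' \<subseteq> {..<m + n} \<times> {..<m + n}"
    using E(1) F(1) by (auto simp: E'_def F'_def a_def b_def)
  ultimately have "card (E' \<union> F') \<le> extremal l p id (m + n)"
    by (rule card_le_extremal[rotated])
  moreover have "card (E' \<union> F') = card E' + card F'"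
    using fin E'(3) F'(3) by (intro card_Un_disjoint) (auto simp: E'_def F'_def, fastforce)
  moreover have "card E' = card E" "card F' = card F"
    by (auto simp: E'_def F'_def inj_on_def intro!: card_image)
  ultimately show ?thesis using E(3) F(3) by simp
qed

text \<open>\<open>c \<ge> 1\<close> holds because two points do not fit into a single cell; it
  keeps log c nonnegative.\<close>

lemma extremal_limit:
  assumes "l \<ge> 2" "inj_on p {..<l}" "\<And>j. j < l \<Longrightarrow> p j < l"
  obtains c where "(\<lambda>n. real (extremal l p id n) / real n) \<longlonglongrightarrow> c" "c \<ge> 1"
    "\<And>n. real (extremal l p id n) \<le> c * real n"
proof -
  obtain K where "\<And>n. extremal l p id n \<le> K * n"
    using extremal_linear[of l p id] assms(1,3) by auto
  then obtain c where c: "(\<lambda>n. real (extremal l p id n) / real n) \<longlonglongrightarrow> c"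
    "\<And>n. real (extremal l p id n) \<le> c * real n"
    using superadditive_limit[of "extremal l p id" K] extremal_superadditive[OF assms(1,2)] by blast
  have "\<not> occurs l p id {(0, 0)}"
  proof
    assume "occurs l p id {(0, 0)}"
    then obtain R C where "\<forall>j<l. (R j, C j) \<in> {(0::nat, 0::nat)}" "\<forall>i<l. \<forall>j<l. id i < id j \<longrightarrow> C i < C j"
      unfolding occurs_def by blast
    moreover have "0 < l" "1 < l" "id (0::nat) < id 1" using assms(1) by auto
    ultimately have "C 0 < C 1" "C 0 = 0" "C 1 = 0" by blast+
    then show False by simp
  qed
  then have "1 \<le> extremal l p id 1"
    using card_le_extremal[of "{(0, 0)}" 1 l p id] by auto
  then have "c \<ge> 1" using c(2)[of 1] by simp
  then show ?thesis using that c by blast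
qed

section \<open>Counting sequences that avoid a pattern\<close>

text \<open>The bound \<open>k\<close> on the entries is recorded beside the avoidance: contraction
  preserves both, and each of them can give the better bound on the size of a level.\<close>

definition avoiders :: "nat \<Rightarrow> (nat \<Rightarrow> nat) \<Rightarrow> (nat \<Rightarrow> nat) \<Rightarrow> nat \<Rightarrow> nat \<Rightarrow> (nat \<times> nat) set set" where
  "avoiders l p q k h = {E. E \<subseteq> {..<2 ^ h} \<times> {..<2 ^ h} \<and> \<not> occurs l p q E \<and> card E \<le> k}"

lemma finite_avoiders: "finite (avoiders l p q k h)"
  by (rule finite_subset[of _ "Pow ({..<2 ^ h} \<times> {..<2 ^ h})"]) (auto simp: avoiders_def)

text \<open>A preimage of \<open>F\<close> is a subset of the four cells that refine each entry of
  \<open>F\<close>.\<close>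

lemma card_contract_fibre:
  assumes "finite F"
  shows "card {E \<in> \<A>. contract 2 E = F} \<le> 2 ^ (4 * card F)"
proof -
  define X where "X = (\<lambda>((r, c), a, b). (2 * r + a, 2 * c + b)) ` (F \<times> {0::nat, 1} \<times> {0::nat, 1})"
  have fin: "finite (F \<times> {0::nat, 1} \<times> {0::nat, 1})" using assms by simp
  have X: "card X \<le> card (F \<times> {0::nat, 1} \<times> {0::nat, 1})" "finite X"
    unfolding X_def by (rule card_image_le[OF fin], rule finite_imageI[OF fin])
  have "{E \<in> \<A>. contract 2 E = F} \<subseteq> Pow X"
  proof
    fix E assume "E \<in> {E \<in> \<A>. contract 2 E = F}"
    then have E: "contract 2 E = F" by simp
    have "(r, c) \<in> X" if "(r, c) \<in> E" for r c
    proof -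
      have "(r div 2, c div 2) \<in> F"
        unfolding E[symmetric] contract_def using that by (intro image_eqI[of _ _ "(r, c)"]) auto
      then have "((r div 2, c div 2), r mod 2, c mod 2) \<in> F \<times> {0, 1} \<times> {0, 1}"
        by auto
      then have "(\<lambda>((r, c), a, b). (2 * r + a, 2 * c + b)) ((r div 2, c div 2), r mod 2, c mod 2) \<in> X"
        unfolding X_def by (rule imageI)
      then show ?thesis by simp
    qed
    then show "E \<in> Pow X" by auto
  qed
  then have "card {E \<in> \<A>. contract 2 E = F} \<le> card (Pow X)"
    using X(2) by (intro card_mono) auto
  also have "\<dots> = 2 ^ card X" using X(2) by (rule card_Pow)
  also have "\<dots> \<le> 2 ^ (4 * card F)"
    using X(1) by (intro power_increasing) (auto simp: card_cartesian_product mult.commute)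
  finally show ?thesis .
qed

lemma card_contract_le: "finite E \<Longrightarrow> card (contract b E) \<le> card E"
  unfolding contract_def by (rule card_image_le)

text \<open>The sum is over the numbers of nonempty nodes in the levels of the quadtree of a matrix.\<close>

lemma card_avoiders:
  "card (avoiders l p q k h) \<le> 2 ^ (1 + 4 * (\<Sum>i<h. min k (extremal l p q (2 ^ i))))"
proof (induction h)
  case 0
  \<comment> \<open>The single cell is either empty or filled, whence the 1 in the exponent.\<close>
  have "avoiders l p q k 0 \<subseteq> Pow {(0, 0)}" by (auto simp: avoiders_def)
  then have "card (avoiders l p q k 0) \<le> card (Pow {(0::nat, 0::nat)})" by (rule card_mono[rotated]) simp
  then show ?case by (simp add: card_Pow)
next
  case (Suc h)
  define e where "e = min k (extremal l p q (2 ^ h))"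
  have contract: "contract 2 E \<in> avoiders l p q k h" if "E \<in> avoiders l p q k (Suc h)" for E
  proof -
    have E: "E \<subseteq> {..<2 * 2 ^ h} \<times> {..<2 * 2 ^ h}" "\<not> occurs l p q E" "card E \<le> k"
      using that by (auto simp: avoiders_def)
    have "contract 2 E \<subseteq> {..<2 ^ h} \<times> {..<2 ^ h}"
      using E(1) by (auto simp: contract_def)
    moreover have "card (contract 2 E) \<le> k"
      using card_contract_le[of E 2] E(1,3) finite_subset[OF E(1)] by simp
    moreover have "\<not> occurs l p q (contract 2 E)"
      using E(2) occurs_contract by blast
    ultimately show ?thesis by (simp add: avoiders_def)
  qed
  have "avoiders l p q k (Suc h) =
      (\<Union>F\<in>avoiders l p q k h. {E \<in> avoiders l p q k (Suc h). contract 2 E = F})"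
    using contract by auto
  then have "card (avoiders l p q k (Suc h)) =
      card (\<Union>F\<in>avoiders l p q k h. {E \<in> avoiders l p q k (Suc h). contract 2 E = F})"
    by (rule arg_cong)
  also have "\<dots> \<le> (\<Sum>F\<in>avoiders l p q k h. card {E \<in> avoiders l p q k (Suc h). contract 2 E = F})"
    by (rule card_UN_le[OF finite_avoiders])
  also have "\<dots> \<le> (\<Sum>F\<in>avoiders l p q k h. 2 ^ (4 * e))"
  proof (rule sum_mono)
    fix F assume F: "F \<in> avoiders l p q k h"
    then have "finite F" by (auto simp: avoiders_def intro: finite_subset)
    moreover have "card F \<le> e"
      using F card_le_extremal by (auto simp: avoiders_def e_def)
    then have "(2::nat) ^ (4 * card F) \<le> 2 ^ (4 * e)"
      by (intro power_increasing) auto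
    ultimately show "card {E \<in> avoiders l p q k (Suc h). contract 2 E = F} \<le> 2 ^ (4 * e)"
      using card_contract_fibre le_trans by blast
  qed
  also have "\<dots> = card (avoiders l p q k h) * 2 ^ (4 * e)" by simp
  also have "\<dots> \<le> 2 ^ (1 + 4 * (\<Sum>i<h. min k (extremal l p q (2 ^ i)))) * 2 ^ (4 * e)"
    using Suc.IH by (rule mult_le_mono1)
  also have "\<dots> = 2 ^ (1 + 4 * (\<Sum>i<Suc h. min k (extremal l p q (2 ^ i))))"
    by (simp add: power_add[symmetric] e_def algebra_simps)
  finally show ?case .
qed

text \<open>For \<open>a = 0\<close> the sum is geometric. Raising \<open>a\<close> by one shifts
  the summands, which adds one new summand of at most \<open>k\<close>.\<close>

lemma sum_min_power_le: "(\<Sum>i<h. min k (2 ^ (a + i))) \<le> a * k + (2::nat) ^ h"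
proof (induction a)
  case 0
  have "(\<Sum>i<h. min k (2 ^ (0 + i))) \<le> (\<Sum>i<h. 2 ^ i)" by (intro sum_mono) simp
  also have "\<dots> \<le> (2::nat) ^ h" by (induction h) auto
  finally show ?case by simp
next
  case (Suc a)
  have "(\<Sum>i<h. min k (2 ^ (Suc a + i))) \<le> (\<Sum>i<Suc h. min k ((2::nat) ^ (a + i)))"
    by (subst sum.lessThan_Suc_shift) simp
  also have "\<dots> \<le> (\<Sum>i<h. min k (2 ^ (a + i))) + k" by simp
  finally show ?case using Suc by simp
qed

section \<open>Sequences as matrices\<close>

definition cells :: "nat list \<Rightarrow> (nat \<times> nat) set" where
  "cells xs = (\<lambda>j. (xs ! j, j)) ` {..<length xs}"

text \<open>\<open>occurs\<close> demands only implications. As \<open>\<pi>\<close> is distinct,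
  they decide every pair of different positions and so yield the equivalence in
  \<open>seq_contains\<close>.\<close>

lemma seq_contains_if_occurs_cells:
  assumes "occurs (length \<pi>) ((!) \<pi>) id (cells xs)" "distinct \<pi>"
  shows "seq_contains xs \<pi>"
proof -
  obtain R C where "\<forall>j<length \<pi>. (R j, C j) \<in> cells xs"
    "\<forall>i<length \<pi>. \<forall>j<length \<pi>. \<pi> ! i < \<pi> ! j \<longrightarrow> R i < R j"
    "\<forall>i<length \<pi>. \<forall>j<length \<pi>. id i < id j \<longrightarrow> C i < C j"
    using assms(1) unfolding occurs_def by blast
  then have RC: "\<And>j. j < length \<pi> \<Longrightarrow> C j < length xs \<and> R j = xs ! C j"
    "\<And>i j. i < length \<pi> \<Longrightarrow> j < length \<pi> \<Longrightarrow> \<pi> ! i < \<pi> ! j \<Longrightarrow> R i < R j"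
    "\<And>i j. i < length \<pi> \<Longrightarrow> j < length \<pi> \<Longrightarrow> i < j \<Longrightarrow> C i < C j"
    by (auto simp: cells_def)
  have "xs ! C j < xs ! C i \<longleftrightarrow> \<pi> ! j < \<pi> ! i" if ij: "i < length \<pi>" "j < length \<pi>" for i j
  proof -
    consider "\<pi> ! j < \<pi> ! i" | "j = i" | "\<pi> ! i < \<pi> ! j"
      using assms(2) ij nth_eq_iff_index_eq by (metis linorder_neqE_nat)
    then show ?thesis
    proof cases
      case 1
      then show ?thesis using RC(1)[OF ij(1)] RC(1)[OF ij(2)] RC(2)[OF ij(2,1)] by simp
    next
      case 3
      then show ?thesis using RC(1)[OF ij(1)] RC(1)[OF ij(2)] RC(2)[OF ij] by simp
    qed simp
  qed
  moreover have "strict_mono_on {..<length \<pi>} C"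
    using RC(3) by (auto intro!: strict_mono_onI)
  ultimately show ?thesis
    unfolding seq_contains_def using RC(1) by (intro exI[of _ C]) auto
qed

text \<open>A sequence is determined by its matrix, which fits into side 2 ^ h. With 2 ^ a as a
  bound on c, the level of side 2 ^ i has at most min k (2 ^ (a + i)) entries.\<close>

lemma card_avoiding_sequences:
  assumes "distinct \<pi>" "k \<le> 2 ^ h" "\<And>n. extremal (length \<pi>) ((!) \<pi>) id n \<le> 2 ^ a * n"
  shows "card {xs. length xs = k \<and> set xs \<subseteq> {..<k} \<and> seq_avoids xs \<pi>} \<le> 2 ^ (1 + 4 * (a * k + 2 ^ h))"
proof -
  let ?\<Gamma> = "{xs. length xs = k \<and> set xs \<subseteq> {..<k} \<and> seq_avoids xs \<pi>}"
  have inj: "inj_on cells ?\<Gamma>"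
  proof (rule inj_onI)
    fix xs ys assume xy: "xs \<in> ?\<Gamma>" "ys \<in> ?\<Gamma>" and eq: "cells xs = cells ys"
    show "xs = ys"
    proof (rule nth_equalityI)
      fix j assume "j < length xs"
      then have "(xs ! j, j) \<in> cells ys" using eq by (auto simp: cells_def)
      then show "xs ! j = ys ! j" by (auto simp: cells_def)
    qed (use xy in simp)
  qed
  have "cells ` ?\<Gamma> \<subseteq> avoiders (length \<pi>) ((!) \<pi>) id k h"
  proof
    fix E assume "E \<in> cells ` ?\<Gamma>"
    then obtain xs where xs: "E = cells xs" "length xs = k" "set xs \<subseteq> {..<k}" "seq_avoids xs \<pi>" by auto
    have "xs ! j < 2 ^ h" if "j < k" for j
    proof -
      have "xs ! j \<in> {..<k}" using subsetD[OF xs(3) nth_mem[of j xs]] that xs(2) by simp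
      then show ?thesis using assms(2) by simp
    qed
    then have "E \<subseteq> {..<2 ^ h} \<times> {..<2 ^ h}"
      using xs(1,2) assms(2) by (auto simp: cells_def)
    moreover have "card E \<le> k"
      using card_image_le[of "{..<length xs}" "\<lambda>j. (xs ! j, j)"] xs(1,2) by (simp add: cells_def)
    moreover have "\<not> occurs (length \<pi>) ((!) \<pi>) id E"
      using seq_contains_if_occurs_cells assms(1) xs by blast
    ultimately show "E \<in> avoiders (length \<pi>) ((!) \<pi>) id k h" by (simp add: avoiders_def)
  qed
  then have "card ?\<Gamma> \<le> card (avoiders (length \<pi>) ((!) \<pi>) id k h)"
    by (rule card_inj_on_le[OF inj _ finite_avoiders])
  also have "\<dots> \<le> 2 ^ (1 + 4 * (\<Sum>i<h. min k (extremal (length \<pi>) ((!) \<pi>) id (2 ^ i))))"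
    by (rule card_avoiders)
  also have "\<dots> \<le> 2 ^ (1 + 4 * (\<Sum>i<h. min k (2 ^ (a + i))))"
    using assms(3) by (intro power_increasing add_mono mult_le_mono sum_mono min.mono)
      (auto simp: power_add)
  also have "\<dots> \<le> 2 ^ (1 + 4 * (a * k + 2 ^ h))"
    using sum_min_power_le[of k a h] by (intro power_increasing) auto
  finally show ?thesis .
qed

text \<open>The trivial count k ^ k does not involve the pattern and serves the additive
  term.\<close>

lemma card_bounded_lists:
  assumes "k \<le> 2 ^ h"
  shows "finite {xs::nat list. length xs = k \<and> set xs \<subseteq> {..<k}}"
    and "card {xs. length xs = k \<and> set xs \<subseteq> {..<k}} \<le> 2 ^ (k * h)"
proof -
  have eq: "{xs. length xs = k \<and> set xs \<subseteq> {..<k}} = {xs. set xs \<subseteq> {..<k} \<and> length xs = k}" by auto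
  show "finite {xs::nat list. length xs = k \<and> set xs \<subseteq> {..<k}}"
    unfolding eq by (rule finite_lists_length_eq) simp
  have "card {xs. length xs = k \<and> set xs \<subseteq> {..<k}} = k ^ k"
    unfolding eq by (subst card_lists_length_eq) auto
  also have "\<dots> \<le> (2 ^ h) ^ k" using assms by (rule power_mono) simp
  finally show "card {xs. length xs = k \<and> set xs \<subseteq> {..<k}} \<le> 2 ^ (k * h)"
    by (simp add: power_mult[symmetric] mult.commute)
qed

lemma ex_power_of_two_between:
  fixes k :: nat
  assumes "k \<ge> 1"
  obtains h :: nat where "k \<le> 2 ^ h" "2 ^ h \<le> 2 * k"
proof -
  have "\<exists>h::nat. k \<le> 2 ^ h \<and> 2 ^ h \<le> 2 * k"
    using assms
  proof (induction k rule: dec_induct)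
    case base
    then show ?case by (intro exI[of _ 0]) simp
  next
    case (step k)
    then obtain h :: nat where h: "k \<le> 2 ^ h" "2 ^ h \<le> 2 * k" by auto
    show ?case
    proof (cases "k = 2 ^ h")
      case True
      then show ?thesis using step.hyps by (intro exI[of _ "Suc h"]) simp
    next
      case False
      then show ?thesis using h by (intro exI[of _ h]) simp
    qed
  qed
  then show ?thesis using that by blast
qed

section \<open>Running time\<close>

text \<open>\<open>X\<close> is the number of digits at depth \<open>D\<close>. At most
  \<open>X\<close> depths are tried, each with at most k ^ X <= 2 ^ \<open>X\<^sup>2\<close> tables.
  The factor 16 is a power of two like \<open>X\<close>, so the final bound is again of the form 2 ^
  2 ^ m.\<close>

lemma position_bound:
  fixes k D :: nat
  assumes "k \<ge> 1" "\<And>u. g u < k"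
  defines "X \<equiv> 2 ^ (D + k + 1)"
  shows "3 * k + 6 + position k D g * (14 * k\<^sup>2 + 3 * X + 5) \<le> 2 ^ (16 * X\<^sup>2)"
proof -
  have X: "D + k + 1 < X" unfolding X_def by (rule less_exp)
  have kX: "k \<le> X" "D + 1 \<le> X" "1 \<le> X" using X by auto
  have "k ^ 2 ^ (d + k + 1) \<le> 2 ^ X\<^sup>2" if "d < Suc D" for d
  proof -
    have "k ^ 2 ^ (d + k + 1) \<le> k ^ X"
      using assms(1) that unfolding X_def by (intro power_increasing) auto
    also have "\<dots> \<le> (2 ^ k) ^ X" by (rule power_mono) (simp_all add: less_imp_le)
    also have "\<dots> = 2 ^ (k * X)" by (simp add: power_mult)
    also have "\<dots> \<le> 2 ^ X\<^sup>2"
      using kX(1) by (intro power_increasing) (auto simp: power2_eq_square)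
    finally show ?thesis .
  qed
  then have "(\<Sum>d<Suc D. k ^ 2 ^ (d + k + 1)) \<le> (\<Sum>d<Suc D. 2 ^ X\<^sup>2)"
    by (intro sum_mono) auto
  then have "position k D g \<le> (D + 1) * 2 ^ X\<^sup>2"
    using position_less[of g k D, OF assms(2)] by simp
  also have "\<dots> \<le> X * 2 ^ X\<^sup>2" using kX(2) by (rule mult_le_mono1)
  finally have pos: "position k D g \<le> X * 2 ^ X\<^sup>2" .
  have X2: "X \<le> X\<^sup>2" "1 \<le> X\<^sup>2" using kX(3) by (auto simp: power2_eq_square)
  have "k\<^sup>2 \<le> X\<^sup>2" using kX(1) by (rule power_mono) simp
  then have "14 * k\<^sup>2 + 3 * X + 5 \<le> 22 * X\<^sup>2" using X2 by linarith
  then have "position k D g * (14 * k\<^sup>2 + 3 * X + 5) \<le> (X * 2 ^ X\<^sup>2) * (22 * X\<^sup>2)"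
    using pos by (intro mult_le_mono)
  moreover have "3 * k + 6 \<le> 9 * (X * (2 ^ X\<^sup>2 * X\<^sup>2))"
  proof -
    have "1 \<le> 2 ^ X\<^sup>2 * X\<^sup>2" using X2(2) by (simp add: Suc_le_eq)
    then have "X \<le> X * (2 ^ X\<^sup>2 * X\<^sup>2)" by simp
    then show ?thesis using kX by linarith
  qed
  \<comment> \<open>31 = 22 + 9 collects the two preceding estimates; it is then rounded up to 2 ^
    5.\<close>
  ultimately have "3 * k + 6 + position k D g * (14 * k\<^sup>2 + 3 * X + 5) \<le> 31 * (X * 2 ^ X\<^sup>2 * X\<^sup>2)"
    by (simp add: algebra_simps)
  also have "\<dots> \<le> 2 ^ 5 * (2 ^ X * 2 ^ X\<^sup>2 * 2 ^ X\<^sup>2)"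
    by (intro mult_le_mono less_imp_le[OF less_exp]) auto
  also have "\<dots> = 2 ^ (5 + X + X\<^sup>2 + X\<^sup>2)" by (simp only: power_add mult.assoc)
  also have "\<dots> \<le> 2 ^ (16 * X\<^sup>2)"
    using X2 by (intro power_increasing) auto
  finally show ?thesis .
qed

lemma double_power_eq_powr: "real (2 ^ 2 ^ n) = 2 powr (2 powr real n)"
proof -
  have "2 powr real n = real (2 ^ n)" by (simp add: powr_realpow)
  moreover have "2 powr real (2 ^ n) = (2::real) ^ 2 ^ n" by (rule powr_realpow) simp
  ultimately show ?thesis by (metis of_nat_numeral of_nat_power)
qed

lemma additive_term_bound:
  assumes "k \<ge> 1" "\<And>u. g u < k" "t \<le> k * h" "2 ^ h \<le> 2 * k"
  defines "D \<equiv> 2 * (t + k)"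
  shows "real (3 * k + 6 + position k D g * (14 * k\<^sup>2 + 3 * 2 ^ (D + k + 1) + 5)) \<le>
    2 powr (2 powr (4 * (real k * log 2 (real k)) + 16 * real k))"
proof -
  have k: "real k \<ge> 1" using assms(1) by simp
  have "real h = log 2 (2 ^ h)" by simp
  also have "\<dots> \<le> log 2 (2 * real k)"
  proof -
    have "real (2 ^ h) \<le> real (2 * k)" using assms(4) by (rule of_nat_mono)
    then show ?thesis using k by (intro log_mono) auto
  qed
  also have "\<dots> = 1 + log 2 (real k)" using k by (simp add: log_mult)
  finally have h: "real h \<le> 1 + log 2 (real k)" .
  have "real t \<le> real k * real h" using assms(3) by (metis of_nat_le_iff of_nat_mult)
  also have "\<dots> \<le> real k * (1 + log 2 (real k))" using h by (intro mult_left_mono) auto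
  finally have t: "real t \<le> real k + real k * log 2 (real k)" by (simp add: algebra_simps)
  define X where "X = (2::nat) ^ (D + k + 1)"
  have "real (3 * k + 6 + position k D g * (14 * k\<^sup>2 + 3 * X + 5)) \<le> real (2 ^ (16 * X\<^sup>2))"
    using position_bound[of k g D, OF assms(1,2)] unfolding X_def by (rule of_nat_mono)
  also have "16 * X\<^sup>2 = 2 ^ (2 * (D + k + 1) + 4)"
    by (simp only: X_def power_add[of _ "2 * (D + k + 1)"] power_even_eq[of _ "D + k + 1"]) simp
  also have "real (2 ^ 2 ^ (2 * (D + k + 1) + 4)) = 2 powr (2 powr real (2 * (D + k + 1) + 4))"
    by (rule double_power_eq_powr)
  \<comment> \<open>For \<open>D = 2 * (t + k)\<close> the exponent is 4 t + 6 k + 6. With t <= k +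
    k log k and k >= 1 it is at most 4 k log k + 16 k.\<close>
  also have "\<dots> \<le> 2 powr (2 powr (4 * (real k * log 2 (real k)) + 16 * real k))"
    using t k by (intro powr_mono) (auto simp: D_def)
  finally show ?thesis by (simp only: X_def)
qed

lemma additive_exponent_bigo:
  "(\<lambda>k. 4 * (real k * log 2 (real k)) + 16 * real k) \<in> O(\<lambda>k. real k * log 2 (real k))"
proof (rule bigoI)
  show "eventually (\<lambda>k. norm (4 * (real k * log 2 (real k)) + 16 * real k) \<le>
    20 * norm (real k * log 2 (real k))) sequentially"
    using eventually_ge_at_top[of 2]
  proof eventually_elim
    case (elim k)
    then have "log 2 2 \<le> log 2 (real k)" by (intro log_mono) auto
    then have "real k * 1 \<le> real k * log 2 (real k)" by (intro mult_left_mono) auto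
    then show ?case by simp
  qed
qed

section \<open>The Fueredi--Hajnal limit\<close>

definition ones :: "bool mat \<Rightarrow> (nat \<times> nat) set" where
  "ones M = {(r, c). r < dim_row M \<and> c < dim_col M \<and> M $$ (r, c)}"

text \<open>\<open>I\<close> may reach beyond the matrix, so monotonicity is taken from its part
  below \<open>n\<close>.\<close>

lemma pick_mono_bounded:
  assumes "i < j" "j < card {a. a < n \<and> a \<in> I}"
  shows "pick I i < pick I j"
  using pick_mono_le[OF assms(2,1)] pick_reduce_set[of i n I] pick_reduce_set[of j n I] assms by simp

lemma occurs_ones_if_mat_contains:
  assumes "is_permutation \<pi>" "mat_contains M (perm_mat \<pi>)"
  shows "occurs (length \<pi>) ((!) \<pi>) id (ones M)"
proof -
  obtain I J where dims: "card {i. i < dim_row M \<and> i \<in> I} = length \<pi>"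
      "card {j. j < dim_col M \<and> j \<in> J} = length \<pi>"
    and sub: "\<And>r c. r < length \<pi> \<Longrightarrow> c < length \<pi> \<Longrightarrow> \<pi> ! c = Suc r \<Longrightarrow> submatrix M I J $$ (r, c)"
    using assms(2) unfolding mat_contains_def perm_mat_def dim_submatrix by auto
  have range: "\<pi> ! j \<ge> 1" "\<pi> ! j \<le> length \<pi>" if "j < length \<pi>" for j
    using nth_mem[OF that] assms(1) by (auto simp: is_permutation_def)
  show ?thesis
    unfolding occurs_def
  proof (rule exI[of _ "\<lambda>j. pick I (\<pi> ! j - 1)"], rule exI[of _ "\<lambda>j. pick J j"], intro conjI allI impI)
    fix j assume j: "j < length \<pi>"
    then have r: "\<pi> ! j - 1 < length \<pi>" "\<pi> ! j = Suc (\<pi> ! j - 1)" using range[of j] by auto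
    have "M $$ (pick I (\<pi> ! j - 1), pick J j)"
      using sub[OF r(1) j r(2)] submatrix_index[of "\<pi> ! j - 1" M I j J] r(1) j dims by simp
    then show "(pick I (\<pi> ! j - 1), pick J j) \<in> ones M"
      using pick_le[of "\<pi> ! j - 1" "dim_row M" I] pick_le[of j "dim_col M" J] r(1) j dims
      by (simp add: ones_def)
  next
    fix i j assume "i < length \<pi>" "j < length \<pi>" "\<pi> ! i < \<pi> ! j"
    then show "pick I (\<pi> ! i - 1) < pick I (\<pi> ! j - 1)"
      using range[of i] range[of j] dims by (intro pick_mono_bounded[of _ _ "dim_row M"]) auto
  next
    fix i j assume "i < length \<pi>" "j < length \<pi>" "id i < id j"
    then show "pick J i < pick J j"
      using dims by (intro pick_mono_bounded[of _ _ "dim_col M"]) auto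
  qed
qed

text \<open>Keep exactly the rows and columns of the occurrence. Since the values of
  \<open>\<pi>\<close> are 1, ..., l, exactly \<open>r\<close> points lie below the point of value
  \<open>Suc r\<close>, so its row is the kept row number \<open>r\<close>; columns are counted
  likewise.\<close>

lemma mat_contains_if_occurs_ones:
  assumes "is_permutation \<pi>" "occurs (length \<pi>) ((!) \<pi>) id (ones M)"
  shows "mat_contains M (perm_mat \<pi>)"
proof -
  define l where "l = length \<pi>"
  obtain R C where "\<forall>j<l. (R j, C j) \<in> ones M" "\<forall>i<l. \<forall>j<l. \<pi> ! i < \<pi> ! j \<longrightarrow> R i < R j"
    "\<forall>i<l. \<forall>j<l. id i < id j \<longrightarrow> C i < C j"
    using assms(2) unfolding occurs_def l_def[symmetric] by blast
  then have RC: "\<And>j. j < l \<Longrightarrow> R j < dim_row M \<and> C j < dim_col M \<and> M $$ (R j, C j)"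
    and R: "\<And>i j. i < l \<Longrightarrow> j < l \<Longrightarrow> \<pi> ! i < \<pi> ! j \<Longrightarrow> R i < R j"
    and C: "\<And>i j. i < l \<Longrightarrow> j < l \<Longrightarrow> i < j \<Longrightarrow> C i < C j"
    by (auto simp: ones_def)
  have d: "distinct \<pi>" "set \<pi> = {1..l}" using assms(1) by (auto simp: is_permutation_def l_def)
  then have neq: "\<pi> ! i < \<pi> ! j \<or> \<pi> ! j < \<pi> ! i" if "i < l" "j < l" "i \<noteq> j" for i j
    using that nth_eq_iff_index_eq[of \<pi> i j] by (auto simp: l_def)
  have R_iff: "R i < R j \<longleftrightarrow> \<pi> ! i < \<pi> ! j" if "i < l" "j < l" for i j
    using R[OF that] R[OF that(2,1)] neq[OF that] by fastforce
  have C_iff: "C i < C j \<longleftrightarrow> i < j" if "i < l" "j < l" for i j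
    using C[OF that] C[OF that(2,1)] by (cases i j rule: linorder_cases) auto
  have injR: "inj_on R {..<l}"
  proof (rule inj_onI)
    fix i j assume "i \<in> {..<l}" "j \<in> {..<l}" "R i = R j"
    then show "i = j" using R[of i j] R[of j i] neq[of i j] by (cases "i = j") auto
  qed
  have injC: "inj_on C {..<l}"
  proof (rule inj_onI)
    fix i j assume "i \<in> {..<l}" "j \<in> {..<l}" "C i = C j"
    then show "i = j" using C[of i j] C[of j i] by (cases i j rule: linorder_cases) auto
  qed
  define I where "I = R ` {..<l}"
  define J where "J = C ` {..<l}"
  have "{i. i < dim_row M \<and> i \<in> I} = I" "{j. j < dim_col M \<and> j \<in> J} = J"
    using RC by (auto simp: I_def J_def)
  then have dims: "card {i. i < dim_row M \<and> i \<in> I} = l" "card {j. j < dim_col M \<and> j \<in> J} = l"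
    using injR injC by (auto simp: I_def J_def card_image)
  have "submatrix M I J $$ (r, c)" if rc: "r < l" "c < l" "\<pi> ! c = Suc r" for r c
  proof -
    have "{a \<in> I. a < R c} = R ` {j \<in> {..<l}. \<pi> ! j < \<pi> ! c}"
      using R_iff rc(2) by (auto simp: I_def)
    moreover have "card (R ` {j \<in> {..<l}. \<pi> ! j < \<pi> ! c}) = card {j \<in> {..<l}. \<pi> ! j < \<pi> ! c}"
      using injR by (intro card_image inj_on_subset[OF injR]) auto
    moreover have "card {j \<in> {..<l}. \<pi> ! j < \<pi> ! c} = card {1..r}"
    proof -
      have "(!) \<pi> ` {j \<in> {..<l}. \<pi> ! j < \<pi> ! c} = {1..r}"
      proof (intro equalityI subsetI)
        fix v assume "v \<in> (!) \<pi> ` {j \<in> {..<l}. \<pi> ! j < \<pi> ! c}"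
        then obtain j where "j < l" "v = \<pi> ! j" "\<pi> ! j < Suc r" using rc(3) by auto
        moreover from this have "v \<in> {1..l}" using d(2) nth_mem[of j \<pi>] by (simp add: l_def)
        ultimately show "v \<in> {1..r}" by simp
      next
        fix v assume "v \<in> {1..r}"
        then have v: "v \<in> set \<pi>" "v < Suc r" using d(2) rc(1) by auto
        then obtain j where "j < l" "v = \<pi> ! j" by (auto simp: in_set_conv_nth l_def)
        then show "v \<in> (!) \<pi> ` {j \<in> {..<l}. \<pi> ! j < \<pi> ! c}" using v(2) rc(3) by auto
      qed
      moreover have "inj_on ((!) \<pi>) {j \<in> {..<l}. \<pi> ! j < \<pi> ! c}"
        using d(1) by (intro inj_on_nth) (auto simp: l_def)
      ultimately show ?thesis by (metis card_image)
    qed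
    ultimately have pr: "pick I r = R c"
      using pick_card_in_set[of "R c" I] rc(2) by (simp add: I_def)
    have "{a \<in> J. a < C c} = C ` {..<c}"
      using C_iff rc(2) by (auto simp: J_def)
    moreover have "card (C ` {..<c}) = c"
      using rc(2) by (subst card_image) (auto intro: inj_on_subset[OF injC])
    ultimately have pc: "pick J c = C c"
      using pick_card_in_set[of "C c" J] rc(2) by (simp add: J_def)
    show ?thesis
      using submatrix_index[of r M I c J] dims rc pr pc RC by simp
  qed
  then show ?thesis
    unfolding mat_contains_def
    by (intro exI[of _ I] exI[of _ J]) (use dims in \<open>auto simp: perm_mat_def dim_submatrix l_def\<close>)
qed

lemma ex_perm_eq_extremal:
  assumes "is_permutation \<pi>"
  shows "ex_perm \<pi> n = extremal (length \<pi>) ((!) \<pi>) id n"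
proof -
  let ?occ = "occurs (length \<pi>) ((!) \<pi>) id"
  have av: "mat_avoids M \<pi> \<longleftrightarrow> \<not> ?occ (ones M)" for M
    using occurs_ones_if_mat_contains mat_contains_if_occurs_ones assms by blast
  have num: "num_ones M = card (ones M)" for M by (simp add: num_ones_def ones_def)
  have "num_ones ` {M \<in> carrier_mat n n. mat_avoids M \<pi>} = card ` {E. E \<subseteq> {..<n} \<times> {..<n} \<and> \<not> ?occ E}"
  proof (intro equalityI subsetI)
    fix x assume "x \<in> num_ones ` {M \<in> carrier_mat n n. mat_avoids M \<pi>}"
    then obtain M where M: "M \<in> carrier_mat n n" "\<not> ?occ (ones M)" "x = card (ones M)"
      by (auto simp: av num)
    then have "ones M \<subseteq> {..<n} \<times> {..<n}" by (auto simp: ones_def)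
    then show "x \<in> card ` {E. E \<subseteq> {..<n} \<times> {..<n} \<and> \<not> ?occ E}" using M by blast
  next
    fix x assume "x \<in> card ` {E. E \<subseteq> {..<n} \<times> {..<n} \<and> \<not> ?occ E}"
    then obtain E where E: "E \<subseteq> {..<n} \<times> {..<n}" "\<not> ?occ E" "x = card E" by blast
    let ?M = "mat n n (\<lambda>x. x \<in> E)"
    have "ones ?M = E" using E(1) by (auto simp: ones_def)
    then show "x \<in> num_ones ` {M \<in> carrier_mat n n. mat_avoids M \<pi>}"
      using E by (intro image_eqI[of _ _ ?M]) (auto simp: num av)
  qed
  then show ?thesis by (simp only: ex_perm_def extremal_def)
qed

lemma occurs_order_cong:
  assumes "\<And>i j. i < l \<Longrightarrow> j < l \<Longrightarrow> p i < p j \<longleftrightarrow> p' i < p' j"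
  shows "occurs l p q E \<longleftrightarrow> occurs l p' q E"
  unfolding occurs_def using assms by (intro ex_cong1 conj_cong refl) blast

lemma furedi_hajnal_limit_bounds:
  assumes "is_permutation \<pi>" "length \<pi> \<ge> 2"
  shows "furedi_hajnal_limit \<pi> \<ge> 1"
    "real (extremal (length \<pi>) ((!) \<pi>) id n) \<le> furedi_hajnal_limit \<pi> * real n"
proof -
  \<comment> \<open>The Marcus--Tardos bound expects values from 0 on; \<open>occurs\<close> depends
    only on their order, so the shift changes nothing.\<close>
  define p where "p j = \<pi> ! j - 1" for j
  have range: "\<pi> ! j \<ge> 1" "\<pi> ! j \<le> length \<pi>" if "j < length \<pi>" for j
    using nth_mem[OF that] assms(1) by (auto simp: is_permutation_def)
  have "p i < p j \<longleftrightarrow> \<pi> ! i < \<pi> ! j" if "i < length \<pi>" "j < length \<pi>" for i j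
    using range(1)[OF that(1)] range(1)[OF that(2)] by (auto simp: p_def)
  then have eq: "extremal (length \<pi>) p id n = extremal (length \<pi>) ((!) \<pi>) id n" for n
    unfolding extremal_def using occurs_order_cong[of "length \<pi>" p "(!) \<pi>"] by simp
  have "inj_on p {..<length \<pi>}"
  proof (rule inj_onI)
    fix i j assume ij: "i \<in> {..<length \<pi>}" "j \<in> {..<length \<pi>}" "p i = p j"
    then have "\<pi> ! i = \<pi> ! j" using range(1)[of i] range(1)[of j] by (auto simp: p_def)
    then show "i = j" using ij assms(1) by (simp add: is_permutation_def nth_eq_iff_index_eq)
  qed
  moreover have "p j < length \<pi>" if "j < length \<pi>" for j
    using range[OF that] by (auto simp: p_def)
  ultimately obtain c where c: "(\<lambda>n. real (extremal (length \<pi>) p id n) / real n) \<longlonglongrightarrow> c" "c \<ge> 1"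
    "\<And>n. real (extremal (length \<pi>) p id n) \<le> c * real n"
    using extremal_limit[of "length \<pi>" p] assms(2) by blast
  have "furedi_hajnal_limit \<pi> = c"
    unfolding furedi_hajnal_limit_def ex_perm_eq_extremal[OF assms(1)] eq[symmetric]
    using c(1) by (rule limI)
  then show "furedi_hajnal_limit \<pi> \<ge> 1"
    "real (extremal (length \<pi>) ((!) \<pi>) id n) \<le> furedi_hajnal_limit \<pi> * real n"
    using c(2,3) eq by auto
qed

section \<open>Combination of the bounds\<close>

lemma sorts_all_in_time_if_table:
  fixes S :: "'a::linorder list list"
  assumes "k \<ge> 1" "\<And>s. s \<in> set S \<Longrightarrow> length s = k" "\<And>u. g u < k"
    "\<And>s. s \<in> set S \<Longrightarrow> sorted (run_tree g (2 * (t + k)) s)" "t \<le> k * h" "2 ^ h \<le> 2 * k"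
    "real (length S * (8 * (t + k) + 13 * k + 17)) \<le> B"
  shows "sorts_all_in_time sort_all_com k S
    (B + 2 powr (2 powr (4 * (real k * log 2 (real k)) + 16 * real k)))"
  unfolding sorts_all_in_time_def
proof (intro allI impI)
  fix e assume e: "\<forall>i<length S. \<forall>j<k. e (i * k + j) = S ! i ! j"
  let ?D = "2 * (t + k)"
  have "halts sort_all_com ((\<lambda>_. 0)(0 := length S, 1 := k), e) (3 * length S + 3 * k + 5 +
      (length S * (4 * ?D + 13 * k + 14) +
       position k ?D g * (14 * k\<^sup>2 + 3 * 2 ^ (?D + k + 1) + 5) + 1))
    (\<lambda>(m', e'). \<forall>i<length S. block e' (i * k) k = sort (S ! i))"
    using assms(1-4) e by (intro halts_sort_all_com) auto
  then obtain T m' e' where T: "exec sort_all_com ((\<lambda>_. 0)(0 := length S, 1 := k), e) T (m', e')"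
    "T \<le> 3 * length S + 3 * k + 5 + (length S * (4 * ?D + 13 * k + 14) +
       position k ?D g * (14 * k\<^sup>2 + 3 * 2 ^ (?D + k + 1) + 5) + 1)"
    "\<forall>i<length S. block e' (i * k) k = sort (S ! i)"
    unfolding halts_def by auto
  have "3 * length S + 3 * k + 5 + (length S * (4 * ?D + 13 * k + 14) +
       position k ?D g * (14 * k\<^sup>2 + 3 * 2 ^ (?D + k + 1) + 5) + 1) =
    length S * (8 * (t + k) + 13 * k + 17) +
      (3 * k + 6 + position k ?D g * (14 * k\<^sup>2 + 3 * 2 ^ (?D + k + 1) + 5))"
    by (simp add: algebra_simps)
  then have "real T \<le> real (length S * (8 * (t + k) + 13 * k + 17)) +
      real (3 * k + 6 + position k ?D g * (14 * k\<^sup>2 + 3 * 2 ^ (?D + k + 1) + 5))"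
    using T(2) by (metis of_nat_add of_nat_le_iff)
  then have "real T \<le> B + 2 powr (2 powr (4 * (real k * log 2 (real k)) + 16 * real k))"
    using additive_term_bound[of k g t h, OF assms(1,3,5,6)] assms(7) by linarith
  moreover have "\<forall>i<length S. map (\<lambda>j. e' (i * k + j)) [0..<k] = sort (S ! i)"
    using T(3) by (simp add: block_def)
  ultimately show "\<exists>T m' e'. exec sort_all_com ((\<lambda>_. 0)(0 := length S, 1 := k), e) T (m', e') \<and>
      real T \<le> B + 2 powr (2 powr (4 * (real k * log 2 (real k)) + 16 * real k)) \<and>
      (\<forall>i<length S. map (\<lambda>j. e' (i * k + j)) [0..<k] = sort (S ! i))"
    using T(1) by blast
qed

lemma exists_table_for_avoiders:
  assumes "is_permutation \<pi>" "length \<pi> \<ge> 2" "k \<ge> 1" "k \<le> 2 ^ h" "2 ^ h \<le> 2 * k"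
  obtains t g where "t \<le> k * h" "real t \<le> real k * (4 * log 2 (furedi_hajnal_limit \<pi>) + 13)"
    "\<And>u. g u < k"
    "\<And>s :: 'a::linorder list. length s = k \<Longrightarrow> seq_avoids s \<pi> \<Longrightarrow> sorted (run_tree g (2 * (t + k)) s)"
proof -
  define c where "c = furedi_hajnal_limit \<pi>"
  \<comment> \<open>Rounding log c up makes 2 ^ a an integer bound on \<open>c\<close> and costs at
    most 1 in the exponent.\<close>
  define a where "a = nat \<lceil>log 2 c\<rceil>"
  have c: "c \<ge> 1" using furedi_hajnal_limit_bounds(1)[OF assms(1,2)] by (simp add: c_def)
  then have log: "log 2 c \<ge> 0" by simp
  then have a: "log 2 c \<le> real a" "real a \<le> log 2 c + 1" by (simp_all add: a_def)
  have "c = 2 powr log 2 c" using c by simp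
  also have "\<dots> \<le> 2 powr real a" using a(1) by (rule powr_mono) simp
  also have "\<dots> = 2 ^ a" by (simp add: powr_realpow)
  finally have ca: "c \<le> 2 ^ a" .
  have ext: "extremal (length \<pi>) ((!) \<pi>) id n \<le> 2 ^ a * n" for n
  proof -
    have "real (extremal (length \<pi>) ((!) \<pi>) id n) \<le> c * real n"
      using furedi_hajnal_limit_bounds(2)[OF assms(1,2)] by (simp add: c_def)
    also have "\<dots> \<le> 2 ^ a * real n" using ca by (rule mult_right_mono) simp
    also have "\<dots> = real (2 ^ a * n)" by simp
    finally show ?thesis by (simp only: of_nat_le_iff)
  qed
  define \<Gamma> where "\<Gamma> = {xs. length xs = k \<and> set xs \<subseteq> {..<k} \<and> seq_avoids xs \<pi>}"
  have sub: "\<Gamma> \<subseteq> {xs. length xs = k \<and> set xs \<subseteq> {..<k}}" by (auto simp: \<Gamma>_def)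
  have fin: "finite \<Gamma>" using sub card_bounded_lists(1)[OF assms(4)] by (rule finite_subset)
  \<comment> \<open>The same \<open>t\<close> obeys both counts: the first, free of the pattern,
    bounds the search, and the second bounds the time per sequence.\<close>
  define t where "t = min (k * h) (1 + 4 * (a * k + 2 ^ h))"
  have "card \<Gamma> \<le> 2 ^ (k * h)"
    using card_mono[OF card_bounded_lists(1)[OF assms(4)] sub] card_bounded_lists(2)[OF assms(4)] by simp
  moreover have "card \<Gamma> \<le> 2 ^ (1 + 4 * (a * k + 2 ^ h))"
    unfolding \<Gamma>_def using assms(1,4) ext
    by (intro card_avoiding_sequences) (auto simp: is_permutation_def)
  ultimately have card: "card \<Gamma> \<le> 2 ^ t" by (simp add: t_def min_def)
  have len: "length x = k" if "x \<in> \<Gamma>" for x using that by (simp add: \<Gamma>_def)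
  obtain g where g: "\<forall>u. g u < k" "\<forall>x\<in>\<Gamma>. sorted (run_tree g (2 * (t + k)) x)"
    using exists_table[OF fin card assms(3) len] by blast
  have "t \<le> 1 + 4 * (a * k + 2 * k)"
    using assms(5) by (auto simp: t_def intro!: min.coboundedI2)
  then have "real t \<le> real (1 + 4 * (a * k + 2 * k))" by (rule of_nat_mono)
  also have "\<dots> = 1 + real k * (4 * real a + 8)" by (simp add: algebra_simps)
  also have "\<dots> \<le> real k * (4 * real a + 9)" using assms(3) by (simp add: algebra_simps)
  also have "\<dots> \<le> real k * (4 * log 2 c + 13)" using a(2) by (intro mult_left_mono) auto
  finally have t: "real t \<le> real k * (4 * log 2 c + 13)" .
  have "sorted (run_tree g (2 * (t + k)) s)" if s: "length s = k" "seq_avoids s \<pi>" for s :: "'a list"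
  proof -
    have "set (rank_list s) \<subseteq> {..<k}"
      using rank_list_less_length[of _ s] s(1) by auto
    then have "rank_list s \<in> \<Gamma>"
      using s by (simp add: \<Gamma>_def seq_contains_rank_list)
    then have "sorted (run_tree g (2 * (t + k)) (rank_list s))" using g(2) by blast
    moreover have "sorted (run_tree g (2 * (t + k)) (rank_list s)) \<longleftrightarrow> sorted (run_tree g (2 * (t + k)) s)"
    proof (rule sorted_run_tree_iff)
      show "g u < k" for u using g(1) by blast
    qed (simp_all add: s(1) rank_list_less_iff)
    ultimately show ?thesis by simp
  qed
  moreover have "t \<le> k * h" by (simp add: t_def)
  moreover have "g u < k" for u using g(1) by blast
  ultimately show ?thesis using that[of t g] t unfolding c_def by blast
qed

theorem theorem4p1:
  shows "\<exists>(P::com) (C::real) (f::nat \<Rightarrow> real).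
    f \<in> O(\<lambda>k. real k * log 2 (real k)) \<and>
    (\<forall>(\<pi>::nat list) (k::nat) (n::nat) (S::'a::linorder list list).
       is_permutation \<pi> \<longrightarrow> k \<ge> 1 \<longrightarrow> k dvd n \<longrightarrow> length S = n div k \<longrightarrow>
       (\<forall>s\<in>set S. length s = k \<and> seq_avoids s \<pi>) \<longrightarrow>
       sorts_all_in_time P k S
         (C * ((log 2 (furedi_hajnal_limit \<pi>) + 1) * real n) + 2 powr (2 powr (f k))))"
proof (rule exI[of _ sort_all_com], rule exI[of _ 142],
    rule exI[of _ "\<lambda>k. 4 * (real k * log 2 (real k)) + 16 * real k"],
    intro conjI allI impI additive_exponent_bigo)
  fix \<pi> :: "nat list" and k n :: nat and S :: "'a list list"
  assume \<pi>: "is_permutation \<pi>" and k: "k \<ge> 1" and n: "k dvd n" "length S = n div k"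
    and S: "\<forall>s\<in>set S. length s = k \<and> seq_avoids s \<pi>"
  have nS: "n = length S * k" using n by simp
  obtain h where h: "k \<le> 2 ^ h" "2 ^ h \<le> 2 * k" using ex_power_of_two_between[OF k] .
  let ?L = "log 2 (furedi_hajnal_limit \<pi>)"
  show "sorts_all_in_time sort_all_com k S (142 * ((?L + 1) * real n) +
    2 powr (2 powr (4 * (real k * log 2 (real k)) + 16 * real k)))"
  proof (cases "S = []")
    case True
    \<comment> \<open>Here \<open>n = 0\<close>, so the linear term vanishes whatever the value of
      the limit.\<close>
    then show ?thesis
      using nS by (intro sorts_all_in_time_if_table[of k S "\<lambda>_. 0" 0 h] k h) (use k in auto)
  next
    case False
    \<comment> \<open>A pattern with at most one entry is contained in every nonempty sequence, so
      it leaves nothing to sort.\<close>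
    have "length \<pi> \<ge> 2"
    proof (rule ccontr)
      assume short: "\<not> length \<pi> \<ge> 2"
      obtain s where "s \<in> set S" using False by fastforce
      then have "length s \<ge> 1" "seq_avoids s \<pi>" using S k by auto
      moreover have "seq_contains s \<pi>"
      proof -
        have "i = j" if "i < length \<pi>" "j < length \<pi>" for i j
          using short that by linarith
        then have "strict_mono_on {..<length \<pi>} (\<lambda>_. 0::nat)"
          "\<forall>i<length \<pi>. \<forall>j<length \<pi>. s ! 0 < s ! 0 \<longleftrightarrow> \<pi> ! i < \<pi> ! j"
          by (auto intro!: strict_mono_onI)
        then show ?thesis
          unfolding seq_contains_def using \<open>length s \<ge> 1\<close> by (intro exI[of _ "\<lambda>_. 0"]) auto
      qed
      ultimately show False by blast
    qed
    then obtain t g where t: "t \<le> k * h" "real t \<le> real k * (4 * ?L + 13)" and g: "\<And>u. g u < k"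
      "\<And>s :: 'a list. length s = k \<Longrightarrow> seq_avoids s \<pi> \<Longrightarrow> sorted (run_tree g (2 * (t + k)) s)"
      using exists_table_for_avoiders[OF \<pi> _ k h] by blast
    have L: "?L \<ge> 0"
      using furedi_hajnal_limit_bounds(1)[OF \<pi> \<open>length \<pi> \<ge> 2\<close>] by simp
    \<comment> \<open>38 = 8 + 13 + 17, and with the 13 in the bound on \<open>t\<close> the
      constant becomes 8 * 13 + 38 = 142.\<close>
    have "real (8 * (t + k) + 13 * k + 17) \<le> 8 * real t + 38 * real k" using k by simp
    also have "\<dots> \<le> real k * (32 * ?L + 142)" using t(2) by (simp add: algebra_simps)
    also have "\<dots> \<le> real k * (142 * (?L + 1))" using L by (intro mult_left_mono) auto
    finally have "real (length S) * real (8 * (t + k) + 13 * k + 17) \<le>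
        real (length S) * (real k * (142 * (?L + 1)))"
      by (rule mult_left_mono) simp
    then have "real (length S * (8 * (t + k) + 13 * k + 17)) \<le> 142 * ((?L + 1) * real n)"
      by (simp add: nS algebra_simps)
    then show ?thesis
      using S by (intro sorts_all_in_time_if_table[of k S g t h] k t h g) auto
  qed
qed

end
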